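(* Let $G$ be a connected acyclic finite quiver. Then, for every semi-root $s$ of $G$ and arbitrary edge parameters $\boldsymbol\beta=(\beta_\varepsilon)_{\varepsilon\in E_G}$, $$\omega_c(G;\boldsymbol\beta)=\mathcal M_s(G;\boldsymbol\beta):=\sum_{K\in\mathcal K_s(G)}\nu_G(K)\,B_{\nu_G(K)-1}\,\omega(K;\boldsymbol\beta)\sum_{\Gamma\in\mathcal W_s(G/K)}e(\Gamma)\,g_{\boldsymbol\beta}(G/K,\Gamma).$$ In particular, the right-hand side is independent of the choice of semi-root.
   Context: A (finite) quiver $G=(V_G,E_G,\rho_G)$ has finite sets $V_G,E_G$ and $\rho_G:E_G\to V_G\times V_G$, where $\rho_G(\varepsilon)=(u,v)$ is written $\varepsilon:u\to v$; parallel edges, directed cycles and tadpoles ($u\to u$) are allowed in general; acyclic means no directed cycle (tadpoles count as directed cycles); connected means nonempty with connected underlying undirected graph. Edges carry parameters $\beta_\varepsilon$ over a field of characteristic zero, kept by edges surviving in subquivers/contractions; $\beta_{\varepsilon,\pm}=(\beta_\varepsilon\pm1)/2$. A cut-subquiver $H\preceq G$ has vertex set $V_G$ and any $E_H\subseteq E_G$; the contraction $G/H$ has vertices the connected components of $H$ and edges $E_G\setminus E_H$ (with labels and directions retained) with induced incidences; it may contain directed cycles and tadpoles. For tadpole-free $G$, $e_0(G)=|\operatorname{LE}(G)|/|V_G|!$ if $G$ is acyclic ($\operatorname{LE}(G)$ = linear extensions of the partial order induced by the edges), $e_0(G)=0$ otherwise; in general $e(G)=\bigl(\prod_{\varepsilon\text{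 tadpole}}(-\beta_{\varepsilon,-})\bigr)e_0(G_{\mathrm{pruned}})$ with $G_{\mathrm{pruned}}$ obtained by deleting all tadpoles. $\omega$ is the unique function on quivers with $\sum_{H\preceq G}\omega(H)e(G/H)=\epsilon(G)$, $\epsilon(G)=1$ if $E_G=\emptyset$ and $0$ otherwise; $\omega_c(G)=\omega(G)$ for connected $G$, and $\omega_c(G)=0$ otherwise. A semi-root of $G$ is a vertex with no outgoing edge. $\mathcal K_s(G)$ is the set of cut-subquivers $K\preceq G$ in which $s$ is isolated. $\nu_G(K)$ is the number of connected components of $K$, i.e. $|V_{G/K}|$. The component $\{s\}$ of $K$ is the distinguished root vertex of $G/K$, again denoted $s$. $B_n$ are the Bernoulli numbers with $B_1=-\frac12$. A quiver $H$ with distinguished vertex $r$ is almost rooted if $r$ has no outgoing edge, every vertex $v\ne r$ has at least one outgoing edge, and every choice of one outgoing edge at each $v\ne r$ yields a rooted spanning tree oriented toward $r$. For an edge-labeled quiver $Q$ with distinguished vertex $s$, $\mathcal W_s(Q)$ (the spider webs) is the set of orientations $\Gamma$ of the underlying edge-labeled undirected graph of $Q$ such that $(\Gamma,s)$ is almost rooted (so $\mathcal W_s(Q)=\emptyset$ if $Q$ has a tadpole; parallel edges are distinct). For $\Gamma\in\mathcal W_s(Q)$ and $v\ne s$, $h_v(\Gamma)$ is the set of edges outgoing from $v$ in $\Gamma$, and for $h=h_v(\Gamma)$, $F_h(Q,\Gamma)$ is the set of edges of $h$ whose orientations in $\Gamma$ and in $Q$ are opposite. For $F\subseteq h$, $$s_{\boldsymbol\beta}(h,F)=\prod_{\varepsilon\in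 h\setminus F}\beta_{\varepsilon,+}\prod_{\varepsilon\in F}\beta_{\varepsilon,-}-\prod_{\varepsilon\in h\setminus F}\beta_{\varepsilon,-}\prod_{\varepsilon\in F}\beta_{\varepsilon,+},$$ and $g_{\boldsymbol\beta}(Q,\Gamma)=\prod_{v\neq s}s_{\boldsymbol\beta}\bigl(h_v(\Gamma),F_{h_v(\Gamma)}(Q,\Gamma)\bigr)$. *)

theory Defs
  imports Complex_Main "Graph_Theory.Digraph_Component"
begin

text \<open>
  A finite quiver is a \<^locale>\<open>fin_digraph\<close>: arcs are labels with a tail and a head, so parallel
  edges and tadpoles are allowed. Connectedness is \<^const>\<open>Digraph_Component.connected\<close> (a nonempty
  vertex set and a connected underlying undirected graph). The edge parameters are a single function
  \<open>\<beta>\<close> on labels; cut-subquivers, contractions and reorientations keep the labels and hence the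
  parameters.
\<close>

section \<open>Quivers, cut-subquivers, contractions\<close>

definition acyclic_quiver :: "('a, 'b) pre_digraph \<Rightarrow> bool" where
  "acyclic_quiver G \<longleftrightarrow> (\<nexists>p. pre_digraph.cycle G p)"

definition semi_root :: "('a, 'b) pre_digraph \<Rightarrow> 'a \<Rightarrow> bool" where
  "semi_root G s \<longleftrightarrow> s \<in> verts G \<and> out_arcs G s = {}"

definition cut_subquivers :: "('a, 'b) pre_digraph \<Rightarrow> ('a, 'b) pre_digraph set" where
  "cut_subquivers G = {H. spanning H G}"

text \<open>Components are represented by their vertex sets.\<close>

definition component_of :: "('a, 'b) pre_digraph \<Rightarrow> 'a \<Rightarrow> 'a set" where
  "component_of H v = pre_digraph.scc_of (with_proj (mk_symmetric H)) v"

definition components :: "('a, 'b) pre_digraph \<Rightarrow> 'a set set" where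
  "components H = pre_digraph.sccs_verts (with_proj (mk_symmetric H))"

definition contract :: "('a, 'b) pre_digraph \<Rightarrow> ('a, 'b) pre_digraph \<Rightarrow> ('a set, 'b) pre_digraph" where
  "contract G H = \<lparr> verts = components H, arcs = arcs G - arcs H,
     tail = (\<lambda>a. component_of H (tail G a)), head = (\<lambda>a. component_of H (head G a)) \<rparr>"

section \<open>The characters \<open>e\<close> and \<open>\<omega>\<close>\<close>

definition linear_extensions :: "('a, 'b) pre_digraph \<Rightarrow> 'a rel set" where
  "linear_extensions G =
     {r. linear_order_on (verts G) r \<and> {(u, v). u \<rightarrow>\<^sup>*\<^bsub>G\<^esub> v} \<subseteq> r}"

definition e0_char :: "('a, 'b) pre_digraph \<Rightarrow> 'k::field_char_0" where
  "e0_char G = (if acyclic_quiver G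
     then of_nat (card (linear_extensions G)) / fact (card (verts G)) else 0)"

definition tadpoles :: "('a, 'b) pre_digraph \<Rightarrow> 'b set" where
  "tadpoles G = {a \<in> arcs G. tail G a = head G a}"

definition prune :: "('a, 'b) pre_digraph \<Rightarrow> ('a, 'b) pre_digraph" where
  "prune G = G\<lparr>arcs := arcs G - tadpoles G\<rparr>"

definition beta_plus :: "('b \<Rightarrow> 'k::field_char_0) \<Rightarrow> 'b \<Rightarrow> 'k" where
  "beta_plus \<beta> a = (\<beta> a + 1) / 2"

definition beta_minus :: "('b \<Rightarrow> 'k::field_char_0) \<Rightarrow> 'b \<Rightarrow> 'k" where
  "beta_minus \<beta> a = (\<beta> a - 1) / 2"

definition e_char :: "('b \<Rightarrow> 'k::field_char_0) \<Rightarrow> ('a, 'b) pre_digraph \<Rightarrow> 'k" where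
  "e_char \<beta> G = (\<Prod>a\<in>tadpoles G. - beta_minus \<beta> a) * e0_char (prune G)"

definition counit :: "('a, 'b) pre_digraph \<Rightarrow> 'k::field_char_0" where
  "counit G = (if arcs G = {} then 1 else 0)"

definition omega_spec ::
  "('b \<Rightarrow> 'k::field_char_0) \<Rightarrow> (('a, 'b) pre_digraph \<Rightarrow> 'k) \<Rightarrow> bool" where
  "omega_spec \<beta> w \<longleftrightarrow>
     (\<forall>G. fin_digraph G \<longrightarrow> (\<Sum>H\<in>cut_subquivers G. w H * e_char \<beta> (contract G H)) = counit G)"

text \<open>
  The value 0 off the finite quivers is a convention that makes the function unique; existence and
  uniqueness are shown in \<open>omega_ex1\<close>.
\<close>

definition omega :: "('b \<Rightarrow> 'k::field_char_0) \<Rightarrow> ('a, 'b) pre_digraph \<Rightarrow> 'k" where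
  "omega \<beta> = (THE w. omega_spec \<beta> w \<and> (\<forall>G. \<not> fin_digraph G \<longrightarrow> w G = 0))"

definition omega_c :: "('b \<Rightarrow> 'k::field_char_0) \<Rightarrow> ('a, 'b) pre_digraph \<Rightarrow> 'k" where
  "omega_c \<beta> G = (if Digraph_Component.connected G then omega \<beta> G else 0)"

section \<open>Spider webs\<close>

text \<open>An in-arborescence: every vertex has exactly one directed walk to the root.\<close>

definition rooted_tree :: "('a, 'b) pre_digraph \<Rightarrow> 'a \<Rightarrow> bool" where
  "rooted_tree T r \<longleftrightarrow> r \<in> verts T \<and> (\<forall>v\<in>verts T. \<exists>!p. pre_digraph.awalk T v p r)"

definition almost_rooted :: "('a, 'b) pre_digraph \<Rightarrow> 'a \<Rightarrow> bool" where
  "almost_rooted H r \<longleftrightarrow> r \<in> verts H \<and> out_arcs H r = {} \<and>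
     (\<forall>v\<in>verts H - {r}. out_arcs H v \<noteq> {}) \<and>
     (\<forall>c. (\<forall>v\<in>verts H - {r}. c v \<in> out_arcs H v) \<longrightarrow>
        rooted_tree (H\<lparr>arcs := c ` (verts H - {r})\<rparr>) r)"

text \<open>
  The tail and head maps are total; fixing them off the arcs makes each orientation
  occur exactly once.
\<close>

definition orientations :: "('a, 'b) pre_digraph \<Rightarrow> ('a, 'b) pre_digraph set" where
  "orientations Q = {\<Gamma>. verts \<Gamma> = verts Q \<and> arcs \<Gamma> = arcs Q \<and>
     (\<forall>a\<in>arcs Q. arc_to_ends \<Gamma> a = arc_to_ends Q a \<or> arc_to_ends \<Gamma> a = prod.swap (arc_to_ends Q a)) \<and>
     (\<forall>a. a \<notin> arcs Q \<longrightarrow> arc_to_ends \<Gamma> a = arc_to_ends Q a)}"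

definition spider_webs :: "'a \<Rightarrow> ('a, 'b) pre_digraph \<Rightarrow> ('a, 'b) pre_digraph set" where
  "spider_webs s Q = {\<Gamma> \<in> orientations Q. almost_rooted \<Gamma> s}"

definition opposite_arcs :: "('a, 'b) pre_digraph \<Rightarrow> ('a, 'b) pre_digraph \<Rightarrow> 'b set \<Rightarrow> 'b set" where
  "opposite_arcs Q \<Gamma> h = {a \<in> h. arc_to_ends \<Gamma> a = prod.swap (arc_to_ends Q a)}"

definition s_coeff :: "('b \<Rightarrow> 'k::field_char_0) \<Rightarrow> 'b set \<Rightarrow> 'b set \<Rightarrow> 'k" where
  "s_coeff \<beta> h F =
     (\<Prod>a\<in>h - F. beta_plus \<beta> a) * (\<Prod>a\<in>F. beta_minus \<beta> a)
   - (\<Prod>a\<in>h - F. beta_minus \<beta> a) * (\<Prod>a\<in>F. beta_plus \<beta> a)"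

definition g_coeff ::
  "('b \<Rightarrow> 'k::field_char_0) \<Rightarrow> 'a \<Rightarrow> ('a, 'b) pre_digraph \<Rightarrow> ('a, 'b) pre_digraph \<Rightarrow> 'k" where
  "g_coeff \<beta> s Q \<Gamma> =
     (\<Prod>v\<in>verts Q - {s}. s_coeff \<beta> (out_arcs \<Gamma> v) (opposite_arcs Q \<Gamma> (out_arcs \<Gamma> v)))"

section \<open>The spider web sum\<close>

text \<open>The Bernoulli numbers with \<open>bernoulli 1 = -1/2\<close>.\<close>

fun bernoulli :: "nat \<Rightarrow> rat" where
  "bernoulli 0 = 1"
| "bernoulli (Suc n) = - (\<Sum>k\<le>n. of_nat ((n + 2) choose k) * bernoulli k) / of_nat (n + 2)"

definition isolating_cuts :: "'a \<Rightarrow> ('a, 'b) pre_digraph \<Rightarrow> ('a, 'b) pre_digraph set" where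
  "isolating_cuts s G = {K \<in> cut_subquivers G. \<forall>a\<in>arcs K. tail K a \<noteq> s \<and> head K a \<noteq> s}"

definition nu :: "('a, 'b) pre_digraph \<Rightarrow> nat" where
  "nu K = card (components K)"

text \<open>For \<open>K \<in> isolating_cuts s G\<close> the root vertex of \<open>contract G K\<close> is the component \<open>{s}\<close>.\<close>

definition spider_sum :: "('b \<Rightarrow> 'k::field_char_0) \<Rightarrow> 'a \<Rightarrow> ('a, 'b) pre_digraph \<Rightarrow> 'k" where
  "spider_sum \<beta> s G =
     (\<Sum>K\<in>isolating_cuts s G.
        of_nat (nu K) * of_rat (bernoulli (nu K - 1)) * omega \<beta> K *
        (\<Sum>\<Gamma>\<in>spider_webs {s} (contract G K). e_char \<beta> \<Gamma> * g_coeff \<beta> {s} (contract G K) \<Gamma>))"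

section \<open>Existence and uniqueness of \<open>\<omega>\<close>\<close>

lemma cut_subquivers_eq:
  assumes "wf_digraph G"
  shows "cut_subquivers G = (\<lambda>E. G\<lparr>arcs := E\<rparr>) ` Pow (arcs G)"
proof (intro equalityI subsetI)
  fix H assume "H \<in> cut_subquivers G"
  then have "arcs H \<subseteq> arcs G" "H = G\<lparr>arcs := arcs H\<rparr>"
    by (auto simp: cut_subquivers_def spanning_def subgraph_def compatible_def)
  then show "H \<in> (\<lambda>E. G\<lparr>arcs := E\<rparr>) ` Pow (arcs G)" by blast
next
  fix H assume "H \<in> (\<lambda>E. G\<lparr>arcs := E\<rparr>) ` Pow (arcs G)"
  then obtain E where "E \<subseteq> arcs G" "H = G\<lparr>arcs := E\<rparr>" by blast
  with assms show "H \<in> cut_subquivers G"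
    by (auto simp: cut_subquivers_def spanning_def subgraph_def compatible_def wf_digraph_def)
qed

lemma finite_cut_subquivers:
  assumes "fin_digraph G" shows "finite (cut_subquivers G)"
  using assms by (simp add: cut_subquivers_eq fin_digraph_def fin_digraph_axioms_def)

lemma cut_subquivers_self: "wf_digraph G \<Longrightarrow> G \<in> cut_subquivers G"
  by (auto simp: cut_subquivers_def spanning_def subgraph_def compatible_def)

lemma fin_digraph_cut:
  assumes "fin_digraph G" "H \<in> cut_subquivers G" shows "fin_digraph H"
  using assms
  by (auto simp: cut_subquivers_def spanning_def subgraph_def fin_digraph_def
      fin_digraph_axioms_def intro: finite_subset)

lemma card_arcs_cut_less:
  assumes "fin_digraph G" "H \<in> cut_subquivers G" "H \<noteq> G"
  shows "card (arcs H) < card (arcs G)"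
proof -
  obtain E where E: "E \<subseteq> arcs G" "H = G\<lparr>arcs := E\<rparr>"
    using assms(1,2) by (auto simp: cut_subquivers_eq fin_digraph_def)
  then have "E \<subset> arcs G" using assms(3) by auto
  then show ?thesis using assms(1) E
    by (auto simp: fin_digraph_def fin_digraph_axioms_def intro: psubset_card_mono)
qed

lemma finite_components:
  assumes "fin_digraph G" shows "finite (components G)"
proof -
  interpret fin_digraph G by fact
  have "S \<subseteq> verts G" if S: "S \<in> components G" for S
  proof
    fix u assume "u \<in> S"
    then have "u \<rightarrow>\<^sup>*\<^bsub>with_proj (mk_symmetric G)\<^esub> u"
      using S by (auto simp: components_def pre_digraph.sccs_verts_def)
    then show "u \<in> verts G"
      by (auto elim: reachable_in_vertsE simp: mk_symmetric_def)
  qed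
  then have "components G \<subseteq> Pow (verts G)" by blast
  then show ?thesis by (rule finite_subset) simp
qed

lemma e_char_contract_self:
  assumes "fin_digraph G"
  shows "e_char \<beta> (contract G G) \<noteq> 0"
proof -
  let ?Q = "contract G G"
  have fin: "finite (verts ?Q)"
    using finite_components[OF assms] by (simp add: contract_def)
  have noarcs: "arcs ?Q = {}" by (simp add: contract_def)
  then have tad: "tadpoles ?Q = {}" and pr: "prune ?Q = ?Q"
    by (simp_all add: tadpoles_def prune_def contract_def)
  have acyc: "acyclic_quiver ?Q"
    using noarcs by (auto simp: acyclic_quiver_def pre_digraph.cycle_def pre_digraph.awalk_def)
  obtain r where r: "well_order_on (verts ?Q) r" using well_order_on by blast
  then have lin: "linear_order_on (verts ?Q) r" by (simp add: well_order_on_def)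
  have "(u, v) \<in> r" if uv: "u \<rightarrow>\<^sup>*\<^bsub>?Q\<^esub> v" for u v
  proof -
    have "(u, v) \<in> rtrancl_on (verts ?Q) {}"
      using uv noarcs by (simp add: reachable_def arcs_ends_def)
    then have "u = v \<and> u \<in> verts ?Q" by (induction rule: rtrancl_on.induct) auto
    then show ?thesis using lin by (auto simp: order_on_defs refl_on_def)
  qed
  then have "r \<in> linear_extensions ?Q" using lin by (auto simp: linear_extensions_def)
  moreover have "linear_extensions ?Q \<subseteq> Pow (verts ?Q \<times> verts ?Q)"
    by (auto simp: linear_extensions_def order_on_defs)
  then have "finite (linear_extensions ?Q)"
    by (rule finite_subset) (use fin in auto)
  ultimately have "card (linear_extensions ?Q) \<noteq> 0" by auto
  then show ?thesis using acyc by (simp add: e_char_def tad pr e0_char_def)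
qed

lemma omega_spec_unique:
  assumes "omega_spec \<beta> w" "omega_spec \<beta> w'" "fin_digraph G"
  shows "w G = w' G"
  using assms(3)
proof (induction "card (arcs G)" arbitrary: G rule: less_induct)
  case less
  let ?t = "\<lambda>w H. w H * e_char \<beta> (contract G H)"
  have wf: "wf_digraph G" using less.prems by (simp add: fin_digraph_def)
  have split: "sum (?t v) (cut_subquivers G) = ?t v G + sum (?t v) (cut_subquivers G - {G})" for v
    using finite_cut_subquivers[OF less.prems] cut_subquivers_self[OF wf] by (rule sum.remove)
  have "sum (?t w) (cut_subquivers G) = sum (?t w') (cut_subquivers G)"
    using assms(1,2) less.prems by (simp add: omega_spec_def)
  moreover have "sum (?t w) (cut_subquivers G - {G}) = sum (?t w') (cut_subquivers G - {G})"
    using less.hyps card_arcs_cut_less[OF less.prems] fin_digraph_cut[OF less.prems]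
    by (intro sum.cong refl) auto
  ultimately have "?t w G = ?t w' G" by (simp add: split)
  then show ?case using e_char_contract_self[OF less.prems, of \<beta>] by simp
qed

lemma omega_spec_exists:
  fixes \<beta> :: "'b \<Rightarrow> 'k::field_char_0"
  shows "\<exists>w :: ('a, 'b) pre_digraph \<Rightarrow> 'k.
    omega_spec \<beta> w \<and> (\<forall>G. \<not> fin_digraph G \<longrightarrow> w G = 0)"
proof -
  define F where "F = (\<lambda>(w :: ('a, 'b) pre_digraph \<Rightarrow> 'k) G. if fin_digraph G
    then (counit G - (\<Sum>H\<in>cut_subquivers G - {G}. w H * e_char \<beta> (contract G H)))
      / e_char \<beta> (contract G G) else 0)"
  define w where "w = wfrec (measure (\<lambda>G. card (arcs G))) F"
  have w: "w G = F w G" for G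
  proof -
    have "w G = F (cut w (measure (\<lambda>G. card (arcs G))) G) G"
      unfolding w_def by (rule wfrec) simp
    also have "\<dots> = F w G"
      using card_arcs_cut_less[of G]
      by (auto simp: F_def cut_def intro!: arg_cong2[where f="(/)"] arg_cong2[where f="(-)"] sum.cong)
    finally show ?thesis .
  qed
  have "(\<Sum>H\<in>cut_subquivers G. w H * e_char \<beta> (contract G H)) = counit G"
    if G: "fin_digraph G" for G
  proof -
    have "G \<in> cut_subquivers G"
      using G cut_subquivers_self by (auto simp: fin_digraph_def)
    then show ?thesis
      using G e_char_contract_self[OF G, of \<beta>] w[of G]
      by (simp add: sum.remove[OF finite_cut_subquivers[OF G]] F_def)
  qed
  moreover have "w G = 0" if "\<not> fin_digraph G" for G
    using that by (simp add: w[of G] F_def)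
  ultimately have "omega_spec \<beta> w \<and> (\<forall>G. \<not> fin_digraph G \<longrightarrow> w G = 0)"
    by (simp add: omega_spec_def)
  then show ?thesis by blast
qed

lemma omega_ex1:
  fixes \<beta> :: "'b \<Rightarrow> 'k::field_char_0"
  shows "\<exists>!w :: ('a, 'b) pre_digraph \<Rightarrow> 'k.
    omega_spec \<beta> w \<and> (\<forall>G. \<not> fin_digraph G \<longrightarrow> w G = 0)"
proof (rule ex_ex1I[OF omega_spec_exists])
  fix w w' :: "('a, 'b) pre_digraph \<Rightarrow> 'k"
  assume "omega_spec \<beta> w \<and> (\<forall>G. \<not> fin_digraph G \<longrightarrow> w G = 0)"
    "omega_spec \<beta> w' \<and> (\<forall>G. \<not> fin_digraph G \<longrightarrow> w' G = 0)"
  then show "w = w'" by (metis ext omega_spec_unique)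
qed

lemma omega_spec_omega: "omega_spec \<beta> (omega \<beta>)"
  using theI'[OF omega_ex1] unfolding omega_def by blast

end

theory Submission
  imports Defs "HOL-Computational_Algebra.Polynomial" "HOL-Library.Disjoint_Sets"
begin

text \<open>
  For a set \<open>X\<close> of vertices consider the weighted count
  \<open>\<Phi>\<^bsub>X\<^esub>(N)\<close> of all maps \<open>x\<close> from \<open>X\<close> to \<open>{1..N}\<close>, in which an arc \<open>a\<close> from \<open>u\<close> to \<open>v\<close>
  inside \<open>X\<close> contributes \<open>beta_plus \<beta> a\<close> if \<open>x(u) < x(v)\<close> and \<open>beta_minus \<beta> a\<close> otherwise. It is a
  polynomial in \<open>N\<close>, namely the sum of \<open>\<omega>(H) N\<^bsup>\<nu>(H)\<^esup>\<close> times a normalized sum of weights over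
  the linear orders of the components of \<open>H\<close>, where \<open>H\<close> runs through the cuts of the subquiver
  induced on \<open>X\<close> whose contraction has no tadpole. This formula is taken below as the definition
  (\<open>Phi\<close>), and two properties are proved from it. At \<open>N = 1\<close> it is the product of all
  \<open>beta_minus\<close> (\<open>Phi_1\<close>): this is the defining recursion of \<open>\<omega>\<close> summed over all sets of arcs, where
  the value \<open>- beta_minus\<close> of \<open>e\<close> on tadpoles makes all contractions with a tadpole cancel. And
  \<open>\<Phi>\<^bsub>X\<^esub>(M + N)\<close> is a sum over the splittings of \<open>X\<close> into a lower part, evaluated
  at \<open>M\<close>, and an upper part, evaluated at \<open>N\<close> (\<open>Phi_add\<close>): this uses that \<open>\<omega>\<close> is multiplicative on
  disjoint unions (\<open>omega_disjoint_union\<close>) and a binomial theorem for sums over linear orders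
  (\<open>two_sided_const\<close>).

  If \<open>G\<close> is connected, then the linear coefficient of \<open>\<Phi>\<close> on all vertices of \<open>G\<close> is \<open>\<omega>(G)\<close>,
  because the only cut in the sum with one component is \<open>G\<close> itself. Let \<open>s\<close> be a semi-root. For an
  arc into \<open>s\<close>, a tail level with \<open>s\<close> has the same weight as a tail above \<open>s\<close>; so sorting the maps
  by the number \<open>k\<close> of elements of \<open>{1..N}\<close> below \<open>x(s)\<close> gives a sum over \<open>k < N\<close> of products
  \<open>\<Phi>\<^bsub>A\<^esub>(k) \<Phi>\<^bsub>B\<^esub>(N - k)\<close>, where \<open>A\<close> and \<open>B\<close> partition the
  other vertices (\<open>Phi_semi_root\<close>). The sum of \<open>k\<^bsup>i\<^esup> (N - k)\<^bsup>j\<^esup>\<close> over \<open>k < N\<close> is a polynomial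
  in \<open>N\<close> with linear coefficient \<open>(- 1)\<^bsup>j\<^esup> B\<^bsub>i + j\<^esub>\<close>. Comparing linear coefficients
  expresses \<open>\<omega>(G)\<close> as a sum over the cuts that isolate \<open>s\<close>, each with its Bernoulli number and with
  a signed sum over the linear orders of its components in which the sign counts the components above
  \<open>s\<close> (\<open>omega_eq_two_sided\<close>).

  This signed sum is the sum over spider webs. A spider web together with a linear extension is a
  linear order \<open>r\<close> of the vertices in which the orientation upwards along \<open>r\<close> has \<open>s\<close> as its only
  sink. For every other \<open>r\<close> the product \<open>g\<close> has a factor \<open>1 - 1\<close>, from a sink different from \<open>s\<close>, so
  the sum may be taken over all linear orders (\<open>sum_spider_webs\<close>). The two terms of the factor of
  \<open>g\<close> at \<open>v\<close> are the weights of \<open>v\<close> when it is placed below, and when it is placed above, everything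
  that lies above it in \<open>r\<close>. Expanding the product therefore starts with \<open>s\<close> and adds the other
  vertices one at a time at the bottom or, with a sign, at the top (\<open>order_sum_spider_weight\<close>).
\<close>

section \<open>Sums over linear orders\<close>

text \<open>
  Reflexive linear orders of a set; the bottom element is related to everything.
\<close>

definition linear_orders :: "'v set \<Rightarrow> 'v rel set" where
  "linear_orders X = {r. linear_order_on X r}"

definition strictly_above :: "'v rel \<Rightarrow> 'v \<Rightarrow> 'v set" where
  "strictly_above r v = {w. w \<noteq> v \<and> (v, w) \<in> r}"

text \<open>
  The sum over all linear orders of a product of local factors: the factor of \<open>v\<close> depends only on
  \<open>v\<close> and the set of elements above it. Such sums can be evaluated by removing the least element.
\<close>

definition order_sum :: "('v \<Rightarrow> 'v set \<Rightarrow> 'k) \<Rightarrow> 'v set \<Rightarrow> 'k::comm_ring_1" where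
  "order_sum \<phi> X = (\<Sum>r\<in>linear_orders X. \<Prod>v\<in>X. \<phi> v (strictly_above r v))"

lemma linear_orders_iff:
  "r \<in> linear_orders X \<longleftrightarrow> r \<subseteq> X \<times> X \<and> (\<forall>x\<in>X. (x, x) \<in> r) \<and> trans r \<and> antisym r \<and>
     (\<forall>x\<in>X. \<forall>y\<in>X. x \<noteq> y \<longrightarrow> (x, y) \<in> r \<or> (y, x) \<in> r)"
  by (auto simp: linear_orders_def order_on_defs refl_on_def total_on_def)

lemma linear_ordersD:
  assumes "r \<in> linear_orders X"
  shows "r \<subseteq> X \<times> X" "trans r" "antisym r" "x \<in> X \<Longrightarrow> (x, x) \<in> r"
    "x \<in> X \<Longrightarrow> y \<in> X \<Longrightarrow> (x, y) \<in> r \<or> (y, x) \<in> r"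
  using assms by (cases "x = y"; simp add: linear_orders_iff)+

lemma strictly_above_subset:
  assumes "r \<in> linear_orders X" shows "strictly_above r v \<subseteq> X"
  using linear_ordersD(1)[OF assms] unfolding strictly_above_def by blast

lemma finite_linear_orders: "finite X \<Longrightarrow> finite (linear_orders X)"
  by (rule finite_subset[of _ "Pow (X \<times> X)"]) (auto simp: linear_orders_iff)

lemma linear_orders_empty [simp]: "linear_orders {} = {{}}"
  by (auto simp: linear_orders_iff trans_def antisym_def)

lemma linear_order_least:
  assumes "r \<in> linear_orders X" "finite Y" "Y \<noteq> {}" "Y \<subseteq> X"
  shows "\<exists>x\<in>Y. \<forall>y\<in>Y. (x, y) \<in> r"
  using assms(2-4)
proof (induction rule: finite_ne_induct)
  case (singleton x)
  then show ?case using assms(1) by (auto simp: linear_orders_iff)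
next
  case (insert x F)
  then obtain m where m: "m \<in> F" "\<forall>y\<in>F. (m, y) \<in> r" by auto
  have refl: "(x, x) \<in> r" "(m, m) \<in> r" and tr: "trans r"
    using assms(1) insert.prems m by (auto simp: linear_orders_iff)
  have "(x, m) \<in> r \<or> (m, x) \<in> r"
    using assms(1) insert.prems insert.hyps m by (auto simp: linear_orders_iff)
  then show ?case using m refl tr by (auto dest: transD)
qed

lemma linear_order_greatest:
  assumes "r \<in> linear_orders X" "finite Y" "Y \<noteq> {}" "Y \<subseteq> X"
  shows "\<exists>x\<in>Y. \<forall>y\<in>Y. (y, x) \<in> r"
proof -
  have "r\<inverse> \<in> linear_orders X" using assms(1) by (simp add: linear_orders_def)
  from linear_order_least[OF this assms(2-4)] show ?thesis by simp
qed

text \<open>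
  A linear order of a nonempty finite set is its least element \<open>x\<close> together with a linear order of
  the rest.
\<close>

lemma bij_betw_linear_orders:
  assumes "finite X" "X \<noteq> {}"
  shows "bij_betw (\<lambda>(x, r). r \<union> {x} \<times> X) (SIGMA x:X. linear_orders (X - {x})) (linear_orders X)"
proof (rule bij_betw_imageI)
  show "inj_on (\<lambda>(x, r). r \<union> {x} \<times> X) (SIGMA x:X. linear_orders (X - {x}))"
  proof (rule inj_onI, clarify)
    fix x y r r'
    assume x: "x \<in> X" and y: "y \<in> X" and r: "r \<in> linear_orders (X - {x})"
      and r': "r' \<in> linear_orders (X - {y})" and eq: "r \<union> {x} \<times> X = r' \<union> {y} \<times> X"
    have sub: "r \<subseteq> (X - {x}) \<times> (X - {x})" "r' \<subseteq> (X - {y}) \<times> (X - {y})"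
      using r r' by (simp_all add: linear_orders_iff)
    have "(y, x) \<in> r \<union> {x} \<times> X" using eq x by blast
    then have xy: "x = y" using sub by blast
    moreover have "r = r'" using eq sub unfolding xy by blast
    ultimately show "x = y \<and> r = r'" by simp
  qed
  show "(\<lambda>(x, r). r \<union> {x} \<times> X) ` (SIGMA x:X. linear_orders (X - {x})) = linear_orders X"
  proof (intro equalityI subsetI)
    fix r assume "r \<in> (\<lambda>(x, r). r \<union> {x} \<times> X) ` (SIGMA x:X. linear_orders (X - {x}))"
    then obtain x r0 where "x \<in> X" "r0 \<in> linear_orders (X - {x})" "r = r0 \<union> {x} \<times> X" by auto
    then show "r \<in> linear_orders X"
      by (auto simp: linear_orders_iff intro!: transI antisymI dest: transD antisymD)
  next
    fix r assume r: "r \<in> linear_orders X"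
    obtain x where x: "x \<in> X" "\<forall>y\<in>X. (x, y) \<in> r"
      using linear_order_least[OF r assms] by auto
    let ?r0 = "r \<inter> (X - {x}) \<times> (X - {x})"
    have "?r0 \<in> linear_orders (X - {x})"
      using r by (auto simp: linear_orders_iff intro!: transI antisymI dest: transD antisymD)
    moreover have "r = ?r0 \<union> {x} \<times> X"
    proof -
      have "(y, x) \<in> r \<Longrightarrow> y = x" for y
        using r x by (auto simp: linear_orders_iff dest: antisymD)
      moreover have "r \<subseteq> X \<times> X" using r by (simp add: linear_orders_iff)
      ultimately show ?thesis using x by blast
    qed
    ultimately show "r \<in> (\<lambda>(x, r). r \<union> {x} \<times> X) ` (SIGMA x:X. linear_orders (X - {x}))"
      using x(1) by (intro image_eqI[of _ _ "(x, ?r0)"]) auto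
  qed
qed

lemma order_sum_empty [simp]: "order_sum \<phi> {} = 1"
  by (simp add: order_sum_def)

lemma order_sum_rec:
  assumes "finite X" "X \<noteq> {}"
  shows "order_sum \<phi> X = (\<Sum>x\<in>X. \<phi> x (X - {x}) * order_sum \<phi> (X - {x}))"
proof -
  have "order_sum \<phi> X = (\<Sum>(x, r)\<in>(SIGMA x:X. linear_orders (X - {x})).
      \<Prod>v\<in>X. \<phi> v (strictly_above (r \<union> {x} \<times> X) v))"
    unfolding order_sum_def
    by (subst sum.reindex_bij_betw[OF bij_betw_linear_orders[OF assms], symmetric])
      (simp add: case_prod_beta)
  also have "\<dots> = (\<Sum>x\<in>X. \<Sum>r\<in>linear_orders (X - {x}). \<Prod>v\<in>X. \<phi> v (strictly_above (r \<union> {x} \<times> X) v))"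
    by (rule sum.Sigma[symmetric]) (use assms finite_linear_orders in auto)
  also have "\<dots> = (\<Sum>x\<in>X. \<phi> x (X - {x}) * order_sum \<phi> (X - {x}))"
  proof (rule sum.cong[OF refl])
    fix x assume x: "x \<in> X"
    have "(\<Prod>v\<in>X. \<phi> v (strictly_above (r \<union> {x} \<times> X) v))
        = \<phi> x (X - {x}) * (\<Prod>v\<in>X - {x}. \<phi> v (strictly_above r v))"
      if r: "r \<in> linear_orders (X - {x})" for r
    proof -
      have "strictly_above (r \<union> {x} \<times> X) x = X - {x}"
        using r by (auto simp: strictly_above_def linear_orders_iff)
      moreover have "strictly_above (r \<union> {x} \<times> X) v = strictly_above r v" if "v \<in> X - {x}" for v
        using that by (auto simp: strictly_above_def)
      ultimately show ?thesis
        using x assms(1) by (subst prod.remove[of _ x]) auto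
    qed
    then show "(\<Sum>r\<in>linear_orders (X - {x}). \<Prod>v\<in>X. \<phi> v (strictly_above (r \<union> {x} \<times> X) v))
        = \<phi> x (X - {x}) * order_sum \<phi> (X - {x})"
      by (simp add: order_sum_def sum_distrib_left)
  qed
  finally show ?thesis .
qed

text \<open>
  The weight of placing all of \<open>A\<close> below all of \<open>B\<close>, where \<open>c u v\<close> is the weight of \<open>u\<close> below \<open>v\<close>.
\<close>

definition pair_weight :: "('v \<Rightarrow> 'v \<Rightarrow> 'k) \<Rightarrow> 'v set \<Rightarrow> 'v set \<Rightarrow> 'k::comm_ring_1" where
  "pair_weight c A B = (\<Prod>u\<in>A. \<Prod>v\<in>B. c u v)"

text \<open>
  The average weight of a random linear order of \<open>X\<close>. Equivalently, this is the integral over the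
  unit cube of the product of the weights \<open>c u v\<close> over all pairs with \<open>x(u) < x(v)\<close>.
\<close>

definition order_vol :: "('v \<Rightarrow> 'v \<Rightarrow> 'k) \<Rightarrow> 'v set \<Rightarrow> 'k::field_char_0" where
  "order_vol c X = order_sum (\<lambda>v W. pair_weight c {v} W) X / fact (card X)"

lemma pair_weight_empty [simp]: "pair_weight c {} B = 1" "pair_weight c A {} = 1"
  by (simp_all add: pair_weight_def)

lemma pair_weight_insert_left: "finite A \<Longrightarrow> x \<notin> A \<Longrightarrow> pair_weight c (insert x A) B
    = pair_weight c {x} B * pair_weight c A B"
  by (simp add: pair_weight_def)

lemma pair_weight_insert_right: "finite B \<Longrightarrow> x \<notin> B \<Longrightarrow> pair_weight c A (insert x B)
    = pair_weight c A {x} * pair_weight c A B"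
  by (simp add: pair_weight_def prod.distrib)

lemma order_vol_empty [simp]: "order_vol c {} = 1"
  by (simp add: order_vol_def)

lemma order_vol_singleton [simp]: "order_vol c {x} = 1"
  by (simp add: order_vol_def order_sum_rec)

lemma order_vol_cong:
  assumes "\<And>u v. u \<in> X \<Longrightarrow> v \<in> X \<Longrightarrow> u \<noteq> v \<Longrightarrow> c u v = d u v"
  shows "order_vol c X = order_vol d X"
proof -
  have "order_sum (\<lambda>v W. pair_weight c {v} W) X = order_sum (\<lambda>v W. pair_weight d {v} W) X"
    unfolding order_sum_def
  proof (intro sum.cong prod.cong refl)
    fix r v assume r: "r \<in> linear_orders X" and v: "v \<in> X"
    have "strictly_above r v \<subseteq> X - {v}"
      using r by (auto simp: linear_orders_iff strictly_above_def)
    then show "pair_weight c {v} (strictly_above r v) = pair_weight d {v} (strictly_above r v)"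
      using v assms by (auto simp: pair_weight_def intro!: prod.cong)
  qed
  then show ?thesis by (simp add: order_vol_def)
qed

lemma order_vol_bottom:
  assumes "finite X"
  shows "of_nat (card X) * order_vol c X = (\<Sum>x\<in>X. pair_weight c {x} (X - {x}) * order_vol c
      (X - {x}))"
proof (cases "X = {}")
  case False
  then obtain n where n: "card X = Suc n" using assms by (cases "card X") auto
  have "(\<Sum>x\<in>X. pair_weight c {x} (X - {x}) * order_vol c (X - {x}))
      = (\<Sum>x\<in>X. pair_weight c {x} (X - {x}) * order_sum (\<lambda>v W. pair_weight c {v} W)
          (X - {x})) / fact n"
    unfolding sum_divide_distrib by (intro sum.cong refl) (use n assms in \<open>auto simp: order_vol_def\<close>)
  also have "\<dots> = order_sum (\<lambda>v W. pair_weight c {v} W) X / fact n"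
    using assms False by (simp add: order_sum_rec)
  also have "\<dots> = of_nat (card X) * order_vol c X"
    by (simp add: order_vol_def n del: of_nat_Suc)
  finally show ?thesis by simp
qed simp

text \<open>
  Removing the greatest instead of the least element: both recursions, iterated, remove the least
  and the greatest element, in the two possible orders.
\<close>

lemma order_vol_top:
  assumes "finite X"
  shows "of_nat (card X) * order_vol c X = (\<Sum>x\<in>X. pair_weight c (X - {x}) {x} * order_vol c
      (X - {x}))"
  using assms
proof (induction "card X" arbitrary: X)
  case 0
  then show ?case by simp
next
  case (Suc n)
  note cX = Suc.hyps(2)[symmetric] and fin = Suc.prems
  show ?case
  proof (cases "n = 0")
    case True
    then obtain x where "X = {x}" using cX by (auto simp: card_1_singleton_iff)
    then show ?thesis using order_vol_bottom[OF fin, of c] by simp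
  next
    case False
    have top: "of_nat n * order_vol c (X - {x}) = (\<Sum>y\<in>X - {x}. pair_weight c (X - {x} - {y}) {y}
        * order_vol c (X - {x} - {y}))"
      if "x \<in> X" for x
      using Suc.hyps(1)[of "X - {x}"] that fin cX by simp
    have bot: "of_nat n * order_vol c (X - {x}) = (\<Sum>y\<in>X - {x}. pair_weight c {y} (X - {x} - {y})
        * order_vol c (X - {x} - {y}))"
      if "x \<in> X" for x
      using order_vol_bottom[of "X - {x}" c] that fin cX by simp
    have eq: "pair_weight c {x} (X - {x}) * (pair_weight c (X - {x} - {y}) {y} * v)
        = pair_weight c (X - {y}) {y} * (pair_weight c {x} (X - {y} - {x}) * v)"
      if "x \<in> X" "y \<in> X" "x \<noteq> y" for x y v
    proof -
      have "pair_weight c {x} (X - {x}) = pair_weight c {x} {y} * pair_weight c {x} (X - {x} - {y})"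
        using pair_weight_insert_right[of "X - {x} - {y}" y c "{x}"] that fin
        by (simp add: insert_absorb)
      moreover have "pair_weight c (X - {y}) {y} = pair_weight c {x} {y} * pair_weight c
          (X - {y} - {x}) {y}"
        using pair_weight_insert_left[of "X - {y} - {x}" x c "{y}"] that fin
        by (simp add: insert_absorb)
      moreover have "X - {y} - {x} = X - {x} - {y}" by auto
      ultimately show ?thesis by (simp add: algebra_simps)
    qed
    have "of_nat n * (of_nat (card X) * order_vol c X)
        = (\<Sum>x\<in>X. pair_weight c {x} (X - {x}) * (of_nat n * order_vol c (X - {x})))"
      by (simp add: order_vol_bottom[OF fin] sum_distrib_left algebra_simps)
    also have "\<dots> = (\<Sum>x\<in>X. \<Sum>y\<in>X - {x}.
        pair_weight c {x} (X - {x}) * (pair_weight c (X - {x} - {y}) {y} * order_vol c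
            (X - {x} - {y})))"
      by (intro sum.cong refl) (simp add: top sum_distrib_left)
    also have "\<dots> = (\<Sum>x\<in>X. \<Sum>y\<in>X - {x}.
        pair_weight c (X - {y}) {y} * (pair_weight c {x} (X - {y} - {x}) * order_vol c
            (X - {y} - {x})))"
      by (intro sum.cong refl) (use eq in \<open>auto simp: Diff_insert2[symmetric] insert_commute\<close>)
    also have "\<dots> = (\<Sum>y\<in>X. \<Sum>x\<in>X - {y}.
        pair_weight c (X - {y}) {y} * (pair_weight c {x} (X - {y} - {x}) * order_vol c
            (X - {y} - {x})))"
    proof -
      have "(\<Sum>x\<in>X. \<Sum>y\<in>X - {x}. g x y) = (\<Sum>y\<in>X. \<Sum>x\<in>X - {y}. g x y)" for g :: "'a \<Rightarrow> 'a \<Rightarrow> 'b"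
      proof -
        have s: "(\<Sum>y\<in>X - {x}. h y) = (\<Sum>y\<in>X. if y = x then 0 else h y)" for x and h :: "'a \<Rightarrow> 'b"
          using fin by (intro sum.mono_neutral_cong_left) auto
        show ?thesis unfolding s by (subst sum.swap) (intro sum.cong refl, auto)
      qed
      then show ?thesis .
    qed
    also have "\<dots> = (\<Sum>y\<in>X. pair_weight c (X - {y}) {y} * (of_nat n * order_vol c (X - {y})))"
      by (intro sum.cong refl) (simp add: bot sum_distrib_left)
    also have "\<dots> = of_nat n * (\<Sum>y\<in>X. pair_weight c (X - {y}) {y} * order_vol c (X - {y}))"
      by (simp add: sum_distrib_left algebra_simps)
    finally show ?thesis using False by simp
  qed
qed

lemma sum_Pow_member_swap:
  assumes "finite X"
  shows "(\<Sum>A\<in>Pow X. \<Sum>x\<in>A. g x A) = (\<Sum>x\<in>X. \<Sum>A\<in>Pow (X - {x}). g x (insert x A))"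
proof -
  have "(\<Sum>A\<in>Pow X. \<Sum>x\<in>A. g x A) = (\<Sum>(A, x)\<in>(SIGMA A:Pow X. A). g x A)"
    using assms by (intro sum.Sigma) (auto intro: finite_subset)
  also have "\<dots> = (\<Sum>(x, A)\<in>(SIGMA x:X. Pow (X - {x})). g x (insert x A))"
    by (rule sum.reindex_bij_witness[of _ "\<lambda>(x, A). (insert x A, x)" "\<lambda>(A, x). (x, A - {x})"])
      (auto simp: insert_absorb)
  also have "\<dots> = (\<Sum>x\<in>X. \<Sum>A\<in>Pow (X - {x}). g x (insert x A))"
    using assms by (intro sum.Sigma[symmetric]) auto
  finally show ?thesis .
qed

lemma sum_Pow_nonmember_swap:
  assumes "finite X"
  shows "(\<Sum>A\<in>Pow X. \<Sum>x\<in>X - A. g x A) = (\<Sum>x\<in>X. \<Sum>A\<in>Pow (X - {x}). g x A)"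
proof -
  have "(\<Sum>A\<in>Pow X. \<Sum>x\<in>X - A. g x A) = (\<Sum>(A, x)\<in>(SIGMA A:Pow X. X - A). g x A)"
    using assms by (intro sum.Sigma) (auto intro: finite_subset)
  also have "\<dots> = (\<Sum>(x, A)\<in>(SIGMA x:X. Pow (X - {x})). g x A)"
    by (rule sum.reindex_bij_witness[of _ "\<lambda>(x, A). (A, x)" "\<lambda>(A, x). (x, A)"]) auto
  also have "\<dots> = (\<Sum>x\<in>X. \<Sum>A\<in>Pow (X - {x}). g x A)"
    using assms by (intro sum.Sigma[symmetric]) auto
  finally show ?thesis .
qed

lemma sum_Pow_chain:
  assumes "finite X"
  shows "(\<Sum>A\<in>Pow X. \<Sum>B\<in>Pow A. g B A) = (\<Sum>B\<in>Pow X. \<Sum>C\<in>Pow (X - B). g B (B \<union> C))"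
proof -
  have "(\<Sum>A\<in>Pow X. \<Sum>B\<in>Pow A. g B A) = (\<Sum>(A, B)\<in>(SIGMA A:Pow X. Pow A). g B A)"
    using assms by (intro sum.Sigma) (auto intro: finite_subset)
  also have "\<dots> = (\<Sum>(B, C)\<in>(SIGMA B:Pow X. Pow (X - B)). g B (B \<union> C))"
    by (rule sum.reindex_bij_witness[of _ "\<lambda>(B, C). (B \<union> C, B)" "\<lambda>(A, B). (B, A - B)"])
      (auto simp: Un_absorb1)
  also have "\<dots> = (\<Sum>B\<in>Pow X. \<Sum>C\<in>Pow (X - B). g B (B \<union> C))"
    using assms by (intro sum.Sigma[symmetric]) auto
  finally show ?thesis .
qed

text \<open>
  The sum over all splittings of \<open>X\<close> into a lower part \<open>A\<close> and an upper part, with an extra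
  factor \<open>p u\<close> for every lower and \<open>q u\<close> for every upper element. The factors record a scale (an
  interval of length \<open>p\<close> below one of length \<open>q\<close>) or a further element between the two parts.
\<close>

definition two_sided ::
  "('v \<Rightarrow> 'v \<Rightarrow> 'k) \<Rightarrow> ('v \<Rightarrow> 'k) \<Rightarrow> ('v \<Rightarrow> 'k) \<Rightarrow> 'v set \<Rightarrow> 'k::field_char_0" where
  "two_sided c p q X = (\<Sum>A\<in>Pow X. (\<Prod>u\<in>A. p u) * (\<Prod>u\<in>X - A. q u) *
     pair_weight c A (X - A) * order_vol c A * order_vol c (X - A))"

lemma two_sided_empty [simp]: "two_sided c p q {} = 1"
  by (simp add: two_sided_def)

lemma two_sided_scale:
  "two_sided c (\<lambda>x. p x * a) (\<lambda>x. q x * b) X = (\<Sum>A\<in>Pow X. (\<Prod>u\<in>A. p u) * (\<Prod>u\<in>X - A. q u) *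
     pair_weight c A (X - A) * order_vol c A * order_vol c (X - A) * (a ^ card A * b ^ card (X - A)))"
  unfolding two_sided_def by (intro sum.cong refl) (simp add: prod.distrib)

lemma two_sided_cong:
  assumes "\<And>u v. u \<in> X \<Longrightarrow> v \<in> X \<Longrightarrow> u \<noteq> v \<Longrightarrow> c u v = d u v"
    and "\<And>u. u \<in> X \<Longrightarrow> p u = p' u" "\<And>u. u \<in> X \<Longrightarrow> q u = q' u"
  shows "two_sided c p q X = two_sided d p' q' X"
  unfolding two_sided_def
proof (rule sum.cong[OF refl])
  fix A assume "A \<in> Pow X"
  then have A: "A \<subseteq> X" by simp
  have "pair_weight c A (X - A) = pair_weight d A (X - A)"
    unfolding pair_weight_def using A assms(1) by (intro prod.cong refl) auto
  moreover have "order_vol c A = order_vol d A" "order_vol c (X - A) = order_vol d (X - A)"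
    using A assms(1) by (intro order_vol_cong; auto)+
  moreover have "(\<Prod>u\<in>A. p u) = (\<Prod>u\<in>A. p' u)" "(\<Prod>u\<in>X - A. q u) = (\<Prod>u\<in>X - A. q' u)"
    using A assms(2,3) by (auto intro!: prod.cong)
  ultimately show "(\<Prod>u\<in>A. p u) * (\<Prod>u\<in>X - A. q u) * pair_weight c A (X - A) * order_vol c A
      * order_vol c (X - A)
      = (\<Prod>u\<in>A. p' u) * (\<Prod>u\<in>X - A. q' u) * pair_weight d A (X - A) * order_vol d A * order_vol d
          (X - A)"
    by simp
qed

text \<open>
  The outermost element is removed: the least element of the lower part or the greatest element of the
  upper part.
\<close>

lemma two_sided_rec:
  assumes fin: "finite X"
  shows "of_nat (card X) * two_sided c p q X =
    (\<Sum>x\<in>X. (p x * pair_weight c {x} (X - {x}) + q x * pair_weight c (X - {x}) {x}) * two_sided c p q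
        (X - {x}))"
proof -
  define w where "w X A = (\<Prod>u\<in>A. p u) * (\<Prod>u\<in>X - A. q u) * pair_weight c A (X - A)" for X A
  have w: "two_sided c p q X = (\<Sum>A\<in>Pow X. w X A * order_vol c A * order_vol c (X - A))" for X
    by (simp add: two_sided_def w_def)
  have finA: "finite A" if "A \<in> Pow X" for A using that fin by (auto intro: finite_subset)
  have lower: "w X (insert x A) * pair_weight c {x} (insert x A - {x})
      = p x * pair_weight c {x} (X - {x}) * w (X - {x}) A"
    if x: "x \<in> X" and A: "A \<in> Pow (X - {x})" for x A
  proof -
    have A': "finite A" "x \<notin> A" "X - insert x A = X - {x} - A"
      using A finA by auto
    have "pair_weight c {x} (X - {x}) = pair_weight c {x} A * pair_weight c {x} (X - {x} - A)"
      using A fin by (simp add: pair_weight_def prod.subset_diff[of A "X - {x}"] mult.commute)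
    then show ?thesis using A' by (simp add: w_def pair_weight_insert_left[of A x] algebra_simps)
  qed
  have upper: "w X A * pair_weight c (X - A - {x}) {x} = q x * pair_weight c (X - {x}) {x} * w
      (X - {x}) A"
    if x: "x \<in> X" and A: "A \<in> Pow (X - {x})" for x A
  proof -
    have A': "finite A" "x \<notin> A" "X - A = insert x (X - {x} - A)" "X - A - {x} = X - {x} - A"
      using A x finA by auto
    have "pair_weight c (X - {x}) {x} = pair_weight c A {x} * pair_weight c (X - {x} - A) {x}"
      using A fin by (simp add: pair_weight_def prod.subset_diff[of A "X - {x}"] mult.commute)
    moreover have "pair_weight c A (X - A) = pair_weight c A {x} * pair_weight c A (X - {x} - A)"
      using fin by (subst A'(3), subst pair_weight_insert_right) auto
    moreover have "(\<Prod>u\<in>X - A. q u) = q x * (\<Prod>u\<in>X - {x} - A. q u)"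
      using fin by (subst A'(3), subst prod.insert) auto
    ultimately show ?thesis unfolding w_def A'(4) by (simp add: algebra_simps)
  qed
  have "of_nat (card X) * two_sided c p q X
      = (\<Sum>A\<in>Pow X. w X A * (of_nat (card A) * order_vol c A) * order_vol c (X - A))
      + (\<Sum>A\<in>Pow X. w X A * order_vol c A * (of_nat (card (X - A)) * order_vol c (X - A)))"
  proof -
    have "of_nat (card X) = (of_nat (card A) + of_nat (card (X - A)) :: 'b)" if "A \<in> Pow X" for A
      using that fin finA[OF that]
      by (simp add: card_Diff_subset card_mono of_nat_diff)
    then show ?thesis
      unfolding w sum_distrib_left sum.distrib[symmetric]
      by (intro sum.cong refl) (simp add: algebra_simps)
  qed
  also have "(\<Sum>A\<in>Pow X. w X A * (of_nat (card A) * order_vol c A) * order_vol c (X - A))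
      = (\<Sum>A\<in>Pow X. \<Sum>x\<in>A. w X A * (pair_weight c {x} (A - {x}) * order_vol c (A - {x})) * order_vol c
          (X - A))"
    by (intro sum.cong refl) (simp add: order_vol_bottom finA sum_distrib_left sum_distrib_right)
  also have "\<dots> = (\<Sum>x\<in>X. \<Sum>A\<in>Pow (X - {x}). w X (insert x A) *
      (pair_weight c {x} (insert x A - {x}) * order_vol c (insert x A - {x})) * order_vol c
          (X - insert x A))"
    by (rule sum_Pow_member_swap[OF fin])
  also have "\<dots> = (\<Sum>x\<in>X. p x * pair_weight c {x} (X - {x}) * two_sided c p q (X - {x}))"
    unfolding w sum_distrib_left
  proof (intro sum.cong refl)
    fix x A assume x: "x \<in> X" and A: "A \<in> Pow (X - {x})"
    have "insert x A - {x} = A" "X - insert x A = X - {x} - A" using A by auto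
    then show "w X (insert x A) * (pair_weight c {x} (insert x A - {x}) * order_vol c
        (insert x A - {x})) * order_vol c (X - insert x A)
        = p x * pair_weight c {x} (X - {x}) * (w (X - {x}) A * order_vol c A * order_vol c
            (X - {x} - A))"
      using lower[OF x A] by (simp add: mult.assoc[symmetric])
  qed
  also have "(\<Sum>A\<in>Pow X. w X A * order_vol c A * (of_nat (card (X - A)) * order_vol c (X - A)))
      = (\<Sum>A\<in>Pow X. \<Sum>x\<in>X - A. w X A * order_vol c A * (pair_weight c (X - A - {x}) {x} * order_vol c
          (X - A - {x})))"
    by (intro sum.cong refl) (use fin in \<open>simp add: order_vol_top sum_distrib_left sum_distrib_right\<close>)
  also have "\<dots> = (\<Sum>x\<in>X. \<Sum>A\<in>Pow (X - {x}).
      w X A * order_vol c A * (pair_weight c (X - A - {x}) {x} * order_vol c (X - A - {x})))"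
    by (rule sum_Pow_nonmember_swap[OF fin])
  also have "\<dots> = (\<Sum>x\<in>X. q x * pair_weight c (X - {x}) {x} * two_sided c p q (X - {x}))"
    unfolding w sum_distrib_left
  proof (intro sum.cong refl)
    fix x A assume x: "x \<in> X" and A: "A \<in> Pow (X - {x})"
    have eq: "X - A - {x} = X - {x} - A" by auto
    have "w X A * order_vol c A * (pair_weight c (X - A - {x}) {x} * order_vol c (X - A - {x}))
        = (w X A * pair_weight c (X - A - {x}) {x}) * (order_vol c A * order_vol c (X - {x} - A))"
      unfolding eq by (simp only: mult_ac)
    also have "\<dots> = q x * pair_weight c (X - {x}) {x} * (w (X - {x}) A * order_vol c A * order_vol c
        (X - {x} - A))"
      unfolding upper[OF x A] by (simp only: mult_ac)
    finally show "w X A * order_vol c A * (pair_weight c (X - A - {x}) {x} * order_vol c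
        (X - A - {x}))
        = q x * pair_weight c (X - {x}) {x} * (w (X - {x}) A * order_vol c A * order_vol c
            (X - {x} - A))" .
  qed
  finally show ?thesis by (simp only: sum.distrib distrib_right)
qed

text \<open>
  The binomial theorem for averages over linear orders.
\<close>

lemma two_sided_const:
  assumes "finite X"
  shows "two_sided c (\<lambda>_. a) (\<lambda>_. b) X = (a + b) ^ card X * order_vol c X"
  using assms
proof (induction "card X" arbitrary: X)
  case 0
  then show ?case by simp
next
  case (Suc n)
  note cX = Suc.hyps(2)[symmetric] and fin = Suc.prems
  have "of_nat (card X) * two_sided c (\<lambda>_. a) (\<lambda>_. b) X
      = (\<Sum>x\<in>X. (a * pair_weight c {x} (X - {x}) + b * pair_weight c (X - {x}) {x}) * ((a + b) ^ n
          * order_vol c (X - {x})))"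
    unfolding two_sided_rec[OF fin]
  proof (intro sum.cong refl)
    fix x assume "x \<in> X"
    then have "card (X - {x}) = n" using cX by simp
    then show "(a * pair_weight c {x} (X - {x}) + b * pair_weight c (X - {x}) {x}) * two_sided c
        (\<lambda>_. a) (\<lambda>_. b) (X - {x})
       = (a * pair_weight c {x} (X - {x}) + b * pair_weight c (X - {x}) {x}) * ((a + b) ^ n
           * order_vol c (X - {x}))"
      using Suc.hyps(1)[of "X - {x}"] fin by simp
  qed
  also have "\<dots> = a * (a + b) ^ n * (\<Sum>x\<in>X. pair_weight c {x} (X - {x}) * order_vol c (X - {x}))
      + b * (a + b) ^ n * (\<Sum>x\<in>X. pair_weight c (X - {x}) {x} * order_vol c (X - {x}))"
    by (simp add: sum_distrib_left sum.distrib[symmetric] algebra_simps)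
  also have "\<dots> = of_nat (card X) * ((a + b) ^ card X * order_vol c X)"
    unfolding order_vol_bottom[OF fin, symmetric] order_vol_top[OF fin, symmetric] cX power_Suc
    by (simp only: distrib_right distrib_left mult_ac)
  finally show ?case using cX by (simp del: of_nat_Suc)
qed

lemma order_vol_disjoint_union:
  assumes "finite X" "finite Y" "X \<inter> Y = {}"
    and "\<And>x y. x \<in> X \<Longrightarrow> y \<in> Y \<Longrightarrow> c x y = 1 \<and> c y x = 1"
  shows "order_vol c (X \<union> Y) = order_vol c X * order_vol c Y"
  using assms
proof (induction "card (X \<union> Y)" arbitrary: X Y)
  case 0
  then show ?case by simp
next
  case (Suc n)
  note fin = Suc.prems(1,2) and disj = Suc.prems(3) and one = Suc.prems(4)
  have cw1: "pair_weight c {x} (X \<union> Y - {x}) = pair_weight c {x} (X - {x})" if "x \<in> X" for x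
  proof -
    have "X \<union> Y - {x} = (X - {x}) \<union> Y" using that disj by auto
    then show ?thesis using that one fin disj
      by (simp add: pair_weight_def prod.union_disjoint Int_Diff_disjoint Diff_Int_distrib2)
  qed
  have cw2: "pair_weight c {y} (X \<union> Y - {y}) = pair_weight c {y} (Y - {y})" if "y \<in> Y" for y
  proof -
    have "X \<union> Y - {y} = (Y - {y}) \<union> X" "(Y - {y}) \<inter> X = {}" using that disj by auto
    then show ?thesis using that one fin
      by (simp add: pair_weight_def prod.union_disjoint)
  qed
  have v1: "order_vol c (X \<union> Y - {x}) = order_vol c (X - {x}) * order_vol c Y" if "x \<in> X" for x
  proof -
    have "X \<union> Y - {x} = (X - {x}) \<union> Y" using that disj by auto
    moreover have "card (X \<union> Y - {x}) = n" using that Suc.hyps(2) fin by simp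
    ultimately show ?thesis using Suc.hyps(1)[of "X - {x}" Y] fin disj one by auto
  qed
  have v2: "order_vol c (X \<union> Y - {y}) = order_vol c X * order_vol c (Y - {y})" if "y \<in> Y" for y
  proof -
    have "X \<union> Y - {y} = X \<union> (Y - {y})" using that disj by auto
    moreover have "card (X \<union> Y - {y}) = n" using that Suc.hyps(2) fin by simp
    ultimately show ?thesis using Suc.hyps(1)[of X "Y - {y}"] fin disj one by auto
  qed
  have "of_nat (card (X \<union> Y)) * order_vol c (X \<union> Y)
      = (\<Sum>x\<in>X. pair_weight c {x} (X \<union> Y - {x}) * order_vol c (X \<union> Y - {x}))
      + (\<Sum>x\<in>Y. pair_weight c {x} (X \<union> Y - {x}) * order_vol c (X \<union> Y - {x}))"
    using fin disj by (simp add: order_vol_bottom sum.union_disjoint)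
  also have "\<dots> = (\<Sum>x\<in>X. pair_weight c {x} (X - {x}) * order_vol c (X - {x})) * order_vol c Y
      + order_vol c X * (\<Sum>x\<in>Y. pair_weight c {x} (Y - {x}) * order_vol c (Y - {x}))"
    by (simp add: cw1 cw2 v1 v2 sum_distrib_left sum_distrib_right algebra_simps)
  also have "\<dots> = of_nat (card (X \<union> Y)) * (order_vol c X * order_vol c Y)"
    unfolding order_vol_bottom[OF fin(1), symmetric] order_vol_bottom[OF fin(2), symmetric]
      card_Un_disjoint[OF fin disj] of_nat_add
    by (simp only: distrib_right distrib_left mult_ac)
  finally have "of_nat (Suc n) * order_vol c (X \<union> Y) = of_nat (Suc n) * (order_vol c X
      * order_vol c Y)"
    unfolding Suc.hyps(2) .
  then show ?case by (simp del: of_nat_Suc)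
qed

text \<open>
  The local factor of the coefficient \<open>g\<close>: the weight of \<open>v\<close> below \<open>W\<close> minus the weight of \<open>v\<close> above
  \<open>W\<close>. The root carries no factor. For empty \<open>W\<close> and \<open>v \<noteq> s\<close> the factor vanishes.
\<close>

definition spider_weight :: "('v \<Rightarrow> 'v \<Rightarrow> 'k) \<Rightarrow> 'v \<Rightarrow> 'v \<Rightarrow> 'v set \<Rightarrow> 'k::field_char_0" where
  "spider_weight c s v W = (if v = s then 1 else pair_weight c {v} W - pair_weight c W {v})"

text \<open>
  The greatest element contributes a factor \<open>1 - 1\<close> unless it is the root.
\<close>

lemma order_sum_spider_weight_no_root:
  assumes "finite X" "X \<noteq> {}" "s \<notin> X"
  shows "order_sum (spider_weight c s) X = 0"
  using assms
proof (induction "card X" arbitrary: X)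
  case 0
  then show ?case by simp
next
  case (Suc n)
  have "spider_weight c s x (X - {x}) * order_sum (spider_weight c s) (X - {x}) = 0"
      if x: "x \<in> X" for x
  proof (cases "X - {x} = {}")
    case True
    have "x \<noteq> s" using x Suc.prems by auto
    then show ?thesis unfolding True by (simp add: spider_weight_def)
  next
    case False
    then show ?thesis using Suc.hyps(1)[of "X - {x}"] Suc.hyps(2) Suc.prems x by simp
  qed
  then show ?case unfolding order_sum_rec[OF Suc.prems(1,2)] by (intro sum.neutral ballI)
qed

text \<open>
  Reading each linear order from the top, every element after \<open>s\<close> is put below all its predecessors
  or, with a minus sign, above them. An arrangement with lower part \<open>A\<close> and upper part \<open>B\<close> arises
  from \<open>(|A| + |B|)! / (|A|! |B|!)\<close> orders; the factorials are those in \<open>order_vol\<close>.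
\<close>

lemma order_sum_spider_weight:
  assumes "finite X" "s \<notin> X"
  shows "order_sum (spider_weight c s) (insert s X)
    = fact (card X) * two_sided c (\<lambda>u. c u s) (\<lambda>u. - c s u) X"
  using assms
proof (induction "card X" arbitrary: X)
  case 0
  then show ?case by (simp add: order_sum_rec spider_weight_def)
next
  case (Suc n)
  note cX = Suc.hyps(2)[symmetric] and fin = Suc.prems(1) and s = Suc.prems(2)
  let ?F = "two_sided c (\<lambda>u. c u s) (\<lambda>u. - c s u)"
  have X0: "X \<noteq> {}" using cX by auto
  have "order_sum (spider_weight c s) (insert s X)
      = spider_weight c s s X * order_sum (spider_weight c s) X
      + (\<Sum>x\<in>X. spider_weight c s x (insert s X - {x}) * order_sum (spider_weight c s)
          (insert s X - {x}))"
    using fin s by (simp add: order_sum_rec)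
  also have "order_sum (spider_weight c s) X = 0"
    by (rule order_sum_spider_weight_no_root[OF fin X0 s])
  also have "(\<Sum>x\<in>X. spider_weight c s x (insert s X - {x}) * order_sum (spider_weight c s)
      (insert s X - {x}))
      = (\<Sum>x\<in>X. (c x s * pair_weight c {x} (X - {x}) + (- c s x) * pair_weight c (X - {x}) {x}) *
          (fact n * ?F (X - {x})))"
  proof (intro sum.cong refl)
    fix x assume x: "x \<in> X"
    have 1: "insert s X - {x} = insert s (X - {x})" "x \<noteq> s" using x s by auto
    have 2: "order_sum (spider_weight c s) (insert s (X - {x})) = fact n * ?F (X - {x})"
      using Suc.hyps(1)[of "X - {x}"] x fin s cX by simp
    have 3: "pair_weight c {x} (insert s (X - {x})) = c x s * pair_weight c {x} (X - {x})"
      "pair_weight c (insert s (X - {x})) {x} = c s x * pair_weight c (X - {x}) {x}"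
      using fin s by (simp_all add: pair_weight_def)
    show "spider_weight c s x (insert s X - {x}) * order_sum (spider_weight c s) (insert s X - {x})
      = (c x s * pair_weight c {x} (X - {x}) + (- c s x) * pair_weight c (X - {x}) {x}) * (fact n
          * ?F (X - {x}))"
      unfolding 1(1) 2 by (simp add: spider_weight_def 1(2) 3)
  qed
  also have "\<dots> = fact n * (of_nat (card X) * ?F X)"
    unfolding two_sided_rec[OF fin] sum_distrib_left by (simp add: algebra_simps)
  also have "spider_weight c s s X * 0 + fact n * (of_nat (card X) * ?F X) = fact (card X) * ?F X"
    by (simp add: cX algebra_simps)
  finally show ?case .
qed

section \<open>Sums of powers and Bernoulli numbers\<close>

lemma sum_power_telescope:
  "(\<Sum>j\<le>m. of_nat (Suc m choose j) * (\<Sum>k<N. of_nat k ^ j)) = (of_nat N ^ Suc m :: 'k::comm_ring_1)"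
proof (induction N)
  case 0
  then show ?case by simp
next
  case (Suc N)
  have "(of_nat N + 1) ^ Suc m = (\<Sum>j\<le>Suc m. of_nat (Suc m choose j) * of_nat N ^ j :: 'k)"
    by (simp only: binomial_ring) simp
  also have "\<dots> = (\<Sum>j\<le>m. of_nat (Suc m choose j) * of_nat N ^ j) + of_nat N ^ Suc m"
    by simp
  finally show ?case
    using Suc.IH by (simp add: sum.distrib algebra_simps)
qed

text \<open>
  The telescoping identity expresses the power sum of exponent \<open>m\<close> through those of smaller exponents;
  its linear coefficients obey the recursion of the Bernoulli numbers.
\<close>

lemma power_sum_poly:
  "\<exists>S :: 'k::field_char_0 poly. (\<forall>N. poly S (of_nat N) = (\<Sum>k<N. of_nat k ^ m)) \<and>
     coeff S 1 = of_rat (bernoulli m)"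
proof (induction m rule: less_induct)
  case (less m)
  then have "\<forall>j\<in>{..<m}. \<exists>S :: 'k poly. (\<forall>N. poly S (of_nat N) = (\<Sum>k<N. of_nat k ^ j)) \<and>
     coeff S 1 = of_rat (bernoulli j)" by auto
  then obtain S :: "nat \<Rightarrow> 'k poly"
    where S: "\<And>j N. j < m \<Longrightarrow> poly (S j) (of_nat N) = (\<Sum>k<N. of_nat k ^ j)"
      "\<And>j. j < m \<Longrightarrow> coeff (S j) 1 = of_rat (bernoulli j)"
    by (metis lessThan_iff)
  define T where "T = smult (1 / of_nat (Suc m))
    (monom 1 (Suc m) - (\<Sum>j<m. smult (of_nat (Suc m choose j)) (S j)))"
  have "poly T (of_nat N) = (\<Sum>k<N. of_nat k ^ m)" for N
  proof -
    have "(\<Sum>j\<le>m. of_nat (Suc m choose j) * (\<Sum>k<N. of_nat k ^ j :: 'k))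
        = (\<Sum>j<m. of_nat (Suc m choose j) * (\<Sum>k<N. of_nat k ^ j)) + of_nat (Suc m) *
            (\<Sum>k<N. of_nat k ^ m)"
      by (simp add: lessThan_Suc_atMost[symmetric] del: of_nat_Suc)
    then have "of_nat (Suc m) * (\<Sum>k<N. of_nat k ^ m :: 'k)
        = of_nat N ^ Suc m - (\<Sum>j<m. of_nat (Suc m choose j) * (\<Sum>k<N. of_nat k ^ j))"
      using sum_power_telescope[of m N, where 'k='k] by (simp add: algebra_simps)
    also have "\<dots> = of_nat (Suc m) * poly T (of_nat N)"
      by (simp add: T_def poly_sum poly_monom S(1) del: of_nat_Suc power_Suc)
    finally show ?thesis by (simp del: of_nat_Suc)
  qed
  moreover have "coeff T 1 = of_rat (bernoulli m)"
  proof (cases m)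
    case 0
    then show ?thesis by (simp add: T_def)
  next
    case (Suc n)
    have "coeff T 1 = - (\<Sum>j<m. of_nat (Suc m choose j) * of_rat (bernoulli j)) / of_nat (Suc m)"
      using Suc by (simp add: T_def coeff_sum S(2)[unfolded One_nat_def] del: of_nat_Suc)
    also have "\<dots> = of_rat (bernoulli m)"
      by (simp add: Suc of_rat_divide of_rat_minus of_rat_sum of_rat_mult lessThan_Suc_atMost
          del: of_nat_Suc binomial_Suc_Suc)
    finally show ?thesis .
  qed
  ultimately show ?case by blast
qed

lemma mixed_power_sum_poly:
  "\<exists>R :: 'k::field_char_0 poly.
     (\<forall>N. poly R (of_nat N) = (\<Sum>k<N. of_nat k ^ i * of_nat (N - k) ^ j)) \<and>
     coeff R 1 = (- 1) ^ j * of_rat (bernoulli (i + j))"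
proof (induction j arbitrary: i)
  case 0
  then show ?case using power_sum_poly[of i] by simp
next
  case (Suc j)
  obtain R0 :: "'k poly" where R0: "\<And>N. poly R0 (of_nat N)
      = (\<Sum>k<N. of_nat k ^ i * of_nat (N - k) ^ j)"
    using Suc[of i] by blast
  obtain R1 :: "'k poly" where R1: "\<And>N. poly R1 (of_nat N)
      = (\<Sum>k<N. of_nat k ^ Suc i * of_nat (N - k) ^ j)"
      "coeff R1 1 = (- 1) ^ j * of_rat (bernoulli (Suc i + j))"
    using Suc[of "Suc i"] by blast
  have "coeff R0 0 = 0" using R0[of 0] by (simp add: poly_0_coeff_0)
  then have "coeff (pCons 0 R0 - R1) 1 = (- 1) ^ Suc j * of_rat (bernoulli (i + Suc j))"
    using R1(2) by simp
  moreover have "poly (pCons 0 R0 - R1) (of_nat N) = (\<Sum>k<N. of_nat k ^ i * of_nat (N - k) ^ Suc j)"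
      for N
  proof -
    have "poly (pCons 0 R0 - R1) (of_nat N) = (\<Sum>k<N. (of_nat N - of_nat k) * (of_nat k ^ i * of_nat
        (N - k) ^ j))"
      by (simp add: R0 R1 sum_distrib_left sum_subtractf[symmetric] algebra_simps)
    also have "\<dots> = (\<Sum>k<N. of_nat k ^ i * of_nat (N - k) ^ Suc j)"
      by (intro sum.cong refl) (simp add: of_nat_diff)
    finally show ?thesis .
  qed
  ultimately show ?case by blast
qed

lemma poly_eq_if_eq_on_nat:
  fixes p q :: "'k::field_char_0 poly"
  assumes "\<And>N. poly p (of_nat N) = poly q (of_nat N)"
  shows "p = q"
proof -
  have "infinite (range (of_nat :: nat \<Rightarrow> 'k))"
    by (rule range_inj_infinite) (rule inj_of_nat)
  moreover have "range of_nat \<subseteq> {x. poly (p - q) x = 0}" using assms by auto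
  ultimately show ?thesis using poly_roots_finite[of "p - q"] finite_subset by auto
qed

section \<open>Arc weights and the character \<open>e\<close>\<close>

text \<open>
  The product of \<open>p\<close> over the arcs from \<open>A\<close> to \<open>B\<close> and of \<open>m\<close> over the arcs from \<open>B\<close> to \<open>A\<close>. For
  disjoint sets this is the weight of placing \<open>A\<close> below \<open>B\<close>, where \<open>p\<close> is the weight of an arc
  pointing upwards and \<open>m\<close> that of an arc pointing downwards.
\<close>

definition arc_weight ::
  "('a, 'b) pre_digraph \<Rightarrow> ('b \<Rightarrow> 'k) \<Rightarrow> ('b \<Rightarrow> 'k) \<Rightarrow> 'a set \<Rightarrow> 'a set \<Rightarrow> 'k::field_char_0" where
  "arc_weight Q p m A B =
     (\<Prod>a\<in>{a \<in> arcs Q. tail Q a \<in> A \<and> head Q a \<in> B}. p a) *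
     (\<Prod>a\<in>{a \<in> arcs Q. tail Q a \<in> B \<and> head Q a \<in> A}. m a)"

lemma arc_weight_empty [simp]: "arc_weight Q p m {} B = 1" "arc_weight Q p m A {} = 1"
  by (simp_all add: arc_weight_def)

lemma arc_weight_flip: "arc_weight Q p m A B = arc_weight Q m p B A"
  by (simp add: arc_weight_def mult.commute)

lemma arc_weight_Un_left:
  assumes "finite (arcs Q)" "A \<inter> A' = {}"
  shows "arc_weight Q p m (A \<union> A') B = arc_weight Q p m A B * arc_weight Q p m A' B"
proof -
  have 1: "{a \<in> arcs Q. tail Q a \<in> A \<union> A' \<and> head Q a \<in> B}
      = {a \<in> arcs Q. tail Q a \<in> A \<and> head Q a \<in> B} \<union> {a \<in> arcs Q. tail Q a \<in> A' \<and> head Q a \<in> B}"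
    and 2: "{a \<in> arcs Q. tail Q a \<in> B \<and> head Q a \<in> A \<union> A'}
      = {a \<in> arcs Q. tail Q a \<in> B \<and> head Q a \<in> A} \<union> {a \<in> arcs Q. tail Q a \<in> B \<and> head Q a \<in> A'}"
    by auto
  show ?thesis
    unfolding arc_weight_def 1 2 using assms by (subst (1 2) prod.union_disjoint) auto
qed

lemma arc_weight_Un_right:
  assumes "finite (arcs Q)" "B \<inter> B' = {}"
  shows "arc_weight Q p m A (B \<union> B') = arc_weight Q p m A B * arc_weight Q p m A B'"
  using arc_weight_Un_left[OF assms, of m p A] by (simp add: arc_weight_flip[of Q p m])

lemma pair_weight_arc_weight:
  assumes "finite (arcs Q)" "finite I" "finite J"
    and "disjoint_family_on f I" "disjoint_family_on g J"
  shows "pair_weight (\<lambda>i j. arc_weight Q p m (f i) (g j)) I J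
      = arc_weight Q p m (\<Union>i\<in>I. f i) (\<Union>j\<in>J. g j)"
  using assms(2,4)
proof (induction I rule: finite_induct)
  case (insert x I)
  have "pair_weight (\<lambda>i j. arc_weight Q p m (f i) (g j)) {x} J = arc_weight Q p m (f x) (\<Union>j\<in>J. g j)"
    using assms(3,5)
  proof (induction J rule: finite_induct)
    case (insert y J)
    have "g y \<inter> (\<Union>j\<in>J. g j) = {}"
      using insert.prems insert.hyps by (auto simp: disjoint_family_on_def)
    moreover have "disjoint_family_on g J" using insert.prems by (auto simp: disjoint_family_on_def)
    ultimately show ?case
      using insert.hyps insert.IH assms(1)
      by (simp add: pair_weight_insert_right[OF insert.hyps] arc_weight_Un_right)
          (simp add: pair_weight_def)
  qed simp
  moreover have "f x \<inter> (\<Union>i\<in>I. f i) = {}"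
    using insert.prems insert.hyps by (auto simp: disjoint_family_on_def)
  moreover have "disjoint_family_on f I" using insert.prems by (auto simp: disjoint_family_on_def)
  ultimately show ?case
    using insert.IH assms(1) by (simp add: pair_weight_insert_left[OF insert.hyps] arc_weight_Un_left)
qed simp

lemma pair_weight_arc_weight_singletons:
  assumes "finite (arcs Q)" "finite A" "finite B"
  shows "pair_weight (\<lambda>u v. arc_weight Q p m {u} {v}) A B = arc_weight Q p m A B"
  using pair_weight_arc_weight[OF assms, of "\<lambda>u. {u}" "\<lambda>u. {u}" p m]
      by (simp add: disjoint_family_on_def)

text \<open>
  The arcs are grouped by their lower endpoint.
\<close>

lemma prod_arcs_linear_order:
  assumes "fin_digraph Q" "r \<in> linear_orders (verts Q)"
  shows "(\<Prod>a\<in>arcs Q - tadpoles Q. if (tail Q a, head Q a) \<in> r then p a else m a)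
    = (\<Prod>v\<in>verts Q. arc_weight Q p m {v} (strictly_above r v))"
proof -
  interpret fin_digraph Q by fact
  let ?g = "\<lambda>a. if (tail Q a, head Q a) \<in> r then tail Q a else head Q a"
  let ?h = "\<lambda>a. if (tail Q a, head Q a) \<in> r then p a else m a"
  have fiber: "(\<Prod>a\<in>{a \<in> arcs Q - tadpoles Q. ?g a = v}. ?h a)
      = arc_weight Q p m {v} (strictly_above r v)"
    if v: "v \<in> verts Q" for v
  proof -
    note r = linear_ordersD(3)[OF assms(2)] and tot = linear_ordersD(5)[OF assms(2)]
    let ?U = "{a \<in> arcs Q. tail Q a \<in> {v} \<and> head Q a \<in> strictly_above r v}"
    let ?D = "{a \<in> arcs Q. tail Q a \<in> strictly_above r v \<and> head Q a \<in> {v}}"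
    have eq: "{a \<in> arcs Q - tadpoles Q. ?g a = v} = ?U \<union> ?D"
    proof (intro equalityI subsetI)
      fix a assume a: "a \<in> {a \<in> arcs Q - tadpoles Q. ?g a = v}"
      then have "tail Q a \<in> verts Q" "head Q a \<in> verts Q" "tail Q a \<noteq> head Q a"
        by (auto simp: tadpoles_def)
      then show "a \<in> ?U \<union> ?D"
        using a tot[of "tail Q a" "head Q a"] by (auto simp: strictly_above_def split: if_splits)
    next
      fix a assume "a \<in> ?U \<union> ?D"
      then show "a \<in> {a \<in> arcs Q - tadpoles Q. ?g a = v}"
        using r by (auto simp: strictly_above_def tadpoles_def dest: antisymD)
    qed
    have disj: "?U \<inter> ?D = {}" by (auto simp: strictly_above_def)
    have "(\<Prod>a\<in>?U. ?h a) = (\<Prod>a\<in>?U. p a)"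
      by (intro prod.cong refl) (auto simp: strictly_above_def)
    moreover have "(\<Prod>a\<in>?D. ?h a) = (\<Prod>a\<in>?D. m a)"
      by (intro prod.cong refl) (use r in \<open>auto simp: strictly_above_def dest: antisymD\<close>)
    ultimately show ?thesis
      unfolding eq arc_weight_def by (subst prod.union_disjoint) (use disj in auto)
  qed
  have "(\<Prod>v\<in>verts Q. \<Prod>a\<in>{a \<in> arcs Q - tadpoles Q. ?g a = v}. ?h a) = (\<Prod>a\<in>arcs Q - tadpoles Q. ?h a)"
    by (rule prod.group) auto
  then show ?thesis using fiber by simp
qed

text \<open>
  The average over all linear orders of the vertices of the product of the arc weights; tadpoles are
  ignored.
\<close>

definition quiver_vol :: "('b \<Rightarrow> 'k) \<Rightarrow> ('b \<Rightarrow> 'k) \<Rightarrow> ('a, 'b) pre_digraph \<Rightarrow> 'k::field_char_0" where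
  "quiver_vol p m Q = order_vol (\<lambda>u v. arc_weight Q p m {u} {v}) (verts Q)"

lemma quiver_vol_eq_sum:
  assumes "fin_digraph Q"
  shows "quiver_vol p m Q = (\<Sum>r\<in>linear_orders (verts Q).
     \<Prod>a\<in>arcs Q - tadpoles Q. if (tail Q a, head Q a) \<in> r then p a else m a) / fact (card (verts Q))"
proof -
  interpret fin_digraph Q by fact
  have "pair_weight (\<lambda>u v. arc_weight Q p m {u} {v}) {v} (strictly_above r v)
      = arc_weight Q p m {v} (strictly_above r v)"
    if "r \<in> linear_orders (verts Q)" for r v
  proof -
    have "strictly_above r v \<subseteq> verts Q"
      using that by (auto simp: linear_orders_iff strictly_above_def)
    then show ?thesis by (intro pair_weight_arc_weight_singletons) (auto intro: finite_subset)
  qed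
  then show ?thesis
    by (simp add: quiver_vol_def order_vol_def order_sum_def prod_arcs_linear_order[OF assms])
qed

lemma linear_extensions_prune:
  assumes "fin_digraph Q"
  shows "linear_extensions (prune Q) =
    {r \<in> linear_orders (verts Q). \<forall>a\<in>arcs Q - tadpoles Q. (tail Q a, head Q a) \<in> r}"
proof -
  interpret fin_digraph Q by fact
  let ?P = "prune Q"
  interpret P: fin_digraph ?P
    by unfold_locales (auto simp: prune_def)
  have vP: "verts ?P = verts Q" "arcs ?P = arcs Q - tadpoles Q" "tail ?P = tail Q" "head ?P = head Q"
    by (simp_all add: prune_def)
  have "{(u, v). u \<rightarrow>\<^sup>*\<^bsub>?P\<^esub> v} \<subseteq> r \<longleftrightarrow> (\<forall>a\<in>arcs Q - tadpoles Q. (tail Q a, head Q a) \<in> r)"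
    if r: "r \<in> linear_orders (verts Q)" for r
  proof
    assume *: "{(u, v). u \<rightarrow>\<^sup>*\<^bsub>?P\<^esub> v} \<subseteq> r"
    show "\<forall>a\<in>arcs Q - tadpoles Q. (tail Q a, head Q a) \<in> r"
    proof
      fix a assume "a \<in> arcs Q - tadpoles Q"
      then have "tail Q a \<rightarrow>\<^bsub>?P\<^esub> head Q a" by (auto simp: arcs_ends_conv vP)
      then have "tail Q a \<rightarrow>\<^sup>*\<^bsub>?P\<^esub> head Q a" by (rule P.reachable_adjI)
      then show "(tail Q a, head Q a) \<in> r" using * by auto
    qed
  next
    assume *: "\<forall>a\<in>arcs Q - tadpoles Q. (tail Q a, head Q a) \<in> r"
    have "(u, v) \<in> r" if "u \<rightarrow>\<^sup>*\<^bsub>?P\<^esub> v" for u v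
      using that
    proof (induction rule: P.reachable_induct)
      case base
      then show ?case using r by (simp add: linear_orders_iff vP)
    next
      case (step x y)
      have "(x, y) \<in> r" using step(2) * by (auto simp: arcs_ends_conv vP)
      then show ?case using step(3) r by (auto simp: linear_orders_iff dest: transD)
    qed
    then show "{(u, v). u \<rightarrow>\<^sup>*\<^bsub>?P\<^esub> v} \<subseteq> r" by auto
  qed
  then show ?thesis unfolding linear_extensions_def by (auto simp: linear_orders_def vP)
qed

lemma acyclic_if_linear_extension:
  assumes "fin_digraph Q" "r \<in> linear_extensions (prune Q)"
  shows "acyclic_quiver (prune Q)"
proof (rule ccontr)
  interpret fin_digraph Q by fact
  let ?P = "prune Q"
  interpret P: fin_digraph ?P
    by unfold_locales (auto simp: prune_def)
  assume "\<not> acyclic_quiver (prune Q)"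
  then obtain u p where p: "P.awalk u p u" "p \<noteq> []"
    by (auto simp: acyclic_quiver_def P.cycle_def)
  then obtain a q where q: "p = a # q" by (cases p) auto
  have a: "a \<in> arcs ?P" "tail ?P a = u" and w: "P.awalk (head ?P a) q u"
    using p(1) unfolding q P.awalk_Cons_iff by auto
  have "(head ?P a, u) \<in> r"
    using P.reachable_awalkI[OF w] assms(2) by (auto simp: linear_extensions_def)
  moreover have "(u, head ?P a) \<in> r"
  proof -
    have "u \<rightarrow>\<^bsub>?P\<^esub> head ?P a" using a by (auto simp: arcs_ends_conv)
    then have "u \<rightarrow>\<^sup>*\<^bsub>?P\<^esub> head ?P a" by (rule P.reachable_adjI)
    then show ?thesis using assms(2) by (auto simp: linear_extensions_def)
  qed
  moreover have "antisym r" using assms(2) by (auto simp: linear_extensions_def order_on_defs)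
  ultimately have "u = head ?P a" by (auto dest: antisymD)
  then show False using a by (auto simp: prune_def tadpoles_def)
qed

text \<open>
  The linear extensions of the pruned quiver are the linear orders in which no arc other than a
  tadpole points downwards. If the pruned quiver has a directed cycle, then there are none, in
  accordance with the value \<open>0\<close> of \<open>e0_char\<close>.
\<close>

lemma e_char_eq_quiver_vol:
  assumes "fin_digraph Q"
  shows "e_char \<beta> Q = (\<Prod>a\<in>tadpoles Q. - beta_minus \<beta> a) * quiver_vol (\<lambda>_. 1) (\<lambda>_. 0) Q"
proof -
  interpret fin_digraph Q by fact
  have one: "(\<Prod>a\<in>arcs Q - tadpoles Q. if (tail Q a, head Q a) \<in> r then 1 else 0 :: 'c)
      = (if \<forall>a\<in>arcs Q - tadpoles Q. (tail Q a, head Q a) \<in> r then 1 else 0)" for r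
    by (auto intro!: prod_zero)
  have "quiver_vol (\<lambda>_. 1) (\<lambda>_. 0) Q
      = of_nat (card (linear_extensions (prune Q))) / (fact (card (verts Q)) :: 'c)"
    unfolding quiver_vol_eq_sum[OF assms] one linear_extensions_prune[OF assms]
    by (simp add: sum.If_cases finite_linear_orders Collect_conj_eq Int_commute)
  moreover have "linear_extensions (prune Q) = {}" if "\<not> acyclic_quiver (prune Q)"
    using acyclic_if_linear_extension[OF assms] that by auto
  ultimately show ?thesis by (simp add: e_char_def e0_char_def prune_def)
qed

lemma e_char_eq_sum:
  assumes "fin_digraph Q"
  shows "e_char \<beta> Q = (\<Sum>r\<in>linear_orders (verts Q). \<Prod>a\<in>arcs Q.
     if tail Q a = head Q a then - beta_minus \<beta> a else if (tail Q a, head Q a) \<in> r then 1 else 0)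
     / fact (card (verts Q))"
proof -
  interpret fin_digraph Q by fact
  let ?y = "\<lambda>r a. if tail Q a = head Q a then - beta_minus \<beta> a else
      if (tail Q a, head Q a) \<in> r then 1 else 0"
  have "(\<Prod>a\<in>arcs Q. ?y r a) = (\<Prod>a\<in>tadpoles Q. - beta_minus \<beta> a) *
      (\<Prod>a\<in>arcs Q - tadpoles Q. if (tail Q a, head Q a) \<in> r then 1 else 0)" for r
  proof -
    have sub: "tadpoles Q \<subseteq> arcs Q" by (auto simp: tadpoles_def)
    have "(\<Prod>a\<in>arcs Q. ?y r a) = (\<Prod>a\<in>arcs Q - tadpoles Q. ?y r a) * (\<Prod>a\<in>tadpoles Q. ?y r a)"
      by (rule prod.subset_diff[OF sub finite_arcs])
    also have "(\<Prod>a\<in>arcs Q - tadpoles Q. ?y r a)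
        = (\<Prod>a\<in>arcs Q - tadpoles Q. if (tail Q a, head Q a) \<in> r then 1 else 0)"
      by (intro prod.cong refl) (auto simp: tadpoles_def)
    also have "(\<Prod>a\<in>tadpoles Q. ?y r a) = (\<Prod>a\<in>tadpoles Q. - beta_minus \<beta> a)"
      by (intro prod.cong refl) (auto simp: tadpoles_def)
    finally show ?thesis by (simp only: mult.commute)
  qed
  then show ?thesis
    by (simp add: e_char_eq_quiver_vol[OF assms] quiver_vol_eq_sum[OF assms] sum_distrib_left)
qed

lemma e_char_disjoint_union:
  assumes Q: "fin_digraph Q" and Q1: "fin_digraph Q1" and Q2: "fin_digraph Q2"
    and V: "verts Q = verts Q1 \<union> verts Q2" "verts Q1 \<inter> verts Q2 = {}"
    and A: "arcs Q = arcs Q1 \<union> arcs Q2"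
    and T1: "\<And>a. a \<in> arcs Q1 \<Longrightarrow> tail Q a = tail Q1 a \<and> head Q a = head Q1 a"
    and T2: "\<And>a. a \<in> arcs Q2 \<Longrightarrow> tail Q a = tail Q2 a \<and> head Q a = head Q2 a"
  shows "e_char \<beta> Q = e_char \<beta> Q1 * e_char \<beta> Q2"
proof -
  interpret Q: fin_digraph Q by fact
  interpret Q1: fin_digraph Q1 by fact
  interpret Q2: fin_digraph Q2 by fact
  have ends: "\<And>a. a \<in> arcs Q1 \<Longrightarrow> tail Q a \<in> verts Q1 \<and> head Q a \<in> verts Q1"
    "\<And>a. a \<in> arcs Q2 \<Longrightarrow> tail Q a \<in> verts Q2 \<and> head Q a \<in> verts Q2"
    by (auto simp: T1 T2)
  have disj: "arcs Q1 \<inter> arcs Q2 = {}" using ends V(2) by blast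
  have tad: "tadpoles Q = tadpoles Q1 \<union> tadpoles Q2" "tadpoles Q1 \<inter> tadpoles Q2 = {}"
    using T1 T2 disj by (auto simp: A tadpoles_def)
  have fint: "finite (tadpoles Q1)" "finite (tadpoles Q2)" by (auto simp: tadpoles_def)
  have e1: "{a \<in> arcs Q. tail Q a \<in> {u} \<and> head Q a \<in> {v}}
      = {a \<in> arcs Q1. tail Q1 a \<in> {u} \<and> head Q1 a \<in> {v}}"
    if "u \<in> verts Q1" for u v
    using that ends V(2) T1 by (auto simp: A)
  have e1': "{a \<in> arcs Q. tail Q a \<in> {v} \<and> head Q a \<in> {u}}
      = {a \<in> arcs Q1. tail Q1 a \<in> {v} \<and> head Q1 a \<in> {u}}"
    if "u \<in> verts Q1" for u v
    using that ends V(2) T1 by (auto simp: A)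
  have e2: "{a \<in> arcs Q. tail Q a \<in> {u} \<and> head Q a \<in> {v}}
      = {a \<in> arcs Q2. tail Q2 a \<in> {u} \<and> head Q2 a \<in> {v}}"
    if "u \<in> verts Q2" for u v
    using that ends V(2) T2 by (auto simp: A)
  have e2': "{a \<in> arcs Q. tail Q a \<in> {v} \<and> head Q a \<in> {u}}
      = {a \<in> arcs Q2. tail Q2 a \<in> {v} \<and> head Q2 a \<in> {u}}"
    if "u \<in> verts Q2" for u v
    using that ends V(2) T2 by (auto simp: A)
  have none: "{a \<in> arcs Q. tail Q a \<in> {u} \<and> head Q a \<in> {v}} = {}"
    "{a \<in> arcs Q. tail Q a \<in> {v} \<and> head Q a \<in> {u}} = {}"
    if "u \<in> verts Q1" "v \<in> verts Q2" for u v
    using that ends V(2) by (auto simp: A)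
  let ?w = "\<lambda>R u v. arc_weight R (\<lambda>_. 1) (\<lambda>_. 0 :: 'c) {u} {v}"
  have "order_vol (?w Q) (verts Q1 \<union> verts Q2) = order_vol (?w Q) (verts Q1) * order_vol (?w Q)
      (verts Q2)"
  proof (rule order_vol_disjoint_union)
    show "?w Q x y = 1 \<and> ?w Q y x = 1" if "x \<in> verts Q1" "y \<in> verts Q2" for x y
      by (simp only: arc_weight_def none[OF that]) simp
  qed (use V(2) in auto)
  moreover have "order_vol (?w Q) (verts Q1) = order_vol (?w Q1) (verts Q1)"
    by (rule order_vol_cong) (simp only: arc_weight_def e1 e1')
  moreover have "order_vol (?w Q) (verts Q2) = order_vol (?w Q2) (verts Q2)"
    by (rule order_vol_cong) (simp only: arc_weight_def e2 e2')
  ultimately have "quiver_vol (\<lambda>_. 1) (\<lambda>_. 0 :: 'c) Q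
      = quiver_vol (\<lambda>_. 1) (\<lambda>_. 0) Q1 * quiver_vol (\<lambda>_. 1) (\<lambda>_. 0) Q2"
    by (simp add: quiver_vol_def V(1))
  then show ?thesis
    unfolding e_char_eq_quiver_vol[OF Q] e_char_eq_quiver_vol[OF Q1] e_char_eq_quiver_vol[OF Q2]
    using tad fint by (simp add: prod.union_disjoint)
qed

section \<open>Components, subquivers and the multiplicativity of \<open>\<omega>\<close>\<close>

text \<open>
  The symmetric relation generated by a set of arcs.
\<close>

definition arc_rel :: "('a, 'b) pre_digraph \<Rightarrow> 'b set \<Rightarrow> 'a rel" where
  "arc_rel G H = (\<Union>a\<in>H. {(tail G a, head G a), (head G a, tail G a)})"

text \<open>
  The vertex set of the component of \<open>v\<close> in the spanning subquiver with arc set \<open>H\<close>.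
\<close>

definition comp_of :: "('a, 'b) pre_digraph \<Rightarrow> 'b set \<Rightarrow> 'a \<Rightarrow> 'a set" where
  "comp_of G H v = (arc_rel G H)\<^sup>* `` {v}"

text \<open>
  The arcs of the subquiver induced on \<open>X\<close>.
\<close>

definition inside :: "('a, 'b) pre_digraph \<Rightarrow> 'a set \<Rightarrow> 'b set" where
  "inside G X = {a \<in> arcs G. tail G a \<in> X \<and> head G a \<in> X}"

text \<open>
  The quiver with vertices \<open>X\<close> and arcs \<open>E\<close>. It is meaningful for \<open>E \<subseteq> inside G X\<close>; all
  subquivers of \<open>G\<close> share its tail and head functions.
\<close>

definition subquiver :: "('a, 'b) pre_digraph \<Rightarrow> 'a set \<Rightarrow> 'b set \<Rightarrow> ('a, 'b) pre_digraph" where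
  "subquiver G X E = G\<lparr>verts := X, arcs := E\<rparr>"

lemma subquiver_simps [simp]:
  "verts (subquiver G X E) = X" "arcs (subquiver G X E) = E"
  "tail (subquiver G X E) = tail G" "head (subquiver G X E) = head G"
  by (simp_all add: subquiver_def)

lemma insideD: "a \<in> inside G X \<Longrightarrow> a \<in> arcs G \<and> tail G a \<in> X \<and> head G a \<in> X"
  by (simp add: inside_def)

lemma inside_mono: "A \<subseteq> B \<Longrightarrow> inside G A \<subseteq> inside G B"
  by (auto simp: inside_def)

lemma finite_inside: "finite (arcs G) \<Longrightarrow> finite (inside G X)"
  by (simp add: inside_def)

lemma sym_arc_rel: "sym (arc_rel G H)"
  by (auto simp: arc_rel_def sym_def)

lemma comp_refl [simp]: "v \<in> comp_of G H v"
  by (simp add: comp_of_def)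

lemma comp_eqI: "w \<in> comp_of G H v \<Longrightarrow> comp_of G H w = comp_of G H v"
proof -
  assume "w \<in> comp_of G H v"
  then have 1: "(v, w) \<in> (arc_rel G H)\<^sup>*" by (simp add: comp_of_def)
  then have 2: "(w, v) \<in> (arc_rel G H)\<^sup>*" using sym_rtrancl[OF sym_arc_rel] by (rule symD[rotated])
  show ?thesis
    unfolding comp_of_def using rtrancl_trans[OF 1] rtrancl_trans[OF 2] by blast
qed

lemma comp_eq_iff: "comp_of G H v = comp_of G H w \<longleftrightarrow> v \<in> comp_of G H w"
proof
  show "v \<in> comp_of G H w" if "comp_of G H v = comp_of G H w"
    using comp_refl[of v G H] unfolding that .
qed (rule comp_eqI)

lemma comp_disjoint: "comp_of G H v \<noteq> comp_of G H w \<Longrightarrow> comp_of G H v \<inter> comp_of G H w = {}"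
proof (rule ccontr)
  assume ne: "comp_of G H v \<noteq> comp_of G H w" "comp_of G H v \<inter> comp_of G H w \<noteq> {}"
  then obtain x where "x \<in> comp_of G H v" "x \<in> comp_of G H w" by blast
  then have "comp_of G H v = comp_of G H w" using comp_eqI[of x G H] by metis
  with ne show False by simp
qed

lemma comp_arc: "a \<in> H \<Longrightarrow> comp_of G H (tail G a) = comp_of G H (head G a)"
  by (subst comp_eq_iff) (auto simp: comp_of_def arc_rel_def)

lemma comp_empty [simp]: "comp_of G {} v = {v}"
  by (simp add: comp_of_def arc_rel_def)

lemma comp_restrict:
  assumes cl: "\<And>a. a \<in> H \<Longrightarrow> tail G a \<in> A \<longleftrightarrow> head G a \<in> A" and H': "\<And>a. a \<in> H \<and> tail G a \<in> A \<longleftrightarrow> a \<in> H'"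
    and v: "v \<in> A"
  shows "comp_of G H v = comp_of G H' v \<and> comp_of G H v \<subseteq> A"
proof -
  have "w \<in> A \<and> (v, w) \<in> (arc_rel G H')\<^sup>*" if "(v, w) \<in> (arc_rel G H)\<^sup>*" for w
    using that
  proof (induction rule: rtrancl_induct)
    case base
    then show ?case using v by simp
  next
    case (step y z)
    then have "(y, z) \<in> arc_rel G H'" "z \<in> A"
      using cl H' by (fastforce simp: arc_rel_def)+
    then show ?case using step by (auto intro: rtrancl_into_rtrancl)
  qed
  moreover have "(arc_rel G H')\<^sup>* \<subseteq> (arc_rel G H)\<^sup>*"
    by (rule rtrancl_mono) (use H' in \<open>auto simp: arc_rel_def\<close>)
  ultimately show ?thesis by (auto simp: comp_of_def)
qed

lemma comp_subset: "H \<subseteq> inside G X \<Longrightarrow> v \<in> X \<Longrightarrow> comp_of G H v \<subseteq> X"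
  using comp_restrict[of H G X H v] by (auto simp: inside_def)

lemma Union_comp: "H \<subseteq> inside G X \<Longrightarrow> \<Union> (comp_of G H ` X) = X"
  using comp_subset[of H G X] comp_refl[of _ G H] by blast

lemma comp_image_disjoint:
  assumes "\<C> \<in> comp_of G H ` X" "\<D> \<in> comp_of G H ` Y" "\<C> \<noteq> \<D>" shows "\<C> \<inter> \<D> = {}"
proof -
  from assms(1,2) obtain v w where "\<C> = comp_of G H v" "\<D> = comp_of G H w" by blast
  then show ?thesis using comp_disjoint[of G H v w] assms(3) by simp
qed

lemma comp_Un:
  assumes "H1 \<subseteq> inside G A" "H2 \<subseteq> inside G B" "A \<inter> B = {}"
  shows "v \<in> A \<Longrightarrow> comp_of G (H1 \<union> H2) v = comp_of G H1 v" "v \<in> B \<Longrightarrow> comp_of G (H1 \<union> H2) v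
      = comp_of G H2 v"
proof -
  show "comp_of G (H1 \<union> H2) v = comp_of G H1 v" if "v \<in> A"
    using comp_restrict[of "H1 \<union> H2" G A H1 v] assms that by (auto simp: inside_def)
  show "comp_of G (H1 \<union> H2) v = comp_of G H2 v" if "v \<in> B"
    using comp_restrict[of "H1 \<union> H2" G B H2 v] assms that by (auto simp: inside_def)
qed

lemma comp_image_Un:
  assumes "H1 \<subseteq> inside G A" "H2 \<subseteq> inside G B" "A \<inter> B = {}"
  shows "comp_of G (H1 \<union> H2) ` (A \<union> B) = comp_of G H1 ` A \<union> comp_of G H2 ` B"
    "comp_of G H1 ` A \<inter> comp_of G H2 ` B = {}"
proof -
  show "comp_of G (H1 \<union> H2) ` (A \<union> B) = comp_of G H1 ` A \<union> comp_of G H2 ` B"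
    using comp_Un[OF assms] by (auto simp: image_Un)
  show "comp_of G H1 ` A \<inter> comp_of G H2 ` B = {}"
  proof (rule ccontr)
    assume "comp_of G H1 ` A \<inter> comp_of G H2 ` B \<noteq> {}"
    then obtain a b where ab: "a \<in> A" "b \<in> B" "comp_of G H1 a = comp_of G H2 b" by blast
    then have "a \<in> B" using comp_subset[OF assms(2) ab(2)] comp_refl[of a G H1] by blast
    then show False using ab assms(3) by blast
  qed
qed

lemma reachable_mk_symmetric_subquiver:
  assumes "H \<subseteq> inside G X"
  shows "u \<rightarrow>\<^sup>*\<^bsub>with_proj (mk_symmetric (subquiver G X H))\<^esub> v \<longleftrightarrow> u \<in> X \<and> v \<in> comp_of G H u"
proof -
  have ends: "arcs_ends (with_proj (mk_symmetric (subquiver G X H))) = arc_rel G H"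
    by (simp add: mk_symmetric_def arc_rel_def)
  have sub: "arc_rel G H \<subseteq> X \<times> X" using assms by (auto simp: arc_rel_def inside_def)
  have "(u, v) \<in> rtrancl_on X (arc_rel G H) \<longleftrightarrow> u \<in> X \<and> (u, v) \<in> (arc_rel G H)\<^sup>*"
  proof
    assume "(u, v) \<in> rtrancl_on X (arc_rel G H)"
    then show "u \<in> X \<and> (u, v) \<in> (arc_rel G H)\<^sup>*"
      by (metis in_rtrancl_on_in_F(1) rtrancl_on_rtranclI)
  next
    assume *: "u \<in> X \<and> (u, v) \<in> (arc_rel G H)\<^sup>*"
    then have "v \<in> X" using comp_subset[OF assms] by (auto simp: comp_of_def)
    with * show "(u, v) \<in> rtrancl_on X (arc_rel G H)"
      using sub by (intro rtrancl_consistent_rtrancl_on) auto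
  qed
  then show ?thesis
    by (simp add: reachable_def ends comp_of_def del: with_proj_simps(3))
qed

lemma component_of_subquiver:
  assumes "H \<subseteq> inside G X" "v \<in> X"
  shows "component_of (subquiver G X H) v = comp_of G H v"
proof -
  have "w \<in> X \<and> v \<in> comp_of G H w" if w: "w \<in> comp_of G H v" for w
    using comp_subset[OF assms] w comp_refl[of v G H] unfolding comp_eqI[OF w] by blast
  then show ?thesis
    unfolding component_of_def pre_digraph.scc_of_def reachable_mk_symmetric_subquiver[OF assms(1)]
    using assms(2) by blast
qed

lemma components_subquiver:
  assumes "H \<subseteq> inside G X"
  shows "components (subquiver G X H) = comp_of G H ` X"
proof (intro equalityI subsetI)
  fix S assume "S \<in> components (subquiver G X H)"
  then have S: "S \<noteq> {}" "\<forall>u\<in>S. \<forall>v\<in>S. u \<in> X \<and> v \<in> comp_of G H u"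
    "\<forall>u\<in>S. \<forall>v. v \<notin> S \<longrightarrow> \<not> (u \<in> X \<and> v \<in> comp_of G H u) \<or> \<not> (v \<in> X \<and> u \<in> comp_of G H v)"
    unfolding components_def pre_digraph.sccs_verts_def reachable_mk_symmetric_subquiver[OF assms]
        by auto
  then obtain u where u: "u \<in> S" "u \<in> X" by blast
  have "v \<in> S" if "v \<in> comp_of G H u" for v
  proof -
    have "v \<in> X" "u \<in> comp_of G H v"
      using that comp_subset[OF assms u(2)] comp_eqI[OF that] by auto
    then show ?thesis using S(3) u that by blast
  qed
  then have "S = comp_of G H u" using S(2) u by blast
  then show "S \<in> comp_of G H ` X" using u by blast
next
  fix S assume "S \<in> comp_of G H ` X"
  then obtain u where u: "u \<in> X" "S = comp_of G H u" by blast
  have mem: "v \<in> X \<and> comp_of G H v = S" if "v \<in> S" for v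
    using that u comp_subset[OF assms u(1)] comp_eqI[of v G H u] by auto
  have "S \<noteq> {}" using u(2) comp_refl[of u G H] by blast
  moreover have "\<forall>a\<in>S. \<forall>b\<in>S. a \<in> X \<and> b \<in> comp_of G H a" using mem by simp
  moreover have "\<forall>a\<in>S. \<forall>b. b \<notin> S \<longrightarrow>
      \<not> (a \<in> X \<and> b \<in> comp_of G H a) \<or> \<not> (b \<in> X \<and> a \<in> comp_of G H b)"
    using mem by simp
  ultimately show "S \<in> components (subquiver G X H)"
    unfolding components_def pre_digraph.sccs_verts_def reachable_mk_symmetric_subquiver[OF assms]
    by (intro CollectI conjI)
qed

lemma connected_comp:
  assumes "fin_digraph G" "Digraph_Component.connected G" "v \<in> verts G"
  shows "comp_of G (arcs G) v = verts G"
proof -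
  interpret fin_digraph G by fact
  have self: "subquiver G (verts G) (arcs G) = G" by (simp add: subquiver_def)
  have 1: "arcs G \<subseteq> inside G (verts G)" by (auto simp: inside_def)
  have "w \<in> comp_of G (arcs G) v" if "w \<in> verts G" for w
    using assms(2,3) that reachable_mk_symmetric_subquiver[OF 1, of v w] unfolding self
    by (simp add: Digraph_Component.connected_def strongly_connected_def)
  then show ?thesis using comp_subset[OF 1 assms(3)] by blast
qed

lemma fin_digraph_subquiver:
  assumes "fin_digraph G" "X \<subseteq> verts G" "E \<subseteq> inside G X"
  shows "fin_digraph (subquiver G X E)"
proof -
  interpret fin_digraph G by fact
  show ?thesis
    using assms(2,3) by unfold_locales (auto simp: inside_def intro: finite_subset)
qed

lemma contract_subquiver:
  assumes "E \<subseteq> inside G X" "H \<subseteq> E"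
  shows "verts (contract (subquiver G X E) (subquiver G X H)) = comp_of G H ` X"
    "arcs (contract (subquiver G X E) (subquiver G X H)) = E - H"
    "a \<in> E \<Longrightarrow> tail (contract (subquiver G X E) (subquiver G X H)) a = comp_of G H (tail G a)"
    "a \<in> E \<Longrightarrow> head (contract (subquiver G X E) (subquiver G X H)) a = comp_of G H (head G a)"
proof -
  have H: "H \<subseteq> inside G X" using assms by auto
  show "verts (contract (subquiver G X E) (subquiver G X H)) = comp_of G H ` X"
    "arcs (contract (subquiver G X E) (subquiver G X H)) = E - H"
    by (simp_all add: contract_def components_subquiver[OF H])
  show "tail (contract (subquiver G X E) (subquiver G X H)) a = comp_of G H (tail G a)"
    "head (contract (subquiver G X E) (subquiver G X H)) a = comp_of G H (head G a)" if "a \<in> E"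
    using that assms by (auto simp: contract_def inside_def intro!: component_of_subquiver[OF H])
qed

lemma fin_digraph_contract_subquiver:
  assumes "fin_digraph G" "X \<subseteq> verts G" "E \<subseteq> inside G X" "H \<subseteq> E"
  shows "fin_digraph (contract (subquiver G X E) (subquiver G X H))"
proof -
  interpret fin_digraph G by fact
  have "finite X" using finite_subset[OF assms(2)] by simp
  moreover have "finite E" using finite_subset[OF assms(3) finite_inside] by simp
  ultimately show ?thesis
    using assms(3) by unfold_locales (auto simp: contract_subquiver[OF assms(3,4)] inside_def)
qed

lemma cut_subquivers_subquiver:
  assumes "fin_digraph G" "X \<subseteq> verts G" "E \<subseteq> inside G X"
  shows "cut_subquivers (subquiver G X E) = subquiver G X ` Pow E"
proof -
  interpret S: fin_digraph "subquiver G X E" by (rule fin_digraph_subquiver[OF assms])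
  show ?thesis
    by (subst cut_subquivers_eq) (use S.wf_digraph in \<open>auto simp: subquiver_def\<close>)
qed

lemma inj_subquiver: "inj_on (subquiver G X) A"
  by (rule inj_onI) (metis subquiver_simps(2))

lemma omega_recursion:
  assumes "fin_digraph G" "X \<subseteq> verts G" "E \<subseteq> inside G X"
  shows "(\<Sum>H\<in>Pow E. omega \<beta> (subquiver G X H) * e_char \<beta> (contract (subquiver G X E)
      (subquiver G X H)))
    = (if E = {} then 1 else 0)"
proof -
  have "(\<Sum>H\<in>cut_subquivers (subquiver G X E). omega \<beta> H * e_char \<beta> (contract (subquiver G X E) H))
      = counit (subquiver G X E)"
    by (rule omega_spec_omega[unfolded omega_spec_def, rule_format, OF fin_digraph_subquiver[OF assms]])
  then show ?thesis
    unfolding cut_subquivers_subquiver[OF assms]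
    by (simp add: sum.reindex[OF inj_subquiver] counit_def)
qed

lemma omega_isolated_vertex:
  assumes "fin_digraph G" "v \<in> verts G"
  shows "omega \<beta> (subquiver G {v} {}) = 1"
proof -
  let ?Q = "contract (subquiver G {v} {}) (subquiver G {v} {})"
  have Q: "verts ?Q = {{v}}" "arcs ?Q = {}"
    using contract_subquiver(1,2)[of "{}" G "{v}" "{}"] by auto
  have "fin_digraph ?Q" using assms by (intro fin_digraph_contract_subquiver) auto
  then have "e_char \<beta> ?Q = 1"
    by (simp add: e_char_eq_quiver_vol quiver_vol_def Q tadpoles_def)
  then show ?thesis using omega_recursion[OF assms(1), of "{v}" "{}" \<beta>] assms(2) by simp
qed

text \<open>
  The functions \<open>H1 \<union> H2 \<mapsto> \<omega>(H1 \<union> H2)\<close> and \<open>H1 \<union> H2 \<mapsto> \<omega>(H1) \<omega>(H2)\<close> satisfy the same recursion,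
  because contractions of a disjoint union are disjoint unions and \<open>e\<close> is multiplicative.
\<close>

lemma omega_disjoint_union:
  assumes G: "fin_digraph G" and AB: "A \<subseteq> verts G" "B \<subseteq> verts G" "A \<inter> B = {}"
    and H: "H1 \<subseteq> inside G A" "H2 \<subseteq> inside G B"
  shows "omega \<beta> (subquiver G (A \<union> B) (H1 \<union> H2)) = omega \<beta> (subquiver G A H1) * omega \<beta>
      (subquiver G B H2)"
  using H
proof (induction "card (H1 \<union> H2)" arbitrary: H1 H2 rule: less_induct)
  case less
  interpret fin_digraph G by fact
  note H = less.prems
  have fin: "finite H1" "finite H2"
    using finite_subset[OF H(1) finite_inside] finite_subset[OF H(2) finite_inside] by simp_all
  have disj: "inside G A \<inter> inside G B = {}" using AB(3) by (auto simp: inside_def)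
  have HAB: "H1 \<union> H2 \<subseteq> inside G (A \<union> B)" using H by (auto simp: inside_def)
  have sub: "A \<union> B \<subseteq> verts G" using AB by auto
  let ?e = "\<lambda>X E H. e_char \<beta> (contract (subquiver G X E) (subquiver G X H))"
  let ?o = "\<lambda>X H. omega \<beta> (subquiver G X H)"
  have e: "?e (A \<union> B) (H1 \<union> H2) (J1 \<union> J2) = ?e A H1 J1 * ?e B H2 J2"
    if J: "J1 \<subseteq> H1" "J2 \<subseteq> H2" for J1 J2
  proof -
    have J12: "J1 \<union> J2 \<subseteq> H1 \<union> H2" and J': "J1 \<subseteq> inside G A" "J2 \<subseteq> inside G B" using J H by auto
    note c = contract_subquiver[OF HAB J12] contract_subquiver[OF H(1) J(1)] contract_subquiver[OF H(2) J(2)]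
    show ?thesis
    proof (rule e_char_disjoint_union)
      show "fin_digraph (contract (subquiver G (A \<union> B) (H1 \<union> H2)) (subquiver G (A \<union> B) (J1 \<union> J2)))"
        "fin_digraph (contract (subquiver G A H1) (subquiver G A J1))"
        "fin_digraph (contract (subquiver G B H2) (subquiver G B J2))"
        using fin_digraph_contract_subquiver[OF G] sub AB H HAB J J12 by auto
      have "H1 \<inter> J2 = {}" "H2 \<inter> J1 = {}" using J H disj by blast+
      then show "arcs (contract (subquiver G (A \<union> B) (H1 \<union> H2)) (subquiver G (A \<union> B) (J1 \<union> J2)))
         = arcs (contract (subquiver G A H1) (subquiver G A J1)) \<union> arcs (contract (subquiver G B H2)
             (subquiver G B J2))"
        unfolding c by blast
    next
      fix a assume "a \<in> arcs (contract (subquiver G A H1) (subquiver G A J1))"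
      then have "a \<in> H1" unfolding c by simp
      then show "tail (contract (subquiver G (A \<union> B) (H1 \<union> H2)) (subquiver G (A \<union> B) (J1 \<union> J2))) a
          = tail (contract (subquiver G A H1) (subquiver G A J1)) a \<and>
          head (contract (subquiver G (A \<union> B) (H1 \<union> H2)) (subquiver G (A \<union> B) (J1 \<union> J2))) a
          = head (contract (subquiver G A H1) (subquiver G A J1)) a"
        using c(3,4,7,8) comp_Un(1)[OF J' AB(3)] H by (auto simp: inside_def)
    next
      fix a assume "a \<in> arcs (contract (subquiver G B H2) (subquiver G B J2))"
      then have "a \<in> H2" unfolding c by simp
      then show "tail (contract (subquiver G (A \<union> B) (H1 \<union> H2)) (subquiver G (A \<union> B) (J1 \<union> J2))) a
          = tail (contract (subquiver G B H2) (subquiver G B J2)) a \<and>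
          head (contract (subquiver G (A \<union> B) (H1 \<union> H2)) (subquiver G (A \<union> B) (J1 \<union> J2))) a
          = head (contract (subquiver G B H2) (subquiver G B J2)) a"
        using c(3,4,11,12) comp_Un(2)[OF J' AB(3)] H by (auto simp: inside_def)
    qed (use comp_image_Un[OF J' AB(3)] in \<open>simp_all add: c\<close>)
  qed
  have bij: "(\<Sum>J\<in>Pow (H1 \<union> H2). f J) = (\<Sum>(J1, J2)\<in>Pow H1 \<times> Pow H2. f (J1 \<union> J2))"
      for f :: "'b set \<Rightarrow> 'c"
  proof -
    have H12: "H1 \<inter> H2 = {}" using H disj by blast
    show ?thesis
      by (rule sum.reindex_bij_witness[of _ "\<lambda>(J1, J2). J1 \<union> J2" "\<lambda>J. (J \<inter> H1, J \<inter> H2)"])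
        (use H12 in \<open>auto simp: Int_Un_distrib[symmetric] Int_absorb2\<close>)
  qed
  let ?S = "Pow H1 \<times> Pow H2"
  have finS: "finite ?S" "(H1, H2) \<in> ?S" using fin by auto
  have 1: "(\<Sum>(J1, J2)\<in>?S. ?o (A \<union> B) (J1 \<union> J2) * (?e A H1 J1 * ?e B H2 J2)) = (if H1 \<union> H2
      = {} then 1 else 0)"
  proof -
    have "(\<Sum>(J1, J2)\<in>?S. ?o (A \<union> B) (J1 \<union> J2) * (?e A H1 J1 * ?e B H2 J2))
        = (\<Sum>(J1, J2)\<in>?S. ?o (A \<union> B) (J1 \<union> J2) * ?e (A \<union> B) (H1 \<union> H2) (J1 \<union> J2))"
      by (intro sum.cong refl) (auto simp: e)
    then show ?thesis using omega_recursion[OF G sub HAB, of \<beta>] unfolding bij by simp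
  qed
  have 2: "(\<Sum>(J1, J2)\<in>?S. (?o A J1 * ?o B J2) * (?e A H1 J1 * ?e B H2 J2)) = (if H1 \<union> H2
      = {} then 1 else 0)"
  proof -
    have "(\<Sum>(J1, J2)\<in>?S. (?o A J1 * ?o B J2) * (?e A H1 J1 * ?e B H2 J2))
        = (\<Sum>J1\<in>Pow H1. ?o A J1 * ?e A H1 J1) * (\<Sum>J2\<in>Pow H2. ?o B J2 * ?e B H2 J2)"
      by (simp add: sum_product sum.cartesian_product algebra_simps)
    then show ?thesis
      unfolding omega_recursion[OF G AB(1) H(1)] omega_recursion[OF G AB(2) H(2)] by auto
  qed
  have 3: "(\<Sum>(J1, J2)\<in>?S - {(H1, H2)}. ?o (A \<union> B) (J1 \<union> J2) * (?e A H1 J1 * ?e B H2 J2))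
      = (\<Sum>(J1, J2)\<in>?S - {(H1, H2)}. (?o A J1 * ?o B J2) * (?e A H1 J1 * ?e B H2 J2))"
  proof (intro sum.cong refl, goal_cases)
    case (1 J)
    obtain J1 J2 where J12: "J = (J1, J2)" by (cases J)
    with 1 have J: "J1 \<subseteq> H1" "J2 \<subseteq> H2" "(J1, J2) \<noteq> (H1, H2)" by auto
    have "J1 \<union> J2 \<noteq> H1 \<union> H2" using J H disj by blast
    then have "card (J1 \<union> J2) < card (H1 \<union> H2)"
      using J fin by (intro psubset_card_mono) auto
    then have "?o (A \<union> B) (J1 \<union> J2) = ?o A J1 * ?o B J2"
      using less.hyps J H by blast
    then show ?case by (simp add: J12)
  qed
  have "?o (A \<union> B) (H1 \<union> H2) * (?e A H1 H1 * ?e B H2 H2)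
      = (?o A H1 * ?o B H2) * (?e A H1 H1 * ?e B H2 H2)"
    using trans[OF 1 2[symmetric]] unfolding sum.remove[OF finS] 3
    by (simp only: case_prod_conv add_right_cancel)
  moreover have "?e A H1 H1 \<noteq> 0" "?e B H2 H2 \<noteq> 0"
    using e_char_contract_self fin_digraph_subquiver[OF G] AB H by blast+
  ultimately show ?case by simp
qed

section \<open>The weighted order polynomial\<close>

text \<open>
  The arc sets \<open>H\<close> for which the contraction of the induced subquiver on \<open>X\<close> by \<open>H\<close> has no tadpole.
\<close>

definition closed_cuts :: "('a, 'b) pre_digraph \<Rightarrow> 'a set \<Rightarrow> 'b set set" where
  "closed_cuts G X = {H. H \<subseteq> inside G X \<and>
     (\<forall>a\<in>inside G X - H. comp_of G H (tail G a) \<noteq> comp_of G H (head G a))}"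

lemma closed_cutsD: "H \<in> closed_cuts G X \<Longrightarrow> H \<subseteq> inside G X"
  by (simp add: closed_cuts_def)

lemma finite_closed_cuts: "finite (arcs G) \<Longrightarrow> finite (closed_cuts G X)"
  by (rule finite_subset[of _ "Pow (inside G X)"]) (auto simp: closed_cuts_def finite_inside)

lemma closed_cuts_Un:
  assumes H1: "H1 \<in> closed_cuts G A" and H2: "H2 \<in> closed_cuts G B" and AB: "A \<inter> B = {}"
  shows "H1 \<union> H2 \<in> closed_cuts G (A \<union> B)"
    "(H1 \<union> H2) \<inter> inside G A = H1" "(H1 \<union> H2) \<inter> inside G B = H2"
proof -
  note sub = closed_cutsD[OF H1] closed_cutsD[OF H2]
  have disj: "inside G A \<inter> inside G B = {}" using AB by (auto simp: inside_def)
  show "(H1 \<union> H2) \<inter> inside G A = H1" "(H1 \<union> H2) \<inter> inside G B = H2"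
    using sub disj by blast+
  have "comp_of G (H1 \<union> H2) (tail G a) \<noteq> comp_of G (H1 \<union> H2) (head G a)"
    if a: "a \<in> inside G (A \<union> B)" "a \<notin> H1 \<union> H2" for a
  proof -
    note c = comp_Un[OF sub AB] and d = comp_image_Un(2)[OF sub AB]
    consider "tail G a \<in> A" "head G a \<in> A" | "tail G a \<in> B" "head G a \<in> B"
      | "tail G a \<in> A" "head G a \<in> B" | "tail G a \<in> B" "head G a \<in> A"
      using insideD[OF a(1)] by blast
    then show ?thesis
    proof cases
      case 1
      then have "a \<in> inside G A - H1" using a by (auto simp: inside_def)
      then show ?thesis using H1 1 by (simp add: c closed_cuts_def)
    next
      case 2
      then have "a \<in> inside G B - H2" using a by (auto simp: inside_def)
      then show ?thesis using H2 2 by (simp add: c closed_cuts_def)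
    next
      case 3
      then show ?thesis using d by (simp add: c) blast
    next
      case 4
      then show ?thesis using d by (simp add: c) blast
    qed
  qed
  moreover have "H1 \<union> H2 \<subseteq> inside G (A \<union> B)" using sub by (auto simp: inside_def)
  ultimately show "H1 \<union> H2 \<in> closed_cuts G (A \<union> B)" by (simp add: closed_cuts_def)
qed

text \<open>
  A closed cut and a set of its components yield closed cuts of the union of these components and of
  its complement. Together with \<open>closed_cuts_Un\<close> this is a bijection.
\<close>

lemma closed_cuts_split:
  assumes H: "H \<in> closed_cuts G X" and \<A>: "\<A> \<subseteq> comp_of G H ` X"
  shows "\<Union>\<A> \<subseteq> X" "X - \<Union>\<A> = \<Union>(comp_of G H ` X - \<A>)"
    "H \<inter> inside G (\<Union>\<A>) \<union> H \<inter> inside G (X - \<Union>\<A>) = H"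
    "comp_of G (H \<inter> inside G (\<Union>\<A>)) ` (\<Union>\<A>) = \<A>"
    "comp_of G (H \<inter> inside G (X - \<Union>\<A>)) ` (X - \<Union>\<A>) = comp_of G H ` X - \<A>"
    "H \<inter> inside G (\<Union>\<A>) \<in> closed_cuts G (\<Union>\<A>)"
    "H \<inter> inside G (X - \<Union>\<A>) \<in> closed_cuts G (X - \<Union>\<A>)"
proof -
  note sub = closed_cutsD[OF H]
  have key: "\<Union>\<B> \<subseteq> X \<and> (\<forall>v\<in>X. v \<in> \<Union>\<B> \<longleftrightarrow> comp_of G H v \<in> \<B>) \<and>
      (\<forall>v\<in>\<Union>\<B>. comp_of G (H \<inter> inside G (\<Union>\<B>)) v = comp_of G H v) \<and>
      comp_of G (H \<inter> inside G (\<Union>\<B>)) ` (\<Union>\<B>) = \<B> \<and>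
      H \<inter> inside G (\<Union>\<B>) \<in> closed_cuts G (\<Union>\<B>)"
    if \<B>: "\<B> \<subseteq> comp_of G H ` X" for \<B>
  proof -
    have 1: "\<Union>\<B> \<subseteq> X" using Union_comp[OF sub] \<B> by blast
    have 2: "v \<in> \<Union>\<B> \<longleftrightarrow> comp_of G H v \<in> \<B>" for v
    proof
      assume "v \<in> \<Union>\<B>"
      then obtain C u where C: "C \<in> \<B>" "v \<in> C" "C = comp_of G H u" using \<B> by blast
      then have "comp_of G H v = C" using comp_eqI[of v G H u] by simp
      then show "comp_of G H v \<in> \<B>" using C by simp
    next
      assume "comp_of G H v \<in> \<B>"
      then show "v \<in> \<Union>\<B>" using comp_refl[of v G H] by blast
    qed
    have arcsB: "tail G a \<in> \<Union>\<B> \<longleftrightarrow> head G a \<in> \<Union>\<B>" if "a \<in> H" for a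
      unfolding 2 comp_arc[OF that] ..
    have 3: "comp_of G (H \<inter> inside G (\<Union>\<B>)) v = comp_of G H v" if "v \<in> \<Union>\<B>" for v
    proof -
      have "a \<in> H \<and> tail G a \<in> \<Union>\<B> \<longleftrightarrow> a \<in> H \<inter> inside G (\<Union>\<B>)" for a
        using arcsB[of a] insideD[of a G X] sub unfolding inside_def by blast
      from comp_restrict[of H G "\<Union>\<B>", OF arcsB this that] show ?thesis by simp
    qed
    have 4: "comp_of G (H \<inter> inside G (\<Union>\<B>)) ` (\<Union>\<B>) = \<B>"
    proof -
      have "comp_of G (H \<inter> inside G (\<Union>\<B>)) ` (\<Union>\<B>) = comp_of G H ` (\<Union>\<B>)"
        using 3 by (intro image_cong) auto
      also have "\<dots> = \<B>"
      proof (intro equalityI subsetI)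
        fix C assume "C \<in> comp_of G H ` (\<Union>\<B>)"
        then show "C \<in> \<B>" using 2 by blast
      next
        fix C assume C: "C \<in> \<B>"
        then obtain u where u: "C = comp_of G H u" using \<B> by blast
        then have "u \<in> \<Union>\<B>" using 2[of u] C by simp
        then show "C \<in> comp_of G H ` (\<Union>\<B>)" using u by blast
      qed
      finally show ?thesis .
    qed
    have 5: "H \<inter> inside G (\<Union>\<B>) \<in> closed_cuts G (\<Union>\<B>)"
    proof -
      have "comp_of G (H \<inter> inside G (\<Union>\<B>)) (tail G a) \<noteq> comp_of G (H \<inter> inside G (\<Union>\<B>)) (head G a)"
        if a: "a \<in> inside G (\<Union>\<B>) - H \<inter> inside G (\<Union>\<B>)" for a
      proof -
        have ends: "tail G a \<in> \<Union>\<B>" "head G a \<in> \<Union>\<B>" using a insideD[of a G "\<Union>\<B>"] by auto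
        have "a \<in> inside G X - H" using a inside_mono[OF 1, of G] by blast
        then show ?thesis unfolding 3[OF ends(1)] 3[OF ends(2)] using H by (simp add: closed_cuts_def)
      qed
      then show ?thesis unfolding closed_cuts_def by blast
    qed
    show ?thesis by (intro conjI ballI 1 2 3 4 5)
  qed
  let ?\<B> = "comp_of G H ` X - \<A>"
  note kA = key[OF \<A>] and kB = key[OF Diff_subset[of "comp_of G H ` X" \<A>]]
  have memA: "v \<in> \<Union>\<A> \<longleftrightarrow> comp_of G H v \<in> \<A>" if "v \<in> X" for v
    using kA that by (elim conjE) (rule bspec)
  have memB: "v \<in> \<Union>?\<B> \<longleftrightarrow> comp_of G H v \<in> ?\<B>" if "v \<in> X" for v
    using kB that by (elim conjE) (rule bspec)
  have subB: "\<Union>?\<B> \<subseteq> X" using kB by (elim conjE)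
  show A: "\<Union>\<A> \<subseteq> X" using kA by (elim conjE)
  show B: "X - \<Union>\<A> = \<Union>?\<B>"
  proof (intro equalityI subsetI)
    fix v assume "v \<in> X - \<Union>\<A>"
    then show "v \<in> \<Union>?\<B>" using memA[of v] memB[of v] by simp
  next
    fix v assume v: "v \<in> \<Union>?\<B>"
    then have "v \<in> X" using subB by (rule subsetD[rotated])
    then show "v \<in> X - \<Union>\<A>" using memA[of v] memB[of v] v by simp
  qed
  show "comp_of G (H \<inter> inside G (\<Union>\<A>)) ` (\<Union>\<A>) = \<A>"
    "H \<inter> inside G (\<Union>\<A>) \<in> closed_cuts G (\<Union>\<A>)" using kA by - (elim conjE, assumption)+
  show "comp_of G (H \<inter> inside G (X - \<Union>\<A>)) ` (X - \<Union>\<A>) = ?\<B>"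
    "H \<inter> inside G (X - \<Union>\<A>) \<in> closed_cuts G (X - \<Union>\<A>)"
    unfolding B using kB by - (elim conjE, assumption)+
  show "H \<inter> inside G (\<Union>\<A>) \<union> H \<inter> inside G (X - \<Union>\<A>) = H"
  proof -
    have "a \<in> inside G (\<Union>\<A>) \<union> inside G (X - \<Union>\<A>)" if a: "a \<in> H" for a
    proof -
      have i: "a \<in> arcs G" "tail G a \<in> X" "head G a \<in> X" using insideD[of a G X] a sub by auto
      have "tail G a \<in> \<Union>\<A> \<longleftrightarrow> head G a \<in> \<Union>\<A>"
        unfolding memA[OF i(2)] memA[OF i(3)] comp_arc[OF a] ..
      then show ?thesis using i unfolding inside_def by blast
    qed
    then show ?thesis by blast
  qed
qed

lemma sum_closed_cuts_split:
  fixes f :: "'a set \<Rightarrow> 'b set \<Rightarrow> 'b set \<Rightarrow> 'k::comm_ring_1"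
  assumes "finite (arcs G)" "finite X"
  shows "(\<Sum>A\<in>Pow X. \<Sum>H1\<in>closed_cuts G A. \<Sum>H2\<in>closed_cuts G (X - A). f A H1 H2)
    = (\<Sum>H\<in>closed_cuts G X. \<Sum>\<A>\<in>Pow (comp_of G H ` X).
        f (\<Union>\<A>) (H \<inter> inside G (\<Union>\<A>)) (H \<inter> inside G (X - \<Union>\<A>)))"
proof -
  let ?S = "SIGMA A:Pow X. closed_cuts G A \<times> closed_cuts G (X - A)"
  let ?T = "SIGMA H:closed_cuts G X. Pow (comp_of G H ` X)"
  let ?i = "\<lambda>(H, \<A>). (\<Union>\<A>, H \<inter> inside G (\<Union>\<A>), H \<inter> inside G (X - \<Union>\<A>))"
  let ?j = "\<lambda>(A, H1, H2). (H1 \<union> H2, comp_of G H1 ` A)"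
  have "(\<Sum>A\<in>Pow X. \<Sum>H1\<in>closed_cuts G A. \<Sum>H2\<in>closed_cuts G (X - A). f A H1 H2)
      = (\<Sum>(A, H1, H2)\<in>?S. f A H1 H2)"
    using assms finite_closed_cuts[OF assms(1)]
    by (simp add: sum.cartesian_product sum.Sigma case_prod_beta)
  also have "\<dots> = (\<Sum>(H, \<A>)\<in>?T. f (\<Union>\<A>) (H \<inter> inside G (\<Union>\<A>)) (H \<inter> inside G (X - \<Union>\<A>)))"
  proof (rule sum.reindex_bij_witness[of _ ?i ?j])
    fix x assume "x \<in> ?S"
    then obtain A H1 H2 where x: "x = (A, H1, H2)" "A \<subseteq> X" "H1 \<in> closed_cuts G A" "H2 \<in> closed_cuts G (X - A)"
      by auto
    have AX: "A \<inter> (X - A) = {}" "A \<union> (X - A) = X" using x(2) by auto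
    note sub = closed_cutsD[OF x(3)] closed_cutsD[OF x(4)]
    note U = closed_cuts_Un[OF x(3,4) AX(1), unfolded AX(2)]
    have un: "\<Union>(comp_of G H1 ` A) = A" by (rule Union_comp[OF sub(1)])
    show ij: "?i (?j x) = x" unfolding x(1) case_prod_conv un U(2,3) ..
    have "comp_of G H1 ` A \<subseteq> comp_of G (H1 \<union> H2) ` X"
      using comp_image_Un(1)[OF sub AX(1)] unfolding AX(2) by blast
    then show "?j x \<in> ?T" using U(1) by (simp add: x(1))
    show "(case ?j x of (H, \<A>) \<Rightarrow> f (\<Union>\<A>) (H \<inter> inside G (\<Union>\<A>)) (H \<inter> inside G (X - \<Union>\<A>)))
        = (case x of (A, H1, H2) \<Rightarrow> f A H1 H2)"
      unfolding x(1) case_prod_conv un U(2,3) ..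
  next
    fix y assume "y \<in> ?T"
    then obtain H \<A> where y: "y = (H, \<A>)" "H \<in> closed_cuts G X" "\<A> \<subseteq> comp_of G H ` X" by auto
    note sp = closed_cuts_split[OF y(2,3)]
    show "?j (?i y) = y" unfolding y(1) case_prod_conv sp(3,4) ..
    show "?i y \<in> ?S" unfolding y(1) using sp(1,6,7) by simp
  qed
  also have "\<dots> = (\<Sum>H\<in>closed_cuts G X. \<Sum>\<A>\<in>Pow (comp_of G H ` X).
        f (\<Union>\<A>) (H \<inter> inside G (\<Union>\<A>)) (H \<inter> inside G (X - \<Union>\<A>)))"
    by (rule sum.Sigma[symmetric]) (use assms finite_closed_cuts[OF assms(1)] in auto)
  finally show ?thesis .
qed

abbreviation beta_weight :: "('a, 'b) pre_digraph \<Rightarrow> ('b \<Rightarrow> 'k) \<Rightarrow> 'a set \<Rightarrow> 'a set \<Rightarrow> 'k::field_char_0" where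
  "beta_weight G \<beta> \<equiv> arc_weight G (beta_plus \<beta>) (beta_minus \<beta>)"

text \<open>
  The polynomial \<open>\<Phi>\<^bsub>X\<^esub>(t)\<close>, by its coefficients. By \<open>Phi_1\<close> and \<open>Phi_add\<close> below,
  its value at a positive integer \<open>N\<close> is the weighted count of the maps from \<open>X\<close> to \<open>{1..N}\<close>.
\<close>

definition Phi :: "('b \<Rightarrow> 'k::field_char_0) \<Rightarrow> ('a, 'b) pre_digraph \<Rightarrow> 'a set \<Rightarrow> 'k \<Rightarrow> 'k" where
  "Phi \<beta> G X t = (\<Sum>H\<in>closed_cuts G X. omega \<beta> (subquiver G X H) *
     order_vol (beta_weight G \<beta>) (comp_of G H ` X) * t ^ card (comp_of G H ` X))"

text \<open>
  The product of two values of \<open>Phi\<close>, summed over all splittings of \<open>X\<close> around a set \<open>S\<close>. It is used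
  for \<open>S\<close> empty, where it gives the addition theorem, and for \<open>S\<close> consisting of the semi-root.
\<close>

lemma Phi_sandwich:
  assumes G: "fin_digraph G" and X: "X \<subseteq> verts G"
  shows "(\<Sum>A\<in>Pow X. beta_weight G \<beta> A S * beta_weight G \<beta> S (X - A) * beta_weight G \<beta> A (X - A) *
      Phi \<beta> G A s * Phi \<beta> G (X - A) t)
    = (\<Sum>H\<in>closed_cuts G X. omega \<beta> (subquiver G X H) *
        two_sided (beta_weight G \<beta>) (\<lambda>C. beta_weight G \<beta> C S * s) (\<lambda>C. beta_weight G \<beta> S C * t)
          (comp_of G H ` X))"
proof -
  interpret fin_digraph G by fact
  have finX: "finite X" using finite_subset[OF X] by simp
  let ?w = "beta_weight G \<beta>" and ?o = "\<lambda>X H. omega \<beta> (subquiver G X H)"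
  let ?g = "\<lambda>X H t. ?o X H * order_vol ?w (comp_of G H ` X) * t ^ card (comp_of G H ` X)"
  have "(\<Sum>A\<in>Pow X. ?w A S * ?w S (X - A) * ?w A (X - A) * Phi \<beta> G A s * Phi \<beta> G (X - A) t)
    = (\<Sum>A\<in>Pow X. \<Sum>H1\<in>closed_cuts G A. \<Sum>H2\<in>closed_cuts G (X - A).
        ?w A S * ?w S (X - A) * ?w A (X - A) * ?g A H1 s * ?g (X - A) H2 t)"
    unfolding Phi_def by (simp only: sum_distrib_left sum_distrib_right)
      (intro sum.cong refl sum.swap)
  also have "\<dots> = (\<Sum>H\<in>closed_cuts G X. \<Sum>\<A>\<in>Pow (comp_of G H ` X).
        ?w (\<Union>\<A>) S * ?w S (X - \<Union>\<A>) * ?w (\<Union>\<A>) (X - \<Union>\<A>) *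
        ?g (\<Union>\<A>) (H \<inter> inside G (\<Union>\<A>)) s * ?g (X - \<Union>\<A>) (H \<inter> inside G (X - \<Union>\<A>)) t)"
    by (rule sum_closed_cuts_split) (use finX in auto)
  also have "\<dots> = (\<Sum>H\<in>closed_cuts G X. ?o X H *
        two_sided ?w (\<lambda>C. ?w C S * s) (\<lambda>C. ?w S C * t) (comp_of G H ` X))"
    unfolding two_sided_def sum_distrib_left
  proof (intro sum.cong refl)
    fix H \<A> assume H: "H \<in> closed_cuts G X" and "\<A> \<in> Pow (comp_of G H ` X)"
    then have \<A>: "\<A> \<subseteq> comp_of G H ` X" by simp
    note sp = closed_cuts_split[OF H \<A>]
    let ?\<B> = "comp_of G H ` X - \<A>"
    have fin: "finite \<A>" "finite ?\<B>" using finX finite_subset[OF \<A>] by auto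
    have dj: "disjoint_family_on (\<lambda>C. C) \<C>" if "\<C> \<subseteq> comp_of G H ` X" for \<C>
      unfolding disjoint_family_on_def
      by (intro ballI impI comp_image_disjoint[of _ G H X _ X]) (use that in auto)
    have djA: "disjoint_family_on (\<lambda>C. C) \<A>" and djB: "disjoint_family_on (\<lambda>C. C) ?\<B>"
      using dj \<A> by blast+
    have djS: "disjoint_family_on (\<lambda>C. C) {S}" by (simp add: disjoint_family_on_def)
    have wAS: "?w (\<Union>\<A>) S = (\<Prod>C\<in>\<A>. ?w C S)"
      using pair_weight_arc_weight[OF finite_arcs fin(1) _ djA djS, of "beta_plus \<beta>" "beta_minus \<beta>"]
      by (simp add: pair_weight_def)
    have wSB: "?w S (\<Union>?\<B>) = (\<Prod>C\<in>?\<B>. ?w S C)"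
      using pair_weight_arc_weight[OF finite_arcs _ fin(2) djS djB, of "beta_plus \<beta>" "beta_minus \<beta>"]
      by (simp add: pair_weight_def)
    have wAB: "?w (\<Union>\<A>) (\<Union>?\<B>) = pair_weight ?w \<A> ?\<B>"
      using pair_weight_arc_weight[OF finite_arcs fin djA djB, of "beta_plus \<beta>" "beta_minus \<beta>"]
          by simp
    have o: "?o (\<Union>\<A>) (H \<inter> inside G (\<Union>\<A>)) * ?o (X - \<Union>\<A>) (H \<inter> inside G (X - \<Union>\<A>)) = ?o X H"
    proof -
      have e: "\<Union>\<A> \<inter> (X - \<Union>\<A>) = {}" "\<Union>\<A> \<union> (X - \<Union>\<A>) = X"
        using sp(1) by auto
      have "\<Union>\<A> \<subseteq> verts G" "X - \<Union>\<A> \<subseteq> verts G"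
        using subset_trans[OF sp(1) X] X by auto
      from omega_disjoint_union[OF G this e(1), of "H \<inter> inside G (\<Union>\<A>)"
          "H \<inter> inside G (X - \<Union>\<A>)" \<beta>, OF Int_lower2 Int_lower2]
      show ?thesis unfolding e(2) sp(3) by (rule sym)
    qed
    have "?w (\<Union>\<A>) S * ?w S (X - \<Union>\<A>) * ?w (\<Union>\<A>) (X - \<Union>\<A>) *
        ?g (\<Union>\<A>) (H \<inter> inside G (\<Union>\<A>)) s * ?g (X - \<Union>\<A>) (H \<inter> inside G (X - \<Union>\<A>)) t
      = (?o (\<Union>\<A>) (H \<inter> inside G (\<Union>\<A>)) * ?o (X - \<Union>\<A>) (H \<inter> inside G (X - \<Union>\<A>))) *
        (((?w (\<Union>\<A>) S) * s ^ card \<A>) * (?w S (\<Union>?\<B>) * t ^ card ?\<B>) * ?w (\<Union>\<A>) (\<Union>?\<B>) *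
         order_vol ?w \<A> * order_vol ?w ?\<B>)"
      unfolding sp(4,5) unfolding sp(2) by (simp only: mult_ac)
    then show "?w (\<Union>\<A>) S * ?w S (X - \<Union>\<A>) * ?w (\<Union>\<A>) (X - \<Union>\<A>) *
        ?g (\<Union>\<A>) (H \<inter> inside G (\<Union>\<A>)) s * ?g (X - \<Union>\<A>) (H \<inter> inside G (X - \<Union>\<A>)) t
      = ?o X H * ((\<Prod>C\<in>\<A>. ?w C S * s) * (\<Prod>C\<in>?\<B>. ?w S C * t) * pair_weight ?w \<A> ?\<B> * order_vol ?w \<A>
          * order_vol ?w ?\<B>)"
      unfolding o wAS wSB wAB by (simp add: prod.distrib)
  qed
  finally show ?thesis .
qed

lemma Phi_add:
  assumes "fin_digraph G" "X \<subseteq> verts G"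
  shows "Phi \<beta> G X (s + t) = (\<Sum>A\<in>Pow X. beta_weight G \<beta> A (X - A) * Phi \<beta> G A s * Phi \<beta> G (X - A) t)"
proof -
  interpret fin_digraph G by fact
  have "finite X" using finite_subset[OF assms(2)] by simp
  then show ?thesis
    using Phi_sandwich[OF assms, of \<beta> "{}" s t]
    by (simp add: two_sided_const Phi_def mult_ac)
qed

lemma Phi_0:
  assumes "finite X" "X \<noteq> {}"
  shows "Phi \<beta> G X 0 = 0"
  unfolding Phi_def using assms by (intro sum.neutral ballI) (simp add: zero_power card_gt_0_iff)

text \<open>
  The weights of the contraction between two of its vertices are those of \<open>G\<close> between the two
  components.
\<close>

lemma arc_weight_contract:
  assumes H: "H \<subseteq> inside G X" and CD: "C \<in> comp_of G H ` X" "D \<in> comp_of G H ` X" "C \<noteq> D"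
  shows "arc_weight (contract (subquiver G X (inside G X)) (subquiver G X H)) p m {C} {D}
    = arc_weight G p m C D"
proof -
  let ?Q = "contract (subquiver G X (inside G X)) (subquiver G X H)"
  note Q = contract_subquiver[OF order_refl H]
  have eq: "{a \<in> arcs ?Q. tail ?Q a \<in> {C} \<and> head ?Q a \<in> {D}}
      = {a \<in> arcs G. tail G a \<in> C \<and> head G a \<in> D}"
    if CD: "C \<in> comp_of G H ` X" "D \<in> comp_of G H ` X" "C \<noteq> D" for C D
  proof -
    obtain u v where u: "u \<in> X" "C = comp_of G H u" and v: "v \<in> X" "D = comp_of G H v"
      using CD by blast
    have sub: "C \<subseteq> X" "D \<subseteq> X" using comp_subset[OF H] u v by auto
    have mem: "x \<in> C \<longleftrightarrow> comp_of G H x = C" "x \<in> D \<longleftrightarrow> comp_of G H x = D" for x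
      unfolding u(2) v(2) comp_eq_iff by (rule refl)+
    have "a \<in> arcs ?Q \<and> tail ?Q a \<in> {C} \<and> head ?Q a \<in> {D} \<longleftrightarrow>
        a \<in> inside G X - H \<and> comp_of G H (tail G a) = C \<and> comp_of G H (head G a) = D" for a
      using Q(3)[of a] Q(4)[of a] unfolding Q(2) by (cases "a \<in> inside G X") simp_all
    moreover have "a \<in> inside G X - H \<and> comp_of G H (tail G a) = C \<and> comp_of G H (head G a) = D \<longleftrightarrow>
        a \<in> arcs G \<and> tail G a \<in> C \<and> head G a \<in> D" for a
      unfolding mem using comp_arc[of a H G] CD(3) sub mem unfolding inside_def by auto
    ultimately show ?thesis by simp
  qed
  show ?thesis unfolding arc_weight_def eq[OF CD] eq[OF CD(2,1) CD(3)[symmetric]] ..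
qed

text \<open>
  The recursion of \<open>\<omega>\<close>, multiplied by \<open>beta_minus\<close> of the missing arcs and summed over all arc sets
  \<open>E\<close>, leaves only the term \<open>E = {}\<close> on one side. On the other side the sum over the arcs outside \<open>H\<close>
  turns the weights \<open>1\<close> and \<open>0\<close> of an arc pointing upwards or downwards into \<open>beta_plus\<close> and
  \<open>beta_minus\<close>, and the weight \<open>- beta_minus\<close> of a tadpole into \<open>0\<close>.
\<close>

lemma Phi_1:
  assumes G: "fin_digraph G" and X: "X \<subseteq> verts G"
  shows "Phi \<beta> G X 1 = (\<Prod>a\<in>inside G X. beta_minus \<beta> a)"
proof -
  interpret fin_digraph G by fact
  let ?E = "inside G X" and ?b = "beta_minus \<beta>"
  let ?e = "\<lambda>E H. e_char \<beta> (contract (subquiver G X E) (subquiver G X H))"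
  let ?o = "\<lambda>H. omega \<beta> (subquiver G X H)"
  have finE: "finite ?E" by (simp add: finite_inside)
  have finX: "finite X" using finite_subset[OF X] by simp
  \<comment> \<open>The sum over the arc sets \<open>H \<union> F\<close> that contain a fixed cut \<open>H\<close>.\<close>
  have inner: "(\<Sum>F\<in>Pow (?E - H). (\<Prod>a\<in>?E - H - F. ?b a) * ?e (H \<union> F) H)
      = (if H \<in> closed_cuts G X then order_vol (beta_weight G \<beta>) (comp_of G H ` X) else 0)"
    if H: "H \<subseteq> ?E" for H
  proof -
    let ?V = "comp_of G H ` X"
    let ?t = "\<lambda>a. comp_of G H (tail G a)" and ?h = "\<lambda>a. comp_of G H (head G a)"
    let ?y = "\<lambda>r a. if ?t a = ?h a then - ?b a else if (?t a, ?h a) \<in> r then 1 else 0"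
    let ?Q = "contract (subquiver G X ?E) (subquiver G X H)"
    note Q = contract_subquiver[OF order_refl H]
    have Qfin: "fin_digraph ?Q" by (rule fin_digraph_contract_subquiver[OF G X order_refl H])
    have e: "?e (H \<union> F) H = (\<Sum>r\<in>linear_orders ?V. \<Prod>a\<in>F. ?y r a) / fact (card ?V)"
      if F: "F \<subseteq> ?E - H" for F
    proof -
      have HF: "H \<union> F \<subseteq> ?E" "H \<subseteq> H \<union> F" "H \<union> F - H = F" using H F by auto
      note c = contract_subquiver[OF HF(1,2)]
      have "(\<Prod>a\<in>F. if tail (contract (subquiver G X (H \<union> F)) (subquiver G X H)) a
              = head (contract (subquiver G X (H \<union> F)) (subquiver G X H)) a then - ?b a
           else if (tail (contract (subquiver G X (H \<union> F)) (subquiver G X H)) a,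
              head (contract (subquiver G X (H \<union> F)) (subquiver G X H)) a) \<in> r then 1 else 0)
          = (\<Prod>a\<in>F. ?y r a)" for r
        by (intro prod.cong refl) (simp add: c)
      then show ?thesis
        unfolding e_char_eq_sum[OF fin_digraph_contract_subquiver[OF G X HF(1,2)]] c(1,2) HF(3)
        by (simp only:)
    qed
    have prod: "(\<Sum>F\<in>Pow (?E - H). (\<Prod>a\<in>?E - H - F. ?b a) * (\<Prod>a\<in>F. ?y r a))
        = (\<Prod>a\<in>?E - H. ?y r a + ?b a)" for r
      using finE by (subst prod_add) (auto simp: mult.commute)
    have "(\<Sum>F\<in>Pow (?E - H). (\<Prod>a\<in>?E - H - F. ?b a) * ?e (H \<union> F) H)
        = (\<Sum>F\<in>Pow (?E - H). \<Sum>r\<in>linear_orders ?V. (\<Prod>a\<in>?E - H - F. ?b a) * (\<Prod>a\<in>F. ?y r a)) / fact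
            (card ?V)"
      unfolding sum_divide_distrib by (intro sum.cong refl)
          (simp add: e sum_distrib_left sum_divide_distrib)
    also have "\<dots> = (\<Sum>r\<in>linear_orders ?V. \<Prod>a\<in>?E - H. ?y r a + ?b a) / fact (card ?V)"
      by (subst sum.swap) (simp only: prod)
    also have "\<dots> = (if H \<in> closed_cuts G X then order_vol (beta_weight G \<beta>) ?V else 0)"
    proof (cases "H \<in> closed_cuts G X")
      case True
      then have ne: "?t a \<noteq> ?h a" if "a \<in> ?E - H" for a using that by (simp add: closed_cuts_def)
      have no_tad: "tadpoles ?Q = {}" unfolding tadpoles_def Q(2) using Q(3,4) ne by auto
      have "(\<Prod>a\<in>?E - H. ?y r a + ?b a)
          = (\<Prod>a\<in>arcs ?Q - tadpoles ?Q. if (tail ?Q a, head ?Q a) \<in> r then beta_plus \<beta> a else ?b a)"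
              for r
        unfolding no_tad Q(2) Diff_empty
        by (intro prod.cong refl) (auto simp: Q(3,4) ne beta_plus_def beta_minus_def field_simps)
      then have "(\<Sum>r\<in>linear_orders ?V. \<Prod>a\<in>?E - H. ?y r a + ?b a) / fact (card ?V)
          = quiver_vol (beta_plus \<beta>) ?b ?Q"
        unfolding quiver_vol_eq_sum[OF Qfin] Q(1) by (simp only:)
      also have "\<dots> = order_vol (beta_weight G \<beta>) ?V"
        unfolding quiver_vol_def Q(1) by (rule order_vol_cong) (rule arc_weight_contract[OF H])
      finally show ?thesis using True by simp
    next
      case False
      then obtain a where a: "a \<in> ?E - H" "?t a = ?h a" using H by (auto simp: closed_cuts_def)
      have "(\<Prod>a\<in>?E - H. ?y r a + ?b a) = 0" for r
        using a finE by (intro prod_zero) auto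
      then show ?thesis using False by simp
    qed
    finally show ?thesis .
  qed
  have "(\<Prod>a\<in>?E. ?b a) = (\<Sum>E\<in>Pow ?E. (if E = {} then 1 else 0) * (\<Prod>a\<in>?E - E. ?b a))"
    using finE by (subst sum.remove[of _ "{}"]) (auto intro!: sum.neutral)
  also have "\<dots> = (\<Sum>E\<in>Pow ?E. \<Sum>H\<in>Pow E. ?o H * ((\<Prod>a\<in>?E - E. ?b a) * ?e E H))"
  proof (intro sum.cong refl)
    fix E assume "E \<in> Pow ?E"
    then have E: "E \<subseteq> ?E" by simp
    show "(if E = {} then 1 else 0) * (\<Prod>a\<in>?E - E. ?b a)
        = (\<Sum>H\<in>Pow E. ?o H * ((\<Prod>a\<in>?E - E. ?b a) * ?e E H))"
      unfolding omega_recursion[OF G X E, of \<beta>, symmetric] sum_distrib_right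
      by (simp only: mult_ac)
  qed
  also have "\<dots> = (\<Sum>H\<in>Pow ?E. \<Sum>F\<in>Pow (?E - H). ?o H * ((\<Prod>a\<in>?E - (H \<union> F). ?b a) * ?e (H \<union> F) H))"
    by (rule sum_Pow_chain[OF finE])
  also have "\<dots> = (\<Sum>H\<in>Pow ?E. ?o H * (if H \<in> closed_cuts G X then order_vol (beta_weight G \<beta>)
      (comp_of G H ` X) else 0))"
  proof (intro sum.cong refl)
    fix H assume "H \<in> Pow ?E"
    then have H: "H \<subseteq> ?E" by simp
    have d: "?E - (H \<union> F) = ?E - H - F" for F by auto
    show "(\<Sum>F\<in>Pow (?E - H). ?o H * ((\<Prod>a\<in>?E - (H \<union> F). ?b a) * ?e (H \<union> F) H))
       = ?o H * (if H \<in> closed_cuts G X then order_vol (beta_weight G \<beta>) (comp_of G H ` X) else 0)"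
      unfolding d sum_distrib_left[symmetric] inner[OF H] ..
  qed
  also have "\<dots> = Phi \<beta> G X 1"
    unfolding Phi_def using finE
    by (intro sum.mono_neutral_cong_right) (auto simp: closed_cuts_def)
  finally show ?thesis by simp
qed

section \<open>Splitting at a semi-root and the linear coefficient\<close>

text \<open>
  Splitting by the position of \<open>s\<close>. The upper part is evaluated at \<open>N - k\<close> rather than \<open>N - k - 1\<close>
  because it includes the vertices level with \<open>s\<close>.
\<close>

lemma Phi_semi_root:
  assumes G: "fin_digraph G" and s: "semi_root G s" and X: "X \<subseteq> verts G" "s \<notin> X"
  shows "Phi \<beta> G (insert s X) (of_nat N) = (\<Sum>k<N. \<Sum>A\<in>Pow X.
     beta_weight G \<beta> A {s} * beta_weight G \<beta> {s} (X - A) * beta_weight G \<beta> A (X - A) *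
     Phi \<beta> G A (of_nat k) * Phi \<beta> G (X - A) (of_nat (N - k)))"
  using X
proof (induction N arbitrary: X)
  case 0
  interpret fin_digraph G by fact
  have "finite X" using finite_subset[OF 0(1)] by simp
  then show ?case by (simp add: Phi_0)
next
  case (Suc N)
  interpret fin_digraph G by fact
  note X = Suc.prems
  let ?w = "beta_weight G \<beta>" and ?P = "Phi \<beta> G"
  have finX: "finite X" using finite_subset[OF X(1)] by simp
  have sV: "s \<in> verts G" and out: "\<And>a. a \<in> arcs G \<Longrightarrow> tail G a \<noteq> s"
    using s by (auto simp: semi_root_def out_arcs_def)
  have sX: "insert s X \<subseteq> verts G" using X sV by auto
  \<comment> \<open>This is where \<open>s\<close> being a semi-root enters: an arc from \<open>B\<close> to \<open>s\<close> has the same weight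
    \<open>beta_minus\<close> whether its tail lies level with \<open>s\<close> or above \<open>s\<close>.\<close>
  have tie: "?P (insert s B) 1 = ?w {s} B * ?P B 1" if B: "B \<subseteq> X" for B
  proof -
    have BV: "B \<subseteq> verts G" "insert s B \<subseteq> verts G" using B X sV by auto
    have "inside G (insert s B) = {a \<in> arcs G. tail G a \<in> B \<and> head G a = s} \<union> inside G B"
      using out by (auto simp: inside_def)
    moreover have "{a \<in> arcs G. tail G a \<in> B \<and> head G a = s} \<inter> inside G B = {}"
      using B X(2) by (auto simp: inside_def)
    ultimately have "(\<Prod>a\<in>inside G (insert s B). beta_minus \<beta> a)
       = (\<Prod>a\<in>{a \<in> arcs G. tail G a \<in> B \<and> head G a = s}. beta_minus \<beta> a) *
           (\<Prod>a\<in>inside G B. beta_minus \<beta> a)"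
      by (simp add: prod.union_disjoint finite_inside)
    moreover have "{a \<in> arcs G. tail G a \<in> {s} \<and> head G a \<in> B} = {}" using out by auto
    then have "?w {s} B = (\<Prod>a\<in>{a \<in> arcs G. tail G a \<in> B \<and> head G a = s}. beta_minus \<beta> a)"
      unfolding arc_weight_def by (simp only: prod.empty mult_1_left singleton_iff)
    ultimately show ?thesis by (simp only: Phi_1[OF G BV(1)] Phi_1[OF G BV(2)])
  qed
  have Un_l: "?w (A \<union> B) C = ?w A C * ?w B C" if "A \<inter> B = {}" for A B C
    by (rule arc_weight_Un_left[OF finite_arcs that])
  have Un_r: "?w C (A \<union> B) = ?w C A * ?w C B" if "A \<inter> B = {}" for A B C
    by (rule arc_weight_Un_right[OF finite_arcs that])
  let ?T = "\<lambda>N k A. ?w A {s} * ?w {s} (X - A) * ?w A (X - A) * ?P A (of_nat k) * ?P (X - A) (of_nat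
      (N - k))"
  have "?P (insert s X) (of_nat (Suc N)) = ?P (insert s X) (of_nat N + 1)" by (simp add: add.commute)
  also have "\<dots> = (\<Sum>A\<in>Pow (insert s X). ?w A (insert s X - A) * ?P A (of_nat N) * ?P
      (insert s X - A) 1)"
    by (rule Phi_add[OF G sX])
  also have "\<dots> = (\<Sum>A\<in>Pow X. ?w A (insert s X - A) * ?P A (of_nat N) * ?P (insert s X - A) 1)
     + (\<Sum>A\<in>Pow X. ?w (insert s A) (X - A) * ?P (insert s A) (of_nat N) * ?P (X - A) 1)"
  proof -
    have "(\<Sum>A\<in>insert s ` Pow X. ?w A (insert s X - A) * ?P A (of_nat N) * ?P (insert s X - A) 1)
       = (\<Sum>A\<in>Pow X. ?w (insert s A) (X - A) * ?P (insert s A) (of_nat N) * ?P (X - A) 1)"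
    proof (subst sum.reindex)
      show "inj_on (insert s) (Pow X)" using X(2) by (auto simp: inj_on_def insert_ident)
      have "insert s X - insert s A = X - A" for A using X(2) by auto
      then show "sum ((\<lambda>A. ?w A (insert s X - A) * ?P A (of_nat N) * ?P
          (insert s X - A) 1) \<circ> insert s) (Pow X)
         = (\<Sum>A\<in>Pow X. ?w (insert s A) (X - A) * ?P (insert s A) (of_nat N) * ?P (X - A) 1)"
        by simp
    qed
    moreover have "Pow X \<inter> insert s ` Pow X = {}" using X(2) by auto
    ultimately show ?thesis
      unfolding Pow_insert using finX by (simp add: sum.union_disjoint)
  qed
  also have "(\<Sum>A\<in>Pow X. ?w A (insert s X - A) * ?P A (of_nat N) * ?P (insert s X - A) 1)
     = (\<Sum>A\<in>Pow X. ?T (Suc N) N A)"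
  proof (intro sum.cong refl)
    fix A assume A: "A \<in> Pow X"
    have 1: "insert s X - A = insert s (X - A)" using A X(2) by auto
    have 2: "?w A (insert s (X - A)) = ?w A {s} * ?w A (X - A)"
      using Un_r[of "{s}" "X - A" A] X(2) by simp
    show "?w A (insert s X - A) * ?P A (of_nat N) * ?P (insert s X - A) 1 = ?T (Suc N) N A"
      unfolding 1 2 tie[OF Diff_subset] by simp
  qed
  also have "(\<Sum>A\<in>Pow X. ?w (insert s A) (X - A) * ?P (insert s A) (of_nat N) * ?P (X - A) 1)
     = (\<Sum>A\<in>Pow X. \<Sum>k<N. \<Sum>B\<in>Pow A. ?w (insert s A) (X - A) *
         (?w B {s} * ?w {s} (A - B) * ?w B (A - B) * ?P B (of_nat k) * ?P (A - B) (of_nat (N - k)))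
             * ?P (X - A) 1)"
  proof (intro sum.cong refl)
    fix A assume "A \<in> Pow X"
    then have A: "A \<subseteq> verts G" "s \<notin> A" using X by auto
    show "?w (insert s A) (X - A) * ?P (insert s A) (of_nat N) * ?P (X - A) 1
     = (\<Sum>k<N. \<Sum>B\<in>Pow A. ?w (insert s A) (X - A) *
         (?w B {s} * ?w {s} (A - B) * ?w B (A - B) * ?P B (of_nat k) * ?P (A - B) (of_nat (N - k)))
             * ?P (X - A) 1)"
      by (simp only: Suc.IH[OF A] sum_distrib_left sum_distrib_right)
  qed
  also have "\<dots> = (\<Sum>k<N. \<Sum>A\<in>Pow X. \<Sum>B\<in>Pow A. ?w (insert s A) (X - A) *
         (?w B {s} * ?w {s} (A - B) * ?w B (A - B) * ?P B (of_nat k) * ?P (A - B) (of_nat (N - k)))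
             * ?P (X - A) 1)"
    by (rule sum.swap)
  also have "\<dots> = (\<Sum>k<N. \<Sum>A\<in>Pow X. ?T (Suc N) k A)"
  proof (rule sum.cong[OF refl])
    fix k assume "k \<in> {..<N}"
    then have k: "of_nat (Suc N - k) = (of_nat (N - k) + 1 :: 'c)" by (simp add: Suc_diff_le)
    let ?g = "\<lambda>B A. ?w (insert s A) (X - A) *
         (?w B {s} * ?w {s} (A - B) * ?w B (A - B) * ?P B (of_nat k) * ?P (A - B) (of_nat (N - k)))
             * ?P (X - A) 1"
    have "(\<Sum>A\<in>Pow X. \<Sum>B\<in>Pow A. ?g B A) = (\<Sum>B\<in>Pow X. \<Sum>C\<in>Pow (X - B). ?g B (B \<union> C))"
      by (rule sum_Pow_chain[OF finX])
    also have "\<dots> = (\<Sum>B\<in>Pow X. ?T (Suc N) k B)"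
    proof (rule sum.cong[OF refl])
      fix B assume "B \<in> Pow X"
      then have B: "B \<subseteq> X" "X - B \<subseteq> verts G" using X by auto
      show "(\<Sum>C\<in>Pow (X - B). ?g B (B \<union> C)) = ?T (Suc N) k B"
        unfolding k Phi_add[OF G B(2)] sum_distrib_left
      proof (intro sum.cong refl)
        fix C assume "C \<in> Pow (X - B)"
        then have C: "C \<subseteq> X - B" by simp
        let ?D = "X - B - C"
        have e: "B \<union> C - B = C" "X - (B \<union> C) = ?D" "insert s (B \<union> C) = {s} \<union> (B \<union> C)" using C by auto
        have d: "{s} \<inter> (B \<union> C) = {}" "B \<inter> C = {}" "C \<inter> ?D = {}" using B C X(2) by auto
        have xb: "C \<union> ?D = X - B" using C by auto
        have "?w {s} (X - B) = ?w {s} C * ?w {s} ?D" "?w B (X - B) = ?w B C * ?w B ?D"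
          using Un_r[OF d(3)] unfolding xb by auto
        then show "?g B (B \<union> C) = ?w B {s} * ?w {s} (X - B) * ?w B (X - B) * ?P B (of_nat k) *
            (?w C (X - B - C) * ?P C (of_nat (N - k)) * ?P (X - B - C) 1)"
          unfolding e Un_l[OF d(1)] Un_l[OF d(2)] by (simp only: mult_ac)
      qed
    qed
    finally show "(\<Sum>A\<in>Pow X. \<Sum>B\<in>Pow A. ?g B A) = (\<Sum>A\<in>Pow X. ?T (Suc N) k A)" .
  qed
  finally show ?case by (simp add: add.commute)
qed

lemma closed_cuts_connected:
  assumes G: "fin_digraph G" and conn: "Digraph_Component.connected G"
    and H: "H \<in> closed_cuts G (verts G)"
  shows "card (comp_of G H ` verts G) = 1 \<longleftrightarrow> H = arcs G"
proof
  interpret fin_digraph G by fact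
  have E: "inside G (verts G) = arcs G" by (auto simp: inside_def)
  assume "card (comp_of G H ` verts G) = 1"
  then obtain C where C: "comp_of G H ` verts G = {C}" by (auto simp: card_1_singleton_iff)
  have "arcs G - H = {}"
  proof (rule ccontr)
    assume "arcs G - H \<noteq> {}"
    then obtain a where a: "a \<in> arcs G" "a \<notin> H" by auto
    have all: "comp_of G H v = C" if "v \<in> verts G" for v
      using imageI[OF that, of "comp_of G H"] unfolding C by simp
    have "comp_of G H (tail G a) = comp_of G H (head G a)" using a by (simp add: all)
    then show False using H a by (simp add: closed_cuts_def E)
  qed
  then show "H = arcs G" using closed_cutsD[OF H] unfolding E by blast
next
  interpret fin_digraph G by fact
  assume "H = arcs G"
  then have "comp_of G H ` verts G = (\<lambda>_. verts G) ` verts G"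
    using connected_comp[OF G conn] by (intro image_cong) auto
  moreover have "verts G \<noteq> {}" using conn by (auto simp: Digraph_Component.connected_def strongly_connected_def)
  ultimately show "card (comp_of G H ` verts G) = 1" by (simp add: image_constant_conv)
qed

text \<open>
  The linear coefficient of \<open>Phi\<close> comes from the closed cuts with a single component.
\<close>

lemma Phi_linear_coeff:
  assumes G: "fin_digraph G" and conn: "Digraph_Component.connected G"
  obtains L where "\<And>t. poly L t = Phi \<beta> G (verts G) t" "coeff L 1 = omega \<beta> G"
proof -
  interpret fin_digraph G by fact
  let ?V = "verts G"
  let ?c = "\<lambda>H. omega \<beta> (subquiver G ?V H) * order_vol (beta_weight G \<beta>) (comp_of G H ` ?V)"
  let ?n = "\<lambda>H. card (comp_of G H ` ?V)"
  define L where "L = (\<Sum>H\<in>closed_cuts G ?V. monom (?c H) (?n H))"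
  have E: "inside G ?V = arcs G" by (auto simp: inside_def)
  have self: "subquiver G ?V (arcs G) = G" by (simp add: subquiver_def)
  have mem: "arcs G \<in> closed_cuts G ?V" by (simp add: closed_cuts_def E)
  obtain C where C: "comp_of G (arcs G) ` ?V = {C}"
    using closed_cuts_connected[OF G conn mem] by (auto simp: card_1_singleton_iff)
  have "poly L t = Phi \<beta> G ?V t" for t
    by (simp add: L_def Phi_def poly_sum poly_monom)
  moreover have "coeff L 1 = omega \<beta> G"
  proof -
    have "coeff L 1 = (\<Sum>H\<in>closed_cuts G ?V. if H = arcs G then ?c H else 0)"
      unfolding L_def coeff_sum
      by (intro sum.cong refl) (use closed_cuts_connected[OF G conn] in \<open>simp add: coeff_monom\<close>)
    also have "\<dots> = ?c (arcs G)"
      using mem by (simp add: sum.delta finite_closed_cuts)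
    finally show ?thesis unfolding C self by simp
  qed
  ultimately show ?thesis by (rule that)
qed

lemma omega_eq_two_sided:
  assumes G: "fin_digraph G" and conn: "Digraph_Component.connected G" and s: "semi_root G s"
  defines "X \<equiv> verts G - {s}"
  shows "omega \<beta> G = (\<Sum>H\<in>closed_cuts G X. omega \<beta> (subquiver G X H) *
     (of_rat (bernoulli (card (comp_of G H ` X))) *
      two_sided (beta_weight G \<beta>) (\<lambda>C. beta_weight G \<beta> C {s}) (\<lambda>C. - beta_weight G \<beta> {s} C)
          (comp_of G H ` X)))"
proof -
  interpret fin_digraph G by fact
  let ?w = "beta_weight G \<beta>"
  have sV: "s \<in> verts G" using s by (simp add: semi_root_def)
  have X: "X \<subseteq> verts G" "s \<notin> X" "insert s X = verts G" using sV by (auto simp: X_def)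
  have finX: "finite X" using finite_subset[OF X(1)] by simp
  obtain L where L: "\<And>t. poly L t = Phi \<beta> G (verts G) t" "coeff L 1 = omega \<beta> G"
    using Phi_linear_coeff[OF G conn] by blast
  define R :: "nat \<Rightarrow> nat \<Rightarrow> 'c poly" where
    "R i j = (SOME R. (\<forall>N. poly R (of_nat N) = (\<Sum>k<N. of_nat k ^ i * of_nat (N - k) ^ j)) \<and>
       coeff R 1 = (- 1) ^ j * of_rat (bernoulli (i + j)))" for i j
  have R: "poly (R i j) (of_nat N) = (\<Sum>k<N. of_nat k ^ i * of_nat (N - k) ^ j)"
    "coeff (R i j) 1 = (- 1) ^ j * of_rat (bernoulli (i + j))" for i j N
    using someI_ex[OF mixed_power_sum_poly[of i j, where 'k='c]] unfolding R_def by auto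
  let ?o = "\<lambda>H. omega \<beta> (subquiver G X H)" and ?C = "\<lambda>H. comp_of G H ` X"
  let ?d = "\<lambda>H \<A>. (\<Prod>C\<in>\<A>. ?w C {s}) * (\<Prod>C\<in>?C H - \<A>. ?w {s} C) * pair_weight ?w \<A> (?C H - \<A>)
      * order_vol ?w \<A> * order_vol ?w (?C H - \<A>)"
  define M where "M = (\<Sum>H\<in>closed_cuts G X. \<Sum>\<A>\<in>Pow (?C H). smult (?o H * ?d H \<A>) (R (card \<A>) (card
      (?C H - \<A>))))"
  have "poly L (of_nat N) = poly M (of_nat N)" for N
  proof -
    have "poly L (of_nat N) = (\<Sum>k<N. \<Sum>H\<in>closed_cuts G X. ?o H *
        two_sided ?w (\<lambda>C. ?w C {s} * of_nat k) (\<lambda>C. ?w {s} C * of_nat (N - k)) (?C H))"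
      unfolding L(1) X(3)[symmetric] Phi_semi_root[OF G s X(1,2)] Phi_sandwich[OF G X(1)] ..
    also have "\<dots> = (\<Sum>H\<in>closed_cuts G X. \<Sum>\<A>\<in>Pow (?C H). ?o H * ?d H \<A> *
        (\<Sum>k<N. of_nat k ^ card \<A> * of_nat (N - k) ^ card (?C H - \<A>)))"
      unfolding two_sided_scale sum_distrib_left
      by (subst sum.swap, rule sum.cong[OF refl], subst sum.swap) (simp only: mult.assoc)
    also have "\<dots> = poly M (of_nat N)"
      by (simp add: M_def poly_sum R(1))
    finally show ?thesis .
  qed
  then have "L = M" by (rule poly_eq_if_eq_on_nat)
  then have "omega \<beta> G = coeff M 1" using L(2) by simp
  also have "\<dots> = (\<Sum>H\<in>closed_cuts G X. \<Sum>\<A>\<in>Pow (?C H). ?o H * ?d H \<A> *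
      ((- 1) ^ card (?C H - \<A>) * of_rat (bernoulli (card \<A> + card (?C H - \<A>)))))"
    unfolding M_def coeff_sum coeff_smult R(2) ..
  also have "\<dots> = (\<Sum>H\<in>closed_cuts G X. ?o H * (of_rat (bernoulli (card (?C H))) *
      two_sided ?w (\<lambda>C. ?w C {s}) (\<lambda>C. - ?w {s} C) (?C H)))"
    unfolding two_sided_def sum_distrib_left
  proof (intro sum.cong refl)
    fix H \<A> assume "\<A> \<in> Pow (?C H)"
    then have \<A>: "\<A> \<subseteq> ?C H" by simp
    then have finA: "finite \<A>" using finite_subset[OF _ finite_imageI[OF finX]] by blast
    have "card \<A> + card (?C H - \<A>) = card (?C H)"
      using \<A> finA finX by (simp add: card_Diff_subset card_mono)
    moreover have "(\<Prod>C\<in>?C H - \<A>. - ?w {s} C) = (- 1) ^ card (?C H - \<A>) * (\<Prod>C\<in>?C H - \<A>. ?w {s} C)"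
      by (rule prod_uminus)
    ultimately show "?o H * ?d H \<A> * ((- 1) ^ card (?C H - \<A>) * of_rat (bernoulli (card \<A> + card
        (?C H - \<A>))))
       = ?o H * (of_rat (bernoulli (card (?C H))) * ((\<Prod>C\<in>\<A>. ?w C {s}) * (\<Prod>C\<in>?C H - \<A>. - ?w {s} C) *
          pair_weight ?w \<A> (?C H - \<A>) * order_vol ?w \<A> * order_vol ?w (?C H - \<A>)))"
      by (simp only: mult_ac)
  qed
  finally show ?thesis .
qed

section \<open>Spider webs and linear orders\<close>

text \<open>
  Reversing the arcs in \<open>F\<close>.
\<close>

definition flip :: "'b set \<Rightarrow> ('a, 'b) pre_digraph \<Rightarrow> ('a, 'b) pre_digraph" where
  "flip F Q = Q\<lparr>tail := (\<lambda>a. if a \<in> F then head Q a else tail Q a),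
                head := (\<lambda>a. if a \<in> F then tail Q a else head Q a)\<rparr>"

lemma flip_simps [simp]:
  "verts (flip F Q) = verts Q" "arcs (flip F Q) = arcs Q"
  "tail (flip F Q) a = (if a \<in> F then head Q a else tail Q a)"
  "head (flip F Q) a = (if a \<in> F then tail Q a else head Q a)"
  by (simp_all add: flip_def)

lemma flip_in_orientations: "F \<subseteq> arcs Q \<Longrightarrow> flip F Q \<in> orientations Q"
  by (auto simp: orientations_def arc_to_ends_def)

lemma orientation_eq_flip:
  assumes "\<Gamma> \<in> orientations Q"
  shows "\<Gamma> = flip {a \<in> arcs Q. arc_to_ends \<Gamma> a \<noteq> arc_to_ends Q a} Q"
  using assms by (intro pre_digraph.equality ext) (auto simp: orientations_def arc_to_ends_def)

lemma orientations_eq_flips: "orientations Q = (\<lambda>F. flip F Q) ` Pow (arcs Q)"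
  using orientation_eq_flip flip_in_orientations by (intro equalityI subsetI) blast+

lemma fin_digraph_flip:
  assumes "fin_digraph Q" shows "fin_digraph (flip F Q)"
proof -
  interpret fin_digraph Q by fact
  show ?thesis by unfold_locales auto
qed

lemma tadpoles_flip [simp]: "tadpoles (flip F Q) = tadpoles Q"
  by (auto simp: tadpoles_def)

lemma finite_spider_webs: "fin_digraph Q \<Longrightarrow> finite (spider_webs s Q)"
  by (simp add: spider_webs_def orientations_eq_flips fin_digraph_def fin_digraph_axioms_def)

text \<open>
  A tadpole stays one in every orientation. Choosing it at its vertex gives a walk to the root that
  can be prolonged by the tadpole, so walks are not unique.
\<close>

lemma spider_webs_tadpole:
  assumes Q: "fin_digraph Q" and tad: "tadpoles Q \<noteq> {}"
  shows "spider_webs s Q = {}"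
proof (rule ccontr)
  assume "spider_webs s Q \<noteq> {}"
  then obtain \<Gamma> where \<Gamma>: "\<Gamma> \<in> orientations Q" "almost_rooted \<Gamma> s" by (auto simp: spider_webs_def)
  obtain F where F: "\<Gamma> = flip F Q" using orientation_eq_flip[OF \<Gamma>(1)] by blast
  interpret fin_digraph \<Gamma> unfolding F by (rule fin_digraph_flip[OF Q])
  obtain a where a: "a \<in> arcs \<Gamma>" "tail \<Gamma> a = head \<Gamma> a"
    using tad tadpoles_flip[of F Q] unfolding F by (auto simp: tadpoles_def)
  let ?v = "tail \<Gamma> a"
  define c where "c u = (if u = ?v then a else SOME b. b \<in> out_arcs \<Gamma> u)" for u
  let ?T = "\<Gamma>\<lparr>arcs := c ` (verts \<Gamma> - {s})\<rparr>"
  have s: "out_arcs \<Gamma> s = {}" and out: "\<And>v. v \<in> verts \<Gamma> - {s} \<Longrightarrow> out_arcs \<Gamma> v \<noteq> {}"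
    using \<Gamma>(2) by (auto simp: almost_rooted_def)
  have v: "?v \<in> verts \<Gamma> - {s}" using a s by auto
  have c: "\<forall>u\<in>verts \<Gamma> - {s}. c u \<in> out_arcs \<Gamma> u"
  proof
    fix u assume "u \<in> verts \<Gamma> - {s}"
    then have "(SOME b. b \<in> out_arcs \<Gamma> u) \<in> out_arcs \<Gamma> u"
      using out by (simp only: some_in_eq) simp
    then show "c u \<in> out_arcs \<Gamma> u" using a by (auto simp: c_def)
  qed
  then have T: "rooted_tree ?T s" using \<Gamma>(2) by (simp add: almost_rooted_def)
  have sub: "e \<in> arcs \<Gamma>" if "e \<in> c ` (verts \<Gamma> - {s})" for e using that c by auto
  interpret T: wf_digraph ?T by unfold_locales (simp_all add: sub)
  have uniq: "\<exists>!p. T.awalk ?v p s" using T v by (auto simp: rooted_tree_def)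
  then obtain p where p: "T.awalk ?v p s" by blast
  have "a \<in> arcs ?T" using v by (auto simp: c_def intro!: image_eqI[of _ _ ?v])
  then have "T.awalk ?v (a # p) s" using p a(2) by (simp add: T.awalk_Cons_iff)
  then have "p = a # p" using uniq p by blast
  then show False by simp
qed

text \<open>
  The orientation in which all arcs point upwards along \<open>r\<close>.
\<close>

definition orient :: "'a rel \<Rightarrow> ('a, 'b) pre_digraph \<Rightarrow> ('a, 'b) pre_digraph" where
  "orient r Q = flip {a \<in> arcs Q. (tail Q a, head Q a) \<notin> r} Q"

lemma orient_iff:
  assumes Q: "fin_digraph Q" and tad: "tadpoles Q = {}" and r: "r \<in> linear_orders (verts Q)"
    and \<Gamma>: "\<Gamma> \<in> orientations Q"
  shows "(\<forall>a\<in>arcs \<Gamma>. (tail \<Gamma> a, head \<Gamma> a) \<in> r) \<longleftrightarrow> \<Gamma> = orient r Q"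
proof -
  interpret fin_digraph Q by fact
  obtain F where F: "F \<subseteq> arcs Q" "\<Gamma> = flip F Q" using \<Gamma> by (auto simp: orientations_eq_flips)
  have "(tail Q a, head Q a) \<notin> r \<longleftrightarrow> (head Q a, tail Q a) \<in> r" if "a \<in> arcs Q" for a
    using that tad linear_ordersD(5)[OF r, of "tail Q a" "head Q a"] linear_ordersD(3)[OF r]
    by (auto simp: tadpoles_def dest: antisymD)
  then have "(\<forall>a\<in>arcs \<Gamma>. (tail \<Gamma> a, head \<Gamma> a) \<in> r) \<longleftrightarrow> F = {a \<in> arcs Q. (tail Q a, head Q a) \<notin> r}"
    using F by auto
  also have "\<dots> \<longleftrightarrow> \<Gamma> = orient r Q"
  proof
    assume "\<Gamma> = orient r Q"
    then have eq: "tail (flip F Q) a = tail (orient r Q) a" for a using F(2) by simp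
    have "a \<in> F \<longleftrightarrow> a \<in> {a \<in> arcs Q. (tail Q a, head Q a) \<notin> r}" if "a \<in> arcs Q" for a
      using eq[of a] tad that by (auto simp: orient_def tadpoles_def split: if_splits)
    then show "F = {a \<in> arcs Q. (tail Q a, head Q a) \<notin> r}" using F(1) by blast
  qed (simp add: F(2) orient_def)
  finally show ?thesis .
qed

lemma out_arcs_orient:
  assumes Q: "fin_digraph Q" and tad: "tadpoles Q = {}" and r: "r \<in> linear_orders (verts Q)"
  shows "out_arcs (orient r Q) v = {a \<in> arcs Q. tail Q a \<in> {v} \<and> head Q a \<in> strictly_above r v}
      \<union> {a \<in> arcs Q. tail Q a \<in> strictly_above r v \<and> head Q a \<in> {v}}" (is "_ = ?U \<union> ?D")
    and "opposite_arcs Q (orient r Q) (out_arcs (orient r Q) v)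
      = {a \<in> arcs Q. tail Q a \<in> strictly_above r v \<and> head Q a \<in> {v}}"
proof -
  interpret fin_digraph Q by fact
  have *: "(tail Q a, head Q a) \<notin> r \<longleftrightarrow> (head Q a, tail Q a) \<in> r" "tail Q a \<noteq> head Q a"
      if "a \<in> arcs Q" for a
    using that tad linear_ordersD(5)[OF r, of "tail Q a" "head Q a"] linear_ordersD(3)[OF r]
    by (auto simp: tadpoles_def dest: antisymD)
  show out: "out_arcs (orient r Q) v = ?U \<union> ?D"
  proof (intro set_eqI)
    fix a show "a \<in> out_arcs (orient r Q) v \<longleftrightarrow> a \<in> ?U \<union> ?D"
      using *[of a] by (auto simp: out_arcs_def orient_def strictly_above_def)
  qed
  show "opposite_arcs Q (orient r Q) (out_arcs (orient r Q) v) = ?D"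
  proof (intro set_eqI)
    fix a show "a \<in> opposite_arcs Q (orient r Q) (out_arcs (orient r Q) v) \<longleftrightarrow> a \<in> ?D"
      unfolding opposite_arcs_def out
      using *[of a] by (auto simp: orient_def strictly_above_def arc_to_ends_def)
  qed
qed

lemma s_coeff_orient:
  assumes Q: "fin_digraph Q" and tad: "tadpoles Q = {}" and r: "r \<in> linear_orders (verts Q)"
  shows "s_coeff \<beta> (out_arcs (orient r Q) v) (opposite_arcs Q (orient r Q) (out_arcs (orient r Q) v))
    = beta_weight Q \<beta> {v} (strictly_above r v) - beta_weight Q \<beta> (strictly_above r v) {v}"
proof -
  have disj: "{a \<in> arcs Q. tail Q a \<in> {v} \<and> head Q a \<in> strictly_above r v} \<inter>
     {a \<in> arcs Q. tail Q a \<in> strictly_above r v \<and> head Q a \<in> {v}} = {}"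
    by (auto simp: strictly_above_def)
  have d: "U \<union> D - D = U" if "U \<inter> D = {}" for U D :: "'b set" using that by auto
  show ?thesis
    unfolding s_coeff_def out_arcs_orient(2)[OF assms]
    unfolding out_arcs_orient(1)[OF assms] d[OF disj] arc_weight_def
    by (simp add: mult.commute)
qed

lemma g_coeff_orient:
  assumes Q: "fin_digraph Q" and tad: "tadpoles Q = {}" and r: "r \<in> linear_orders (verts Q)"
    and s: "s \<in> verts Q"
  shows "g_coeff \<beta> s Q (orient r Q)
    = (\<Prod>v\<in>verts Q. spider_weight (\<lambda>u v. beta_weight Q \<beta> {u} {v}) s v (strictly_above r v))"
proof -
  interpret fin_digraph Q by fact
  have fin: "finite (strictly_above r v)" for v
    using finite_subset[OF strictly_above_subset[OF r] finite_verts] .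
  have "(\<Prod>v\<in>verts Q. spider_weight (\<lambda>u v. beta_weight Q \<beta> {u} {v}) s v (strictly_above r v))
      = (\<Prod>v\<in>verts Q - {s}. spider_weight (\<lambda>u v. beta_weight Q \<beta> {u} {v}) s v (strictly_above r v))"
    using s by (subst prod.remove[of _ s]) (auto simp: spider_weight_def)
  also have "\<dots> = (\<Prod>v\<in>verts Q - {s}. beta_weight Q \<beta> {v} (strictly_above r v) - beta_weight Q \<beta>
      (strictly_above r v) {v})"
    by (intro prod.cong refl) (simp add: spider_weight_def pair_weight_arc_weight_singletons fin)
  finally show ?thesis by (simp add: g_coeff_def s_coeff_orient[OF Q tad r])
qed

text \<open>
  If \<open>g\<close> does not vanish, then every vertex other than \<open>s\<close> has an outgoing arc, so \<open>s\<close> is the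
  greatest element. Following chosen outgoing arcs moves upwards and therefore ends in \<open>s\<close>.
\<close>

lemma almost_rooted_orient:
  assumes Q: "fin_digraph Q" and tad: "tadpoles Q = {}" and r: "r \<in> linear_orders (verts Q)"
    and s: "s \<in> verts Q" and g: "g_coeff \<beta> s Q (orient r Q) \<noteq> 0"
  shows "almost_rooted (orient r Q) s"
proof -
  interpret fin_digraph Q by fact
  let ?\<Gamma> = "orient r Q"
  interpret \<Gamma>: fin_digraph ?\<Gamma> unfolding orient_def by (rule fin_digraph_flip[OF Q])
  have V: "verts ?\<Gamma> = verts Q" "arcs ?\<Gamma> = arcs Q" by (simp_all add: orient_def)
  have up: "head ?\<Gamma> a \<in> strictly_above r v \<and> tail ?\<Gamma> a = v" if "a \<in> out_arcs ?\<Gamma> v" for a v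
    using that linear_ordersD(5)[OF r, of "tail Q a" "head Q a"] unfolding out_arcs_orient[OF Q tad r]
    using linear_ordersD(3)[OF r]
    by (auto simp: orient_def strictly_above_def dest: antisymD)
  have out: "out_arcs ?\<Gamma> v \<noteq> {}" if v: "v \<in> verts Q - {s}" for v
  proof
    assume "out_arcs ?\<Gamma> v = {}"
    then have "s_coeff \<beta> (out_arcs ?\<Gamma> v) (opposite_arcs Q ?\<Gamma> (out_arcs ?\<Gamma> v)) = 0"
      by (simp add: s_coeff_def opposite_arcs_def)
    then have "g_coeff \<beta> s Q ?\<Gamma> = 0" using v unfolding g_coeff_def by (intro prod_zero) auto
    then show False using g by simp
  qed
  obtain m where m: "m \<in> verts Q" "\<forall>y\<in>verts Q. (y, m) \<in> r"
    using linear_order_greatest[OF r finite_verts] s by blast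
  have top: "strictly_above r m = {}"
    using m linear_ordersD(1,3)[OF r] by (auto simp: strictly_above_def dest: antisymD)
  have "m = s" using out[of m] up[of _ m] m(1) top by blast
  then have outs: "out_arcs ?\<Gamma> s = {}" using up[of _ s] top by blast
  have "rooted_tree (?\<Gamma>\<lparr>arcs := c ` (verts Q - {s})\<rparr>) s"
    if c: "\<forall>v\<in>verts Q - {s}. c v \<in> out_arcs ?\<Gamma> v" for c
  proof -
    let ?T = "?\<Gamma>\<lparr>arcs := c ` (verts Q - {s})\<rparr>"
    have sub: "e \<in> arcs ?\<Gamma>" if "e \<in> c ` (verts Q - {s})" for e using that c by auto
    interpret T: wf_digraph ?T by unfold_locales (simp_all add: sub)
    have ct: "tail ?\<Gamma> (c u) = u" if "u \<in> verts Q - {s}" for u using c that V by auto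
    have "\<exists>!p. T.awalk v p s" if "v \<in> verts Q" for v
      using that
    proof (induction "card (strictly_above r v)" arbitrary: v rule: less_induct)
      case less
      show ?case
      proof (cases "v = s")
        case True
        have "p = []" if p: "T.awalk s p s" for p
        proof (rule ccontr)
          assume "p \<noteq> []"
          then obtain a q where "p = a # q" by (cases p) auto
          then have "a \<in> c ` (verts Q - {s})" and a: "tail ?\<Gamma> a = s"
            using p by (auto simp: T.awalk_Cons_iff V)
          then obtain u where "u \<in> verts Q - {s}" "a = c u" by blast
          then show False using ct a by auto
        qed
        moreover have "T.awalk s [] s" using s by (simp add: T.awalk_Nil_iff V)
        ultimately show ?thesis unfolding True by blast
      next
        case False
        let ?u = "head ?\<Gamma> (c v)"
        have vs: "v \<in> verts Q - {s}" using False less.prems by simp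
        then have cv: "c v \<in> out_arcs ?\<Gamma> v" using c V by simp
        have u: "?u \<in> strictly_above r v" using up[OF cv] by simp
        then have uV: "?u \<in> verts Q" using strictly_above_subset[OF r] by blast
        have "strictly_above r ?u \<subset> strictly_above r v"
          using u linear_ordersD(2,3)[OF r] unfolding strictly_above_def trans_def antisym_def
          by blast
        moreover have "finite (strictly_above r v)"
          using finite_subset[OF strictly_above_subset[OF r] finite_verts] .
        ultimately have "card (strictly_above r ?u) < card (strictly_above r v)"
          by (intro psubset_card_mono)
        from less.hyps[OF this uV] obtain p where p: "T.awalk ?u p s" "\<And>q. T.awalk ?u q s \<Longrightarrow> q = p"
            by blast
        have "T.awalk v (c v # p) s" using p(1) vs ct[OF vs] by (simp add: T.awalk_Cons_iff V)
        moreover have "q = c v # p" if q: "T.awalk v q s" for q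
        proof (cases q)
          case Nil
          then show ?thesis using q False by (simp add: T.awalk_Nil_iff)
        next
          case (Cons a q')
          then have "a \<in> c ` (verts Q - {s})" and a: "tail ?\<Gamma> a = v" "T.awalk (head ?\<Gamma> a) q' s"
            using q by (simp_all add: T.awalk_Cons_iff)
          then obtain u where "u \<in> verts Q - {s}" "a = c u" by blast
          then have "a = c v" using ct[of u] a(1) by simp
          then show ?thesis using p(2) a(2) Cons by simp
        qed
        ultimately show ?thesis by blast
      qed
    qed
    then show ?thesis using s by (simp add: rooted_tree_def V)
  qed
  then show ?thesis using s out outs by (simp add: almost_rooted_def V)
qed

text \<open>
  The pairs of a spider web and one of its linear extensions are the linear orders whose upward
  orientation is a spider web; on the others \<open>g\<close> vanishes.
\<close>

lemma sum_spider_webs: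
  assumes Q: "fin_digraph Q" and s: "s \<in> verts Q"
  shows "(\<Sum>\<Gamma>\<in>spider_webs s Q. e_char \<beta> \<Gamma> * g_coeff \<beta> s Q \<Gamma>) = (if tadpoles Q = {}
    then order_sum (spider_weight (\<lambda>u v. beta_weight Q \<beta> {u} {v}) s) (verts Q) / fact (card
        (verts Q)) else 0)"
proof (cases "tadpoles Q = {}")
  case False
  then show ?thesis using spider_webs_tadpole[OF Q] by simp
next
  case True
  interpret fin_digraph Q by fact
  let ?L = "linear_orders (verts Q)" and ?g = "g_coeff \<beta> s Q"
  have e: "e_char \<beta> \<Gamma> = (\<Sum>r\<in>?L. if \<Gamma> = orient r Q then 1 else 0) / fact (card (verts Q))"
    if \<Gamma>: "\<Gamma> \<in> spider_webs s Q" for \<Gamma>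
  proof -
    have o: "\<Gamma> \<in> orientations Q" using \<Gamma> by (simp add: spider_webs_def)
    obtain F where F: "\<Gamma> = flip F Q" using orientation_eq_flip[OF o] by blast
    have fin: "fin_digraph \<Gamma>" unfolding F by (rule fin_digraph_flip[OF Q])
    have V: "verts \<Gamma> = verts Q" "arcs \<Gamma> = arcs Q" "tadpoles \<Gamma> = {}" by (simp_all add: F True)
    have "(\<Prod>a\<in>arcs \<Gamma>. if tail \<Gamma> a = head \<Gamma> a then - beta_minus \<beta> a
          else if (tail \<Gamma> a, head \<Gamma> a) \<in> r then 1 else 0) = (if \<Gamma> = orient r Q then 1 else 0)"
      if r: "r \<in> ?L" for r
    proof -
      have "(\<Prod>a\<in>arcs \<Gamma>. if tail \<Gamma> a = head \<Gamma> a then - beta_minus \<beta> a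
          else if (tail \<Gamma> a, head \<Gamma> a) \<in> r then 1 else 0)
        = (\<Prod>a\<in>arcs \<Gamma>. if (tail \<Gamma> a, head \<Gamma> a) \<in> r then 1 else 0)"
        using V(3) by (intro prod.cong refl) (auto simp: tadpoles_def)
      also have "\<dots> = (if \<forall>a\<in>arcs \<Gamma>. (tail \<Gamma> a, head \<Gamma> a) \<in> r then 1 else 0)"
        unfolding V(2) by (auto intro!: prod_zero)
      finally show ?thesis by (simp only: orient_iff[OF Q True r o])
    qed
    then show ?thesis unfolding e_char_eq_sum[OF fin] V(1) by simp
  qed
  have "(\<Sum>\<Gamma>\<in>spider_webs s Q. e_char \<beta> \<Gamma> * ?g \<Gamma>)
      = (\<Sum>\<Gamma>\<in>spider_webs s Q. \<Sum>r\<in>?L. if \<Gamma> = orient r Q then ?g \<Gamma> else 0) / fact (card (verts Q))"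
    unfolding sum_divide_distrib
  proof (rule sum.cong[OF refl])
    fix \<Gamma> assume \<Gamma>: "\<Gamma> \<in> spider_webs s Q"
    have "(\<Sum>r\<in>?L. if \<Gamma> = orient r Q then ?g \<Gamma> else 0) = (\<Sum>r\<in>?L. if \<Gamma>
        = orient r Q then 1 else 0) * ?g \<Gamma>"
      unfolding sum_distrib_right by (intro sum.cong refl) simp
    then show "e_char \<beta> \<Gamma> * ?g \<Gamma> = (\<Sum>r\<in>?L. (if \<Gamma> = orient r Q then ?g \<Gamma> else 0) / fact (card
        (verts Q)))"
      by (simp add: e[OF \<Gamma>] sum_divide_distrib[symmetric])
  qed
  also have "\<dots> = (\<Sum>r\<in>?L. \<Sum>\<Gamma>\<in>spider_webs s Q. if \<Gamma> = orient r Q then ?g \<Gamma> else 0) / fact (card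
      (verts Q))"
    by (subst sum.swap) simp
  also have "\<dots> = (\<Sum>r\<in>?L. ?g (orient r Q)) / fact (card (verts Q))"
  proof -
    have "(\<Sum>\<Gamma>\<in>spider_webs s Q. if \<Gamma> = orient r Q then ?g \<Gamma> else 0) = ?g (orient r Q)"
        if r: "r \<in> ?L" for r
    proof -
      have "orient r Q \<in> orientations Q"
        unfolding orient_def by (rule flip_in_orientations) auto
      then have "orient r Q \<in> spider_webs s Q" if "?g (orient r Q) \<noteq> 0"
        using almost_rooted_orient[OF Q True r s that] by (simp add: spider_webs_def)
      then show ?thesis by (auto simp: sum.delta finite_spider_webs[OF Q])
    qed
    then show ?thesis by simp
  qed
  also have "\<dots> = order_sum (spider_weight (\<lambda>u v. beta_weight Q \<beta> {u} {v}) s) (verts Q) / fact (card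
      (verts Q))"
    by (simp add: order_sum_def g_coeff_orient[OF Q True _ s] cong: sum.cong)
  finally show ?thesis using True by simp
qed

section \<open>The spider web formula\<close>

text \<open>
  The factorials cancel: the components other than \<open>{s}\<close> contribute \<open>fact (nu K - 1)\<close>, and
  \<open>nu K * fact (nu K - 1)\<close> is the denominator \<open>fact (nu K)\<close> in \<open>e\<close>.
\<close>

lemma spider_sum_summand:
  assumes G: "fin_digraph G" and s: "semi_root G s" and H: "H \<subseteq> inside G (verts G - {s})"
  defines "K \<equiv> subquiver G (verts G) H" and "X \<equiv> verts G - {s}"
  shows "of_nat (nu K) * of_rat (bernoulli (nu K - 1)) * omega \<beta> K *
      (\<Sum>\<Gamma>\<in>spider_webs {s} (contract G K). e_char \<beta> \<Gamma> * g_coeff \<beta> {s} (contract G K) \<Gamma>)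
    = (if H \<in> closed_cuts G X then omega \<beta> (subquiver G X H) *
        (of_rat (bernoulli (card (comp_of G H ` X))) *
         two_sided (beta_weight G \<beta>) (\<lambda>C. beta_weight G \<beta> C {s}) (\<lambda>C. - beta_weight G \<beta> {s} C)
           (comp_of G H ` X)) else 0)"
proof -
  interpret fin_digraph G by fact
  let ?V = "verts G" and ?w = "beta_weight G \<beta>" and ?C = "comp_of G H ` X"
  let ?Q = "contract G K"
  have sV: "s \<in> ?V" and out: "\<And>a. a \<in> arcs G \<Longrightarrow> tail G a \<noteq> s"
    using s by (auto simp: semi_root_def out_arcs_def)
  have X: "X \<subseteq> ?V" "X \<inter> {s} = {}" "X \<union> {s} = ?V" "finite X" using sV by (auto simp: X_def)
  have HX: "H \<subseteq> inside G X" using H by (simp add: X_def)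
  have HV: "H \<subseteq> inside G ?V" using HX inside_mono[OF X(1), of G] by blast
  have E: "inside G ?V = arcs G" by (auto simp: inside_def)
  have Q: "?Q = contract (subquiver G ?V (inside G ?V)) (subquiver G ?V H)"
    unfolding K_def E by (simp add: subquiver_def)
  note c = contract_subquiver[OF order_refl HV, folded Q]
  have empty: "{} \<subseteq> inside G {s}" by simp
  have comps: "comp_of G H ` ?V = insert {s} ?C" "{s} \<notin> ?C"
    using comp_image_Un[OF HX empty X(2)] unfolding X(3) by auto
  have finC: "finite ?C" using X(4) by simp
  have nuK: "nu K = Suc (card ?C)"
    unfolding nu_def K_def components_subquiver[OF HV] comps(1) using comps(2) finC by simp
  have vQ: "verts ?Q = insert {s} ?C" unfolding c(1) comps(1) ..
  have Qfin: "fin_digraph ?Q"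
    unfolding Q by (rule fin_digraph_contract_subquiver[OF G _ _ HV]) auto
  have om: "omega \<beta> K = omega \<beta> (subquiver G X H)"
    using omega_disjoint_union[OF G X(1) _ X(2) HX empty, of \<beta>] sV
    unfolding X(3) K_def by (simp add: omega_isolated_vertex[OF G])
  have tad: "tadpoles ?Q = {} \<longleftrightarrow> H \<in> closed_cuts G X"
  proof
    assume t: "tadpoles ?Q = {}"
    have "comp_of G H (tail G a) \<noteq> comp_of G H (head G a)" if a: "a \<in> inside G X - H" for a
    proof -
      have a': "a \<in> inside G ?V" "a \<notin> H" using a inside_mono[OF X(1), of G] by auto
      then have "a \<in> arcs ?Q" unfolding c(2) by simp
      then show ?thesis using t c(3,4)[OF a'(1)] by (auto simp: tadpoles_def)
    qed
    then show "H \<in> closed_cuts G X" using HX by (simp add: closed_cuts_def)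
  next
    assume cl: "H \<in> closed_cuts G X"
    have "inside G {s} = {}" using out by (auto simp: inside_def)
    then have "{} \<in> closed_cuts G {s}" by (simp add: closed_cuts_def)
    from closed_cuts_Un(1)[OF cl this X(2)] have "H \<in> closed_cuts G ?V" unfolding X(3) by simp
    then have "tail ?Q a \<noteq> head ?Q a" if "a \<in> arcs ?Q" for a
      using that c(3,4)[of a] unfolding c(2) by (simp add: closed_cuts_def)
    then show "tadpoles ?Q = {}" by (auto simp: tadpoles_def)
  qed
  have wQ: "beta_weight ?Q \<beta> {C} {D} = ?w C D" if "C \<in> insert {s} ?C" "D \<in> insert {s} ?C" "C \<noteq> D"
      for C D
    unfolding Q using that by (intro arc_weight_contract[OF HV]) (auto simp: comps(1))
  have "two_sided (\<lambda>C D. beta_weight ?Q \<beta> {C} {D}) (\<lambda>C. beta_weight ?Q \<beta> {C} {{s}})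
        (\<lambda>C. - beta_weight ?Q \<beta> {{s}} {C}) ?C
      = two_sided ?w (\<lambda>C. ?w C {s}) (\<lambda>C. - ?w {s} C) ?C"
  proof (rule two_sided_cong)
    show "beta_weight ?Q \<beta> {C} {D} = ?w C D" if "C \<in> ?C" "D \<in> ?C" "C \<noteq> D" for C D
      using that by (intro wQ) simp_all
    show "beta_weight ?Q \<beta> {C} {{s}} = ?w C {s}" "- beta_weight ?Q \<beta> {{s}} {C} = - ?w {s} C"
      if C: "C \<in> ?C" for C
    proof -
      have "C \<noteq> {s}" using C comps(2) by metis
      then show "beta_weight ?Q \<beta> {C} {{s}} = ?w C {s}" "- beta_weight ?Q \<beta> {{s}} {C} = - ?w {s} C"
        using C wQ[of C "{s}"] wQ[of "{s}" C] by simp_all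
    qed
  qed
  then have web: "(\<Sum>\<Gamma>\<in>spider_webs {s} ?Q. e_char \<beta> \<Gamma> * g_coeff \<beta> {s} ?Q \<Gamma>)
      = (if H \<in> closed_cuts G X then fact (card ?C) *
         two_sided ?w (\<lambda>C. ?w C {s}) (\<lambda>C. - ?w {s} C) ?C / fact (Suc (card ?C)) else 0)"
    using sum_spider_webs[OF Qfin, of "{s}" \<beta>] order_sum_spider_weight[OF finC comps(2),
        of "\<lambda>C D. beta_weight ?Q \<beta> {C} {D}"]
    unfolding vQ tad by (simp only: insertI1 simp_thms card_insert_disjoint[OF finC comps(2)])
  have "of_nat (Suc n) * (fact n * x / fact (Suc n)) = (x :: 'c)" for n x
    by (simp add: field_simps del: of_nat_Suc)
  then show ?thesis
    unfolding web nuK om by (simp add: mult.assoc mult.left_commute del: of_nat_Suc fact_Suc)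
qed

lemma isolating_cuts_eq:
  assumes "fin_digraph G"
  shows "isolating_cuts s G = subquiver G (verts G) ` Pow (inside G (verts G - {s}))"
proof -
  interpret fin_digraph G by fact
  have "cut_subquivers G = subquiver G (verts G) ` Pow (arcs G)"
    by (subst cut_subquivers_eq) (use wf_digraph in \<open>simp_all add: subquiver_def\<close>)
  then show ?thesis unfolding isolating_cuts_def by (auto simp: inside_def intro!: imageI)
qed

lemma omega_eq_spider_sum:
  assumes G: "fin_digraph G" and conn: "Digraph_Component.connected G" and s: "semi_root G s"
  shows "omega \<beta> G = spider_sum \<beta> s G"
proof -
  interpret fin_digraph G by fact
  let ?X = "verts G - {s}"
  let ?f = "\<lambda>H. omega \<beta> (subquiver G ?X H) * (of_rat (bernoulli (card (comp_of G H ` ?X))) *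
      two_sided (beta_weight G \<beta>) (\<lambda>C. beta_weight G \<beta> C {s}) (\<lambda>C. - beta_weight G \<beta> {s} C)
          (comp_of G H ` ?X))"
  have "spider_sum \<beta> s G = (\<Sum>H\<in>Pow (inside G ?X). if H \<in> closed_cuts G ?X then ?f H else 0)"
    unfolding spider_sum_def isolating_cuts_eq[OF G] sum.reindex[OF inj_subquiver] o_def
    by (rule sum.cong[OF refl]) (rule spider_sum_summand[OF G s], simp)
  also have "\<dots> = (\<Sum>H\<in>closed_cuts G ?X. ?f H)"
    by (intro sum.mono_neutral_cong_right) (auto simp: finite_inside closed_cuts_def)
  also have "\<dots> = omega \<beta> G" by (rule omega_eq_two_sided[OF G conn s, symmetric])
  finally show ?thesis by simp
qed

theorem theorem11p8:
  fixes G :: "('a, 'b) pre_digraph" and \<beta> :: "'b \<Rightarrow> 'k::field_char_0"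
  assumes "fin_digraph G" and "Digraph_Component.connected G" and "acyclic_quiver G"
  shows "(\<forall>s. semi_root G s \<longrightarrow> omega_c \<beta> G = spider_sum \<beta> s G) \<and>
    (\<forall>s s'. semi_root G s \<longrightarrow> semi_root G s' \<longrightarrow> spider_sum \<beta> s G = spider_sum \<beta> s' G)"
  by (simp add: omega_c_def assms(2) omega_eq_spider_sum[OF assms(1,2), symmetric])

end
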